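(* For all $n\ge 2$, $\mathbf{H}(S_n)$ factors as $\mathbf{H}(S_n)=\mathbf{D}(S_n)\cdot \mathbb{Z}S_n$ over $\mathbb{Z}$, i.e., the multiplication map defines an isomorphism of $\mathbb{Z}$-modules $\mathbf{D}(S_n)\otimes_{\mathbb{Z}} \mathbb{Z}S_n\to \mathbf{H}(S_n)$.
   Context: For $n\ge 2$, $\mathbf{H}(S_n)$ denotes the (unital associative) $\mathbb{Z}$-algebra generated by $s_i$ and $D_i$, $i=1,\ldots,n-1$, subject to the relations: (1) $s_i^2=1$, $s_iD_i+D_is_i=s_i-1$, $D_i^2=D_i$ for $i=1,\ldots,n-1$; (2) $s_js_i=s_is_j$, $D_js_i=s_iD_j$, $D_jD_i=D_iD_j$ if $|i-j|>1$; (3) $s_js_is_j=s_is_js_i$, $D_is_js_i=s_js_iD_j$, $D_js_iD_j=s_iD_jD_i+D_iD_js_i+s_iD_js_i$ if $|i-j|=1$. The group ring $\mathbb{Z}S_n$ maps to $\mathbf{H}(S_n)$ by sending the simple transposition $(i,i+1)$ to $s_i$. The elements $D_{ij}\in\mathbf{H}(S_n)$, $1\le i<j\le n$, are defined by $D_{i,i+1}=D_i$ and $wD_{ij}w^{-1}=D_{w(i),w(j)}$ for any permutation $w\in S_n$ such that $w(i)<w(j)$ (these elements are well-defined). $\mathbf{D}(S_n)$ is the subalgebra of $\mathbf{H}(S_n)$ generated by all $D_{ij}$, $1\le i<j\le n$. *)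

theory Defs
  imports "HOL-Algebra.Algebra"
begin

section \<open>Integral monoid rings\<close>

text \<open>
  The ring \<open>\<int>[M]\<close> of a monoid \<open>M\<close>: finitely supported integer-valued functions on \<open>M\<close> under
  convolution.  Its additive group is the free abelian group on \<open>M\<close>; \<^const>\<open>frag_of\<close> embeds
  \<open>M\<close> as a basis and \<^const>\<open>frag_extend\<close> is linear extension from that basis, so the product is
  the bilinear extension of the product of \<open>M\<close>.  It provides both the free algebra
  (\<open>M\<close> a free monoid) and the group ring.
\<close>

definition monoid_ring :: "('a, 'm) monoid_scheme \<Rightarrow> ('a \<Rightarrow>\<^sub>0 int) ring" where
  "monoid_ring M =
    \<lparr>carrier = {c. Poly_Mapping.keys c \<subseteq> carrier M},
     monoid.mult = (\<lambda>a b. frag_extend (\<lambda>x. frag_extend (\<lambda>y. frag_of (x \<otimes>\<^bsub>M\<^esub> y)) b) a),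
     one = frag_of \<one>\<^bsub>M\<^esub>,
     ring.zero = 0,
     ring.add = (+)\<rparr>"

definition free_monoid :: "'a set \<Rightarrow> 'a list monoid" where
  "free_monoid A = \<lparr>carrier = lists A, monoid.mult = (@), one = []\<rparr>"

definition free_algebra :: "'a set \<Rightarrow> ('a list \<Rightarrow>\<^sub>0 int) ring" where
  "free_algebra A = monoid_ring (free_monoid A)"

definition free_var :: "'a \<Rightarrow> 'a list \<Rightarrow>\<^sub>0 int" where
  "free_var a = frag_of [a]"

definition group_ring_Sn :: "nat \<Rightarrow> ((nat \<Rightarrow> nat) \<Rightarrow>\<^sub>0 int) ring" where
  "group_ring_Sn n = monoid_ring (sym_group n)"

lemma frag_extend_add_fun:
  "frag_extend (\<lambda>x. f x + g x) c = frag_extend f c + frag_extend g c"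
  by (simp add: frag_extend_def sum.distrib frag_cmul_distrib2)

lemma frag_extend_compose':
  "frag_extend f (frag_extend g c) = frag_extend (\<lambda>x. frag_extend f (g x)) c"
proof -
  have "Poly_Mapping.keys c \<subseteq> UNIV" by simp
  then show ?thesis
    by (induction c rule: frag_induction) (simp_all add: frag_extend_diff)
qed

lemma keys_frag_extend_subset:
  assumes "\<And>x. x \<in> Poly_Mapping.keys c \<Longrightarrow> Poly_Mapping.keys (f x) \<subseteq> S"
  shows "Poly_Mapping.keys (frag_extend f c) \<subseteq> S"
  using keys_frag_extend[of f c] assms by blast

lemma ring_monoid_ring:
  assumes "Group.monoid M"
  shows "ring (monoid_ring M)"
proof -
  interpret M: Group.monoid M by (fact assms)
  show ?thesis
  proof (rule ringI)
    show "abelian_group (monoid_ring M)"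
    proof (rule abelian_groupI)
      fix x assume x: "x \<in> carrier (monoid_ring M)"
      show "\<exists>y\<in>carrier (monoid_ring M). y \<oplus>\<^bsub>monoid_ring M\<^esub> x = \<zero>\<^bsub>monoid_ring M\<^esub>"
        by (rule bexI[of _ "- x"]) (use x in \<open>auto simp: monoid_ring_def\<close>)
    qed (use keys_add in \<open>fastforce simp: monoid_ring_def add_ac\<close>)+
    show "Group.monoid (monoid_ring M)"
    proof (rule monoidI)
      fix x y z
      assume x: "x \<in> carrier (monoid_ring M)" and y: "y \<in> carrier (monoid_ring M)"
        and z: "z \<in> carrier (monoid_ring M)"
      show "x \<otimes>\<^bsub>monoid_ring M\<^esub> y \<in> carrier (monoid_ring M)"
      proof -
        have "Poly_Mapping.keys (frag_extend (\<lambda>x. frag_extend (\<lambda>y. frag_of (x \<otimes>\<^bsub>M\<^esub> y)) y) x)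
            \<subseteq> carrier M"
          by (intro keys_frag_extend_subset)
             (use x y in \<open>auto simp: monoid_ring_def subset_iff\<close>)
        then show ?thesis by (simp add: monoid_ring_def)
      qed
      have "frag_extend (\<lambda>xa. frag_extend (\<lambda>y. frag_of (xa \<otimes>\<^bsub>M\<^esub> y)) z)
              (frag_extend (\<lambda>x. frag_extend (\<lambda>y. frag_of (x \<otimes>\<^bsub>M\<^esub> y)) y) x)
          = frag_extend (\<lambda>u. frag_extend (\<lambda>v. frag_extend (\<lambda>w. frag_of (u \<otimes>\<^bsub>M\<^esub> v \<otimes>\<^bsub>M\<^esub> w)) z) y) x"
        by (simp add: frag_extend_compose')
      also have "\<dots> = frag_extend (\<lambda>u. frag_extend (\<lambda>v. frag_extend (\<lambda>w. frag_of (u \<otimes>\<^bsub>M\<^esub> (v \<otimes>\<^bsub>M\<^esub> w))) z) y) x"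
        using x y z by (intro frag_extend_eq) (auto simp: monoid_ring_def M.m_assoc subsetD)
      finally show "x \<otimes>\<^bsub>monoid_ring M\<^esub> y \<otimes>\<^bsub>monoid_ring M\<^esub> z
          = x \<otimes>\<^bsub>monoid_ring M\<^esub> (y \<otimes>\<^bsub>monoid_ring M\<^esub> z)"
        by (simp add: monoid_ring_def frag_extend_compose')
    next
      fix x assume x: "x \<in> carrier (monoid_ring M)"
      have "frag_extend (\<lambda>y. frag_of (\<one>\<^bsub>M\<^esub> \<otimes>\<^bsub>M\<^esub> y)) x = frag_extend frag_of x"
        and "frag_extend (\<lambda>y. frag_of (y \<otimes>\<^bsub>M\<^esub> \<one>\<^bsub>M\<^esub>)) x = frag_extend frag_of x"
        using x by (auto simp: monoid_ring_def intro!: frag_extend_eq)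
      moreover have "frag_extend frag_of x = x"
        using frag_expansion[of x] by simp
      ultimately show "\<one>\<^bsub>monoid_ring M\<^esub> \<otimes>\<^bsub>monoid_ring M\<^esub> x = x"
        and "x \<otimes>\<^bsub>monoid_ring M\<^esub> \<one>\<^bsub>monoid_ring M\<^esub> = x"
        by (simp_all add: monoid_ring_def)
    qed (simp add: monoid_ring_def)
  qed (simp_all add: monoid_ring_def frag_extend_add frag_extend_add_fun)
qed

lemma monoid_free_monoid: "Group.monoid (free_monoid A)"
  by unfold_locales (auto simp: free_monoid_def)

lemma ring_free_algebra: "ring (free_algebra A)"
  unfolding free_algebra_def by (intro ring_monoid_ring monoid_free_monoid)

lemma ring_group_ring_Sn: "ring (group_ring_Sn n)"
  unfolding group_ring_Sn_def
  by (intro ring_monoid_ring group.is_monoid sym_group_is_group)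

section \<open>The algebra \<open>H(S\<^sub>n)\<close>\<close>

datatype HSn_gen = Gen_s nat | Gen_D nat

definition HSn_gens :: "nat \<Rightarrow> HSn_gen set" where
  "HSn_gens n = Gen_s ` {1..<n} \<union> Gen_D ` {1..<n}"

text \<open>The elements \<open>lhs - rhs\<close>, for all defining relations \<open>lhs = rhs\<close>, evaluated at \<open>s\<close> and \<open>D\<close>.\<close>

context
  fixes R :: "('a, 'b) ring_scheme" (structure) and n :: nat and s D :: "nat \<Rightarrow> 'a"
begin

inductive_set HSn_relators :: "'a set" where
  s_sq: "i \<in> {1..<n} \<Longrightarrow> s i \<otimes> s i \<ominus> \<one> \<in> HSn_relators"
| s_D: "i \<in> {1..<n} \<Longrightarrow> (s i \<otimes> D i \<oplus> D i \<otimes> s i) \<ominus> (s i \<ominus> \<one>) \<in> HSn_relators"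
| D_sq: "i \<in> {1..<n} \<Longrightarrow> D i \<otimes> D i \<ominus> D i \<in> HSn_relators"
| ss_far: "\<lbrakk>i \<in> {1..<n}; j \<in> {1..<n}; \<bar>int i - int j\<bar> > 1\<rbrakk> \<Longrightarrow>
    s j \<otimes> s i \<ominus> s i \<otimes> s j \<in> HSn_relators"
| Ds_far: "\<lbrakk>i \<in> {1..<n}; j \<in> {1..<n}; \<bar>int i - int j\<bar> > 1\<rbrakk> \<Longrightarrow>
    D j \<otimes> s i \<ominus> s i \<otimes> D j \<in> HSn_relators"
| DD_far: "\<lbrakk>i \<in> {1..<n}; j \<in> {1..<n}; \<bar>int i - int j\<bar> > 1\<rbrakk> \<Longrightarrow>
    D j \<otimes> D i \<ominus> D i \<otimes> D j \<in> HSn_relators"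
| sss_near: "\<lbrakk>i \<in> {1..<n}; j \<in> {1..<n}; \<bar>int i - int j\<bar> = 1\<rbrakk> \<Longrightarrow>
    s j \<otimes> s i \<otimes> s j \<ominus> s i \<otimes> s j \<otimes> s i \<in> HSn_relators"
| Dss_near: "\<lbrakk>i \<in> {1..<n}; j \<in> {1..<n}; \<bar>int i - int j\<bar> = 1\<rbrakk> \<Longrightarrow>
    D i \<otimes> s j \<otimes> s i \<ominus> s j \<otimes> s i \<otimes> D j \<in> HSn_relators"
| DsD_near: "\<lbrakk>i \<in> {1..<n}; j \<in> {1..<n}; \<bar>int i - int j\<bar> = 1\<rbrakk> \<Longrightarrow>
    D j \<otimes> s i \<otimes> D j \<ominus> (s i \<otimes> D j \<otimes> D i \<oplus> D i \<otimes> D j \<otimes> s i \<oplus> s i \<otimes> D j \<otimes> s i)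
      \<in> HSn_relators"

end

text \<open>Ideals in \<open>HOL-Algebra\<close> are two-sided, also for noncommutative rings.\<close>

definition HSn_ideal :: "nat \<Rightarrow> (HSn_gen list \<Rightarrow>\<^sub>0 int) set" where
  "HSn_ideal n =
    (let F = free_algebra (HSn_gens n)
     in Idl\<^bsub>F\<^esub> (HSn_relators F n (\<lambda>i. free_var (Gen_s i)) (\<lambda>i. free_var (Gen_D i))))"

definition HSn :: "nat \<Rightarrow> (HSn_gen list \<Rightarrow>\<^sub>0 int) set ring" where
  "HSn n = free_algebra (HSn_gens n) Quot HSn_ideal n"

definition HSn_s :: "nat \<Rightarrow> nat \<Rightarrow> (HSn_gen list \<Rightarrow>\<^sub>0 int) set" where
  "HSn_s n i = HSn_ideal n +>\<^bsub>free_algebra (HSn_gens n)\<^esub> free_var (Gen_s i)"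

definition HSn_D :: "nat \<Rightarrow> nat \<Rightarrow> (HSn_gen list \<Rightarrow>\<^sub>0 int) set" where
  "HSn_D n i = HSn_ideal n +>\<^bsub>free_algebra (HSn_gens n)\<^esub> free_var (Gen_D i)"

lemma HSn_relators_in_carrier:
  assumes "ring R" "\<And>i. i \<in> {1..<n} \<Longrightarrow> s i \<in> carrier R" "\<And>i. i \<in> {1..<n} \<Longrightarrow> D i \<in> carrier R"
  shows "HSn_relators R n s D \<subseteq> carrier R"
proof
  interpret ring R by fact
  fix x assume "x \<in> HSn_relators R n s D"
  then show "x \<in> carrier R"
    by (induction rule: HSn_relators.induct) (use assms(2,3) in simp_all)
qed

lemma free_var_in_carrier: "a \<in> A \<Longrightarrow> free_var a \<in> carrier (free_algebra A)"
  by (simp add: free_var_def free_algebra_def monoid_ring_def free_monoid_def)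

lemma HSn_ideal_is_ideal: "ideal (HSn_ideal n) (free_algebra (HSn_gens n))"
  unfolding HSn_ideal_def Let_def
  by (intro ring.genideal_ideal HSn_relators_in_carrier ring_free_algebra free_var_in_carrier)
     (auto simp: HSn_gens_def)

lemma ring_HSn: "ring (HSn n)"
  unfolding HSn_def by (intro ideal.quotient_is_ring HSn_ideal_is_ideal)

section \<open>The map \<open>\<int>S\<^sub>n \<rightarrow> H(S\<^sub>n)\<close> and the subalgebra \<open>D(S\<^sub>n)\<close>\<close>

text \<open>
  The homomorphism exists by the Coxeter presentation of \<open>S\<^sub>n\<close> and is unique because the simple
  transpositions generate \<open>S\<^sub>n\<close>.  The family \<open>D\<^sub>i\<^sub>j\<close> exists because an element of \<open>S\<^sub>n\<close> fixing
  \<open>k\<close> and \<open>k + 1\<close> commutes with \<open>D\<^sub>k\<close>, and is unique because every pair \<open>i < j\<close> is the image of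
  some \<open>(k, k + 1)\<close>.  Membership in \<^const>\<open>extensional\<close> only fixes the values outside the domain.
\<close>

definition group_ring_to_HSn ::
    "nat \<Rightarrow> ((nat \<Rightarrow> nat) \<Rightarrow>\<^sub>0 int) \<Rightarrow> (HSn_gen list \<Rightarrow>\<^sub>0 int) set" where
  "group_ring_to_HSn n =
    (THE f. f \<in> ring_hom (group_ring_Sn n) (HSn n) \<and>
            f \<in> extensional (carrier (group_ring_Sn n)) \<and>
            (\<forall>i\<in>{1..<n}. f (frag_of (transpose i (i + 1))) = HSn_s n i))"

definition perm_to_HSn :: "nat \<Rightarrow> (nat \<Rightarrow> nat) \<Rightarrow> (HSn_gen list \<Rightarrow>\<^sub>0 int) set" where
  "perm_to_HSn n w = group_ring_to_HSn n (frag_of w)"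

definition HSn_Dij :: "nat \<Rightarrow> nat \<times> nat \<Rightarrow> (HSn_gen list \<Rightarrow>\<^sub>0 int) set" where
  "HSn_Dij n =
    (THE d. d \<in> extensional {(i, j). 1 \<le> i \<and> i < j \<and> j \<le> n} \<and>
            (\<forall>i\<in>{1..<n}. d (i, i + 1) = HSn_D n i) \<and>
            (\<forall>w i j. w permutes {1..n} \<and> 1 \<le> i \<and> i < j \<and> j \<le> n \<and> w i < w j \<longrightarrow>
               perm_to_HSn n w \<otimes>\<^bsub>HSn n\<^esub> d (i, j) \<otimes>\<^bsub>HSn n\<^esub> perm_to_HSn n (inv\<^bsub>sym_group n\<^esub> w)
                 = d (w i, w j)))"

definition DSn :: "nat \<Rightarrow> (HSn_gen list \<Rightarrow>\<^sub>0 int) set ring" where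
  "DSn n = (HSn n)\<lparr>carrier :=
     generate_ring (HSn n) (HSn_Dij n ` {(i, j). 1 \<le> i \<and> i < j \<and> j \<le> n})\<rparr>"

section \<open>Tensor products over \<open>\<int>\<close>\<close>

text \<open>
  A \<open>\<int>\<close>-module is an abelian group, so the tensor product over \<open>\<int>\<close> is the free abelian group on
  pairs modulo biadditivity; compatibility with integer scalars follows.  The groups here are
  \<^emph>\<open>multiplicative\<close> records, to be applied to the \<^const>\<open>add_monoid\<close> of a ring.
\<close>

definition tensor_relators ::
    "('a, 'm) monoid_scheme \<Rightarrow> ('b, 'k) monoid_scheme \<Rightarrow> ('a \<times> 'b \<Rightarrow>\<^sub>0 int) set" where
  "tensor_relators A B =
     {frag_of (x \<otimes>\<^bsub>A\<^esub> x', y) - frag_of (x, y) - frag_of (x', y) | x x' y.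
        x \<in> carrier A \<and> x' \<in> carrier A \<and> y \<in> carrier B} \<union>
     {frag_of (x, y \<otimes>\<^bsub>B\<^esub> y') - frag_of (x, y) - frag_of (x, y') | x y y'.
        x \<in> carrier A \<and> y \<in> carrier B \<and> y' \<in> carrier B}"

definition tensor_subgroup ::
    "('a, 'm) monoid_scheme \<Rightarrow> ('b, 'k) monoid_scheme \<Rightarrow> ('a \<times> 'b \<Rightarrow>\<^sub>0 int) set" where
  "tensor_subgroup A B =
     generate (free_Abelian_group (carrier A \<times> carrier B)) (tensor_relators A B)"

definition tensor_group ::
    "('a, 'm) monoid_scheme \<Rightarrow> ('b, 'k) monoid_scheme \<Rightarrow> ('a \<times> 'b \<Rightarrow>\<^sub>0 int) set monoid" where
  "tensor_group A B = free_Abelian_group (carrier A \<times> carrier B) Mod tensor_subgroup A B"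

definition pure_tensor ::
    "('a, 'm) monoid_scheme \<Rightarrow> ('b, 'k) monoid_scheme \<Rightarrow> 'a \<Rightarrow> 'b \<Rightarrow> ('a \<times> 'b \<Rightarrow>\<^sub>0 int) set" where
  "pure_tensor A B x y =
     tensor_subgroup A B #>\<^bsub>free_Abelian_group (carrier A \<times> carrier B)\<^esub> frag_of (x, y)"

end

theory Submission
  imports Defs
begin

text \<open>
  Moving permutations to the right past the \<open>D\<^sub>i\<^sub>j\<close> (with \<open>w D\<^sub>i\<^sub>j = D\<^sub>w\<^sub>(\<^sub>i\<^sub>)\<^sub>w\<^sub>(\<^sub>j\<^sub>) w\<close> if \<open>w(i) < w(j)\<close>, and a
  correction term by a transposition otherwise) shows that the products \<open>d w\<close> with \<open>d \<in> D(S\<^sub>n)\<close> and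
  \<open>w \<in> S\<^sub>n\<close> span \<open>H(S\<^sub>n)\<close>.  For independence, the same rules define operators on the functions
  \<open>S\<^sub>n \<rightarrow> H(S\<^sub>n)\<close>, a function \<open>m\<close> standing for the formal sum of the \<open>m(w) w\<close>.  They satisfy the
  defining relations because of the quadratic relations between the \<open>D\<^sub>i\<^sub>j\<close>, hence \<open>H(S\<^sub>n)\<close> acts from the
  right, and acting on the formal sum \<open>1 e\<close> recovers \<open>d\<^sub>w\<close> from the element \<open>\<Sum>\<^sub>w d\<^sub>w w\<close>.  That \<open>\<int>S\<^sub>n\<close> maps to
  \<open>H(S\<^sub>n)\<close> at all is the Coxeter presentation of \<open>S\<^sub>n\<close>.
\<close>

section \<open>The Coxeter presentation of the symmetric group\<close>

text \<open>Nothing about the structure of D(S_n) is known beforehand. This is why the formal sums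
  have coefficients in H(S_n): there the quadratic relations between the D_ij follow from the
  defining relations, the cubic one becoming quadratic once all s are moved to one end and
  cancelled. That the coefficients of an element of H(S_n) lie in D(S_n) comes only afterwards, from
  spanning.

  The correction term is the relation s D + D s = s - 1, conjugated from an adjacent transposition
  to (i j). A pair whose order is reversed contributes 1 - D_ba instead of D_ab. Extending D_ij to
  all ordered pairs by E_ba = 1 - E_ab absorbs this case distinction, and the relations for three
  indices become one identity valid in every ordering.

  The map from the group ring and the family D_ij are definite descriptions, so both must first be
  shown to exist and be unique. The computations take place in any ring whose elements satisfy the
  relations (\<open>HSn_elements\<close>), with \<open>perm_rep\<close> and the explicit conjugates
  \<open>Dp\<close> as stand-ins, which are later identified with the described objects.\<close>

definition adj :: "nat \<Rightarrow> nat \<Rightarrow> nat" where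
  "adj i = transpose i (i + 1)"

lemma adj_apply [simp]:
  "adj i i = Suc i" "adj i (Suc i) = i" "k \<noteq> i \<Longrightarrow> k \<noteq> Suc i \<Longrightarrow> adj i k = k"
  by (simp_all add: adj_def)

lemma adj_permutes: "i \<in> {1..<n} \<Longrightarrow> adj i permutes {1..n}"
  unfolding adj_def by (intro permutes_swap_id) auto

lemma comp_adj_permutes: "w permutes {1..n} \<Longrightarrow> i \<in> {1..<n} \<Longrightarrow> w \<circ> adj i permutes {1..n}"
  by (intro permutes_compose adj_permutes)

lemma comp_adj_adj: "w \<circ> adj i \<circ> adj i = w"
  by (simp add: adj_def comp_assoc)

text \<open>Removing a descent from \<open>w\<close> increases \<open>\<Sum>\<^sub>k k w(k) \<le> n\<^sup>3\<close>; this is easier to see than the decrease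
  of the number of inversions.\<close>

definition disorder :: "nat \<Rightarrow> (nat \<Rightarrow> nat) \<Rightarrow> nat" where
  "disorder n w = n * (n * n) - (\<Sum>k=1..n. k * w k)"

lemma disorder_comp_adj:
  assumes w: "w permutes {1..n}" and i: "i \<in> {1..<n}" and desc: "w (i + 1) < w i"
  shows "disorder n (w \<circ> adj i) < disorder n w"
proof -
  \<comment> \<open>The bound keeps the truncated subtraction in \<open>disorder\<close> faithful,
    so that a larger sum gives a strictly smaller value.\<close>
  have le: "(\<Sum>k=1..n. k * v k) \<le> n * (n * n)" if "v permutes {1..n}" for v
  proof -
    have "(\<Sum>k=1..n. k * v k) \<le> of_nat (card {1..n}) * (n * n)"
    proof (rule sum_bounded_above)
      fix k assume "k \<in> {1..n}"
      then have "v k \<in> {1..n}" using permutes_in_image[OF that] by blast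
      then show "k * v k \<le> n * n" using \<open>k \<in> {1..n}\<close> by (intro mult_le_mono) auto
    qed
    then show ?thesis by simp
  qed
  define A where "A = {1..n} - {i, i + 1}"
  have A: "{1..n} = insert i (insert (i + 1) A)" "i \<notin> insert (i + 1) A" "i + 1 \<notin> A" "finite A"
    using i by (auto simp: A_def)
  have split: "(\<Sum>k=1..n. k * v k) = i * v i + ((i + 1) * v (i + 1) + (\<Sum>k\<in>A. k * v k))" for v
    unfolding A(1) using A(2-4) by simp
  have "(\<Sum>k\<in>A. k * (w \<circ> adj i) k) = (\<Sum>k\<in>A. k * w k)"
    by (rule sum.cong) (auto simp: A_def adj_def transpose_def)
  moreover have "i * w i + (i + 1) * w (i + 1) < i * w (i + 1) + (i + 1) * w i"
    using desc by (simp add: algebra_simps)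
  ultimately have "(\<Sum>k=1..n. k * w k) < (\<Sum>k=1..n. k * (w \<circ> adj i) k)"
    unfolding split by simp
  then show ?thesis
    using le[OF w] le[OF comp_adj_permutes[OF w i]] by (simp add: disorder_def)
qed

lemma permutes_adjacent_neq:
  fixes w :: "nat \<Rightarrow> nat"
  shows "w permutes S \<Longrightarrow> w i \<noteq> w (i + 1)"
  by (auto dest!: permutes_inj injD)

text \<open>Climbing from 1 gives k <= w(k), descending from n gives w(k) <= k.\<close>

lemma permutes_ascending_id:
  fixes n :: nat
  assumes w: "w permutes {1..n}" and asc: "\<And>i. i \<in> {1..<n} \<Longrightarrow> w i < w (i + 1)"
  shows "w = id"
proof -
  have lower: "k \<le> w k" if "1 \<le> k" "k \<le> n" for k :: nat
    using that
  proof (induction k rule: nat_induct_at_least)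
    case base
    then show ?case using permutes_in_image[OF w, of 1] by auto
  next
    case (Suc k)
    then show ?case using asc[of k] by auto
  qed
  have upper: "w (n - k) \<le> n - k" if "k < n" for k :: nat
    using that
  proof (induction k)
    case 0
    then show ?case using permutes_in_image[OF w, of n] by auto
  next
    case (Suc k)
    then have "w (n - Suc k) < w (n - k)"
      using asc[of "n - Suc k"] by (simp add: Suc_diff_Suc)
    then show ?case using Suc by linarith
  qed
  have "w k = k" if "k \<in> {1..n}" for k
    using lower[of k] upper[of "n - k"] that by auto
  moreover have "w k = k" if "k \<notin> {1..n}" for k
    using w that by (rule permutes_not_in)
  ultimately show ?thesis by (auto simp: fun_eq_iff)
qed

lemma permutes_descentE:
  fixes n :: nat
  assumes w: "w permutes {1..n}" and "w \<noteq> id"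
  obtains i where "i \<in> {1..<n}" "w (i + 1) < w i"
proof -
  obtain i where i: "i \<in> {1..<n}" "\<not> w i < w (i + 1)"
    using permutes_ascending_id[OF w] \<open>w \<noteq> id\<close> by blast
  moreover have "w i \<noteq> w (i + 1)"
    by (rule permutes_adjacent_neq[OF w])
  ultimately have "w (i + 1) < w i" by linarith
  then show ?thesis using i(1) that by blast
qed

text \<open>Induction along the weak order: removing any descent lowers \<open>disorder\<close>.
  Each step appends an ascent, so the words built this way are reduced.\<close>

lemma permutes_adj_induct [consumes 1, case_names id adj]:
  fixes n :: nat
  assumes w: "w permutes {1..n}"
    and id: "P id"
    and adj: "\<And>w i. w permutes {1..n} \<Longrightarrow> i \<in> {1..<n} \<Longrightarrow> w i < w (i + 1) \<Longrightarrow> P w \<Longrightarrow> P (w \<circ> adj i)"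
  shows "P w"
  using w
proof (induction "disorder n w" arbitrary: w rule: less_induct)
  case less
  show ?case
  proof (cases "w = id")
    case False
    then obtain i where i: "i \<in> {1..<n}" "w (i + 1) < w i"
      using permutes_descentE[OF less.prems] by blast
    note wi = comp_adj_permutes[OF less.prems i(1)]
    have "P (w \<circ> adj i \<circ> adj i)"
      by (rule adj[OF wi i(1) _ less.hyps[OF disorder_comp_adj[OF less.prems i] wi]])
         (use i(2) in simp)
    then show ?thesis by (simp add: comp_adj_adj)
  qed (use id in simp)
qed

lemma far_or_near:
  fixes i j :: nat
  obtains "i = j" | "\<bar>int i - int j\<bar> > 1" | "\<bar>int i - int j\<bar> = 1"
  by linarith

lemma adj_commute:
  assumes "\<bar>int i - int j\<bar> > 1"
  shows "adj i \<circ> adj j = adj j \<circ> adj i"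
  using assms by (auto simp: fun_eq_iff adj_def transpose_def)

lemma adj_braid:
  assumes "\<bar>int i - int j\<bar> = 1"
  shows "adj i \<circ> adj j \<circ> adj i = adj j \<circ> adj i \<circ> adj j"
proof -
  have "j = i + 1 \<or> i = j + 1" using assms by linarith
  then show ?thesis by (auto simp: fun_eq_iff adj_def transpose_def)
qed

text \<open>The generators are involutions, so a monoid is enough; this allows the multiplicative
  monoid of a ring as an instance.\<close>

locale coxeter_elements = Group.monoid G for G (structure) +
  fixes n :: nat and s :: "nat \<Rightarrow> 'a"
  assumes s_closed: "i \<in> {1..<n} \<Longrightarrow> s i \<in> carrier G"
    and s_sq: "i \<in> {1..<n} \<Longrightarrow> s i \<otimes> s i = \<one>"
    and s_far: "i \<in> {1..<n} \<Longrightarrow> j \<in> {1..<n} \<Longrightarrow> \<bar>int i - int j\<bar> > 1 \<Longrightarrow> s j \<otimes> s i = s i \<otimes> s j"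
    and s_near: "i \<in> {1..<n} \<Longrightarrow> j \<in> {1..<n} \<Longrightarrow> \<bar>int i - int j\<bar> = 1 \<Longrightarrow>
      s j \<otimes> s i \<otimes> s j = s i \<otimes> s j \<otimes> s i"
begin

text \<open>The element \<open>x\<close> is the product of the \<open>s i\<close> along some reduced
  word of \<open>w\<close>. It is a relation because independence of the word is the point to be
  proved.\<close>

inductive reduced :: "(nat \<Rightarrow> nat) \<Rightarrow> 'a \<Rightarrow> bool" where
  reduced_id: "reduced id \<one>"
| reduced_adj: "reduced w x \<Longrightarrow> i \<in> {1..<n} \<Longrightarrow> w i < w (i + 1) \<Longrightarrow> reduced (w \<circ> adj i) (x \<otimes> s i)"

lemma reduced_closed: "reduced w x \<Longrightarrow> x \<in> carrier G"
  by (induction rule: reduced.induct) (blast intro: s_closed m_closed one_closed)+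

lemma reduced_permutes: "reduced w x \<Longrightarrow> w permutes {1..n}"
  by (induction rule: reduced.induct) (blast intro: comp_adj_permutes permutes_id)+

lemma reduced_exists: "w permutes {1..n} \<Longrightarrow> \<exists>x. reduced w x"
  by (induction rule: permutes_adj_induct) (blast intro: reduced.intros)+

lemma reduced_descent:
  assumes "reduced (w \<circ> adj i) x" "i \<in> {1..<n}" "w (i + 1) < w i"
  shows "reduced w (x \<otimes> s i)"
  using reduced_adj[OF assms(1,2)] assms(3) by (simp add: comp_adj_adj)

lemma reduced_idE:
  assumes "reduced id x" shows "x = \<one>"
  using assms
proof (cases rule: reduced.cases)
  case (reduced_adj w y i)
  \<comment> \<open>This permutation has a descent at \<open>i\<close>, against the ascent that the
    rule demands.\<close>
  then have "w = adj i" by (metis comp_adj_adj id_comp)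
  then show ?thesis using reduced_adj by simp
qed simp

lemma reduced_descentE:
  assumes "reduced w x" "w \<noteq> id"
  obtains y i where "i \<in> {1..<n}" "w (i + 1) < w i" "reduced (w \<circ> adj i) y" "x = y \<otimes> s i"
  using assms
proof (cases rule: reduced.cases)
  case (reduced_adj v y i)
  show ?thesis
    by (rule that[of i y]) (use reduced_adj in \<open>simp_all add: comp_adj_adj\<close>)
qed simp

text \<open>Local confluence: two descents \<open>i\<close>, \<open>j\<close> of \<open>w\<close> extend to the longest element of the
  parabolic subgroup generated by the two adjacent transpositions.\<close>

lemma reduced_unique:
  assumes "reduced w x" "reduced w y" shows "x = y"
  using assms
proof (induction "disorder n w" arbitrary: w x y rule: less_induct)
  case less
  note IH = less.hyps
  show ?case
  proof (cases "w = id")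
    case True
    then show ?thesis using less.prems reduced_idE by metis
  next
    case False
    have w: "w permutes {1..n}" using less.prems(1) by (rule reduced_permutes)
    obtain x' i where i: "i \<in> {1..<n}" "w (i + 1) < w i" and x': "reduced (w \<circ> adj i) x'" "x = x' \<otimes> s i"
      using reduced_descentE[OF less.prems(1) False] by blast
    obtain y' j where j: "j \<in> {1..<n}" "w (j + 1) < w j" and y': "reduced (w \<circ> adj j) y'" "y = y' \<otimes> s j"
      using reduced_descentE[OF less.prems(2) False] by blast
    note IHi = IH[OF disorder_comp_adj[OF w i]] and IHj = IH[OF disorder_comp_adj[OF w j]]
    note wi = comp_adj_permutes[OF w i(1)] and wj = comp_adj_permutes[OF w j(1)]
    note cl = s_closed[OF i(1)] s_closed[OF j(1)]
    consider "i = j" | "\<bar>int i - int j\<bar> > 1" | "\<bar>int i - int j\<bar> = 1"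
      by (rule far_or_near)
    then show ?thesis
    proof cases
      case 1
      then show ?thesis using IHi[OF x'(1)] x'(2) y' by simp
    next
      case 2
      obtain z where z: "reduced (w \<circ> adj i \<circ> adj j) z"
        using reduced_exists comp_adj_permutes[OF wi j(1)] by blast
      then have z': "reduced (w \<circ> adj j \<circ> adj i) z"
        by (simp add: comp_assoc adj_commute[OF 2])
      have "reduced (w \<circ> adj i) (z \<otimes> s j)"
        by (rule reduced_descent[OF z]) (use 2 i j in \<open>auto simp: transpose_def\<close>)
      moreover have "reduced (w \<circ> adj j) (z \<otimes> s i)"
        by (rule reduced_descent[OF z']) (use 2 i j in \<open>auto simp: transpose_def\<close>)
      ultimately have "x' = z \<otimes> s j" "y' = z \<otimes> s i"
        using IHi x'(1) IHj y'(1) by blast+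
      then show ?thesis
        using x'(2) y'(2) s_far[OF i(1) j(1) 2] reduced_closed[OF z] cl by (simp add: m_assoc)
    next
      case 3
      \<comment> \<open>With descents at both \<open>i\<close> and \<open>j\<close>, the values of
        \<open>w\<close> at three consecutive positions decrease. Both sides of the braid relation
        can therefore be stripped from \<open>w\<close> one descent at a time, leaving the same
        remainder.\<close>
      obtain z where z: "reduced (w \<circ> adj i \<circ> adj j \<circ> adj i) z"
        using reduced_exists comp_adj_permutes[OF comp_adj_permutes[OF wi j(1)] i(1)] by blast
      then have z': "reduced (w \<circ> adj j \<circ> adj i \<circ> adj j) z"
        using adj_braid[OF 3] by (simp add: comp_assoc)
      have ij: "j = i + 1 \<or> i = j + 1" using 3 by linarith
      have "reduced (w \<circ> adj i \<circ> adj j) (z \<otimes> s i)"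
        by (rule reduced_descent[OF z]) (use ij i j in \<open>auto simp: transpose_def\<close>)
      then have "reduced (w \<circ> adj i) (z \<otimes> s i \<otimes> s j)"
        by (rule reduced_descent) (use ij i j in \<open>auto simp: transpose_def\<close>)
      moreover have "reduced (w \<circ> adj j \<circ> adj i) (z \<otimes> s j)"
        by (rule reduced_descent[OF z']) (use ij i j in \<open>auto simp: transpose_def\<close>)
      then have "reduced (w \<circ> adj j) (z \<otimes> s j \<otimes> s i)"
        by (rule reduced_descent) (use ij i j in \<open>auto simp: transpose_def\<close>)
      ultimately have "x' = z \<otimes> s i \<otimes> s j" "y' = z \<otimes> s j \<otimes> s i"
        using IHi x'(1) IHj y'(1) by blast+
      then show ?thesis
        using x'(2) y'(2) s_near[OF i(1) j(1) 3] reduced_closed[OF z] cl by (simp add: m_assoc)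
    qed
  qed
qed

definition perm_rep :: "(nat \<Rightarrow> nat) \<Rightarrow> 'a" where
  "perm_rep w = (THE x. reduced w x)"

lemma perm_rep_eq: "reduced w x \<Longrightarrow> perm_rep w = x"
  unfolding perm_rep_def using reduced_unique by blast

lemma reduced_perm_rep: "w permutes {1..n} \<Longrightarrow> reduced w (perm_rep w)"
  using reduced_exists perm_rep_eq by blast

lemma perm_rep_closed: "w permutes {1..n} \<Longrightarrow> perm_rep w \<in> carrier G"
  using reduced_perm_rep reduced_closed by blast

lemma perm_rep_id: "perm_rep id = \<one>"
  by (intro perm_rep_eq reduced_id)

text \<open>At an ascent this is the rule of \<open>reduced\<close>; at a descent it is that rule
  for \<open>w \<circ> adj i\<close>, solved by s_i^2 = 1. Hence the length of words no longer
  matters from here on.\<close>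

lemma perm_rep_comp_adj:
  assumes w: "w permutes {1..n}" and i: "i \<in> {1..<n}"
  shows "perm_rep (w \<circ> adj i) = perm_rep w \<otimes> s i"
proof (cases "w i < w (i + 1)")
  case True
  then show ?thesis using reduced_adj[OF reduced_perm_rep[OF w] i] perm_rep_eq by blast
next
  case False
  have wi: "w \<circ> adj i permutes {1..n}" using w i by (rule comp_adj_permutes)
  have "w i \<noteq> w (i + 1)"
    by (rule permutes_adjacent_neq[OF w])
  then have desc: "w (i + 1) < w i" using False by linarith
  have "perm_rep w = perm_rep (w \<circ> adj i) \<otimes> s i"
    by (intro perm_rep_eq reduced_descent reduced_perm_rep wi i desc)
  then show ?thesis
    using perm_rep_closed[OF wi] s_closed[OF i] s_sq[OF i] by (simp add: m_assoc)
qed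

lemma perm_rep_adj: "i \<in> {1..<n} \<Longrightarrow> perm_rep (adj i) = s i"
  using perm_rep_comp_adj[OF permutes_id] by (simp only: id_comp perm_rep_id s_closed l_one)

lemma perm_rep_comp:
  assumes "u permutes {1..n}" "v permutes {1..n}"
  shows "perm_rep (u \<circ> v) = perm_rep u \<otimes> perm_rep v"
  using assms(2)
proof (induction rule: permutes_adj_induct)
  case id
  show ?case using assms(1) by (simp only: comp_id perm_rep_id perm_rep_closed r_one)
next
  case (adj w i)
  have "perm_rep (u \<circ> (w \<circ> adj i)) = perm_rep (u \<circ> w) \<otimes> s i"
    using perm_rep_comp_adj[OF permutes_compose[OF adj(1) assms(1)] adj(2)]
    by (simp only: comp_assoc)
  also have "\<dots> = perm_rep u \<otimes> perm_rep (w \<circ> adj i)"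
    using perm_rep_closed[OF assms(1)] perm_rep_closed[OF adj(1)] s_closed[OF adj(2)]
    by (simp only: adj.IH perm_rep_comp_adj[OF adj(1,2)] m_assoc)
  finally show ?case .
qed

end

section \<open>Homomorphisms out of monoid rings and quotient rings\<close>

lemma free_Abelian_group_hom_eqI:
  assumes "group G" and h: "h \<in> hom (free_Abelian_group S) G" and k: "k \<in> hom (free_Abelian_group S) G"
    and eq: "\<And>x. x \<in> S \<Longrightarrow> h (frag_of x) = k (frag_of x)"
    and c: "Poly_Mapping.keys c \<subseteq> S"
  shows "h c = k c"
proof -
  interpret h: group_hom "free_Abelian_group S" G h
    using \<open>group G\<close> h by (simp add: group_hom_def group_hom_axioms_def)
  interpret k: group_hom "free_Abelian_group S" G k
    using \<open>group G\<close> k by (simp add: group_hom_def group_hom_axioms_def)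
  from c show ?thesis
  proof (induction c rule: free_Abelian_group_induct[consumes 1, case_names zero diff gen])
    case (diff a b)
    have "f (a - b) = f a \<otimes>\<^bsub>G\<^esub> inv\<^bsub>G\<^esub> f b" if "group_hom (free_Abelian_group S) G f" for f
      using group_hom.hom_mult[OF that, of a "- b"] group_hom.hom_inv[OF that, of b] diff
      by simp
    from this[OF h.group_hom_axioms] this[OF k.group_hom_axioms] show ?case
      using diff by simp
  qed (use h.hom_one k.hom_one eq in simp_all)
qed

lemma carrier_monoid_ring: "carrier (monoid_ring M) = {c. Poly_Mapping.keys c \<subseteq> carrier M}"
  by (simp add: monoid_ring_def)

lemma add_monoid_ring: "x \<oplus>\<^bsub>monoid_ring M\<^esub> y = x + y"
  by (simp add: monoid_ring_def)

lemma one_monoid_ring: "\<one>\<^bsub>monoid_ring M\<^esub> = frag_of \<one>\<^bsub>M\<^esub>"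
  by (simp add: monoid_ring_def)

lemma mult_monoid_ring_frag_of:
  "frag_of x \<otimes>\<^bsub>monoid_ring M\<^esub> frag_of y = frag_of (x \<otimes>\<^bsub>M\<^esub> y)"
  by (simp add: monoid_ring_def)

lemma add_monoid_monoid_ring: "add_monoid (monoid_ring M) = free_Abelian_group (carrier M)"
  by (simp add: monoid_ring_def free_Abelian_group_def)

lemma ring_hom_additive: "h \<in> ring_hom R S \<Longrightarrow> h \<in> hom (add_monoid R) (add_monoid S)"
  by (auto simp: hom_def ring_hom_def)

lemma monoid_ring_induct [consumes 1, case_names zero gen diff]:
  assumes "c \<in> carrier (monoid_ring M)"
    and "P 0"
    and "\<And>x. x \<in> carrier M \<Longrightarrow> P (frag_of x)"
    and "\<And>a b. \<lbrakk>a \<in> carrier (monoid_ring M); b \<in> carrier (monoid_ring M); P a; P b\<rbrakk> \<Longrightarrow> P (a - b)"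
  shows "P c"
proof -
  have "Poly_Mapping.keys c \<subseteq> carrier M" using assms(1) by (simp add: carrier_monoid_ring)
  then show ?thesis
    by (induction c rule: free_Abelian_group_induct[consumes 1, case_names zero diff gen]) (use assms(2-4) in \<open>simp_all add: carrier_monoid_ring\<close>)
qed

text \<open>The additive map comes from the universal property of the free abelian group. Both sides
  of multiplicativity are biadditive, so it is reduced to basis elements in one argument after the
  other.\<close>

lemma monoid_ring_hom_exists:
  assumes M: "Group.monoid M" and R: "ring R"
    and f: "f \<in> hom M R" and f1: "f \<one>\<^bsub>M\<^esub> = \<one>\<^bsub>R\<^esub>"
  obtains h where "h \<in> ring_hom (monoid_ring M) R" "\<And>x. x \<in> carrier M \<Longrightarrow> h (frag_of x) = f x"
proof -
  interpret M: Group.monoid M by fact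
  interpret R: ring R by fact
  interpret P: ring "monoid_ring M" using M by (rule ring_monoid_ring)
  have "f ` carrier M \<subseteq> carrier (add_monoid R)" using f by (auto simp: hom_def)
  then obtain h where h: "h \<in> hom (free_Abelian_group (carrier M)) (add_monoid R)"
    and hf: "\<And>x. x \<in> carrier M \<Longrightarrow> h (frag_of x) = f x"
    using comm_group.free_Abelian_group_universal[OF R.a_comm_group] by metis
  have h_closed: "h a \<in> carrier R" if "a \<in> carrier (monoid_ring M)" for a
    using h that by (auto simp: hom_def carrier_monoid_ring)
  have h_add: "h (a + b) = h a \<oplus>\<^bsub>R\<^esub> h b"
    if "a \<in> carrier (monoid_ring M)" "b \<in> carrier (monoid_ring M)" for a b
    using h that by (auto simp: hom_def carrier_monoid_ring)
  have h_diff: "h (a - b) = h a \<ominus>\<^bsub>R\<^esub> h b"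
    if ab: "a \<in> carrier (monoid_ring M)" "b \<in> carrier (monoid_ring M)" for a b
  proof -
    have "a - b \<in> carrier (monoid_ring M)"
      using ab keys_diff[of a b] by (auto simp: carrier_monoid_ring)
    then have "h a = h (a - b) \<oplus>\<^bsub>R\<^esub> h b" "h (a - b) \<in> carrier R"
      using h_add[of "a - b" b] ab h_closed by simp_all
    then show ?thesis using ab h_closed[of b] by (simp add: R.minus_eq R.a_assoc R.r_neg)
  qed
  have h_zero: "h 0 = \<zero>\<^bsub>R\<^esub>"
    using h_diff[of 0 0] h_closed[of 0] by (simp add: carrier_monoid_ring R.minus_eq R.r_neg)
  have mult_diff: "(a - b) \<otimes>\<^bsub>monoid_ring M\<^esub> c = a \<otimes>\<^bsub>monoid_ring M\<^esub> c - b \<otimes>\<^bsub>monoid_ring M\<^esub> c"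
    "c \<otimes>\<^bsub>monoid_ring M\<^esub> (a - b) = c \<otimes>\<^bsub>monoid_ring M\<^esub> a - c \<otimes>\<^bsub>monoid_ring M\<^esub> b"
    "0 \<otimes>\<^bsub>monoid_ring M\<^esub> c = 0" "c \<otimes>\<^bsub>monoid_ring M\<^esub> 0 = 0" for a b c
  proof -
    have sub: "frag_extend (\<lambda>x. g x - k x) c = frag_extend g c - frag_extend k c" for g k :: "'a \<Rightarrow> 'a \<Rightarrow>\<^sub>0 int"
      using frag_extend_add_fun[of "\<lambda>x. g x - k x" k c] by simp
    show "(a - b) \<otimes>\<^bsub>monoid_ring M\<^esub> c = a \<otimes>\<^bsub>monoid_ring M\<^esub> c - b \<otimes>\<^bsub>monoid_ring M\<^esub> c"
      "c \<otimes>\<^bsub>monoid_ring M\<^esub> (a - b) = c \<otimes>\<^bsub>monoid_ring M\<^esub> a - c \<otimes>\<^bsub>monoid_ring M\<^esub> b"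
      "0 \<otimes>\<^bsub>monoid_ring M\<^esub> c = 0" "c \<otimes>\<^bsub>monoid_ring M\<^esub> 0 = 0"
      by (simp_all add: monoid_ring_def frag_extend_diff sub) (simp_all add: frag_extend_def)
  qed
  have h_mult: "h (a \<otimes>\<^bsub>monoid_ring M\<^esub> b) = h a \<otimes>\<^bsub>R\<^esub> h b"
    if a: "a \<in> carrier (monoid_ring M)" and b: "b \<in> carrier (monoid_ring M)" for a b
    using a
  proof (induction a rule: monoid_ring_induct)
    case zero
    then show ?case using h_closed[OF b] by (simp add: mult_diff h_zero)
  next
    case (gen x)
    have x: "frag_of x \<in> carrier (monoid_ring M)" using gen by (simp add: carrier_monoid_ring)
    from b show ?case
    proof (induction b rule: monoid_ring_induct)
      case zero
      then show ?case using h_closed[OF x] by (simp add: mult_diff h_zero)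
    next
      case (gen y)
      then show ?case
        using \<open>x \<in> carrier M\<close> f by (simp add: mult_monoid_ring_frag_of hf hom_def)
    next
      case (diff b c)
      then show ?case using x
        by (simp add: mult_diff h_diff h_closed R.minus_eq R.r_distr R.r_minus)
    qed
  next
    case (diff a c)
    then show ?case using b
      by (simp add: mult_diff h_diff h_closed R.minus_eq R.l_distr R.l_minus)
  qed
  have "h \<in> ring_hom (monoid_ring M) R"
    by (rule ring_hom_memI)
       (simp_all add: h_closed h_mult add_monoid_ring h_add one_monoid_ring hf f1)
  then show thesis using hf that by blast
qed

lemma (in ideal) quotient_universal:
  assumes S: "ring S" and h: "h \<in> ring_hom R S" and I: "\<And>x. x \<in> I \<Longrightarrow> h x = \<zero>\<^bsub>S\<^esub>"
  obtains k where "k \<in> ring_hom (R Quot I) S" "\<And>x. x \<in> carrier R \<Longrightarrow> k (I +> x) = h x"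
proof -
  interpret S: ring S by fact
  \<comment> \<open>The map \<open>h\<close> is constant on each coset, so its image there is a
    singleton.\<close>
  define k where "k = (\<lambda>Y. the_elem (h ` Y))"
  have k: "k (I +> x) = h x" if x: "x \<in> carrier R" for x
  proof -
    have "h ` (I +> x) = {h x}"
    proof
      show "h ` (I +> x) \<subseteq> {h x}"
        using x I ring_hom_add[OF h] ring_hom_closed[OF h]
        by (auto simp: a_r_coset_def' Icarr)
      show "{h x} \<subseteq> h ` (I +> x)"
        using a_rcos_self[OF x] by blast
    qed
    then show ?thesis by (simp add: k_def)
  qed
  have "k \<in> ring_hom (R Quot I) S"
  proof (rule ring_hom_memI)
    show "k \<one>\<^bsub>R Quot I\<^esub> = \<one>\<^bsub>S\<^esub>"
      using k ring_hom_one[OF h] by (simp add: FactRing_def)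
  qed (auto simp: FactRing_simps rcoset_mult_add a_rcos_sum k
        ring_hom_closed[OF h] ring_hom_mult[OF h] ring_hom_add[OF h])
  then show thesis using k that by blast
qed

section \<open>Endomorphism rings of abelian groups\<close>

text \<open>The product is composition in diagrammatic order, so that a ring homomorphism into
  this ring is a right module structure.\<close>

definition right_endo_ring :: "('a, 'm) monoid_scheme \<Rightarrow> ('a \<Rightarrow> 'a) ring" where
  "right_endo_ring G =
    \<lparr>carrier = {f \<in> extensional (carrier G). f \<in> hom G G},
     monoid.mult = (\<lambda>f g. compose (carrier G) g f),
     one = (\<lambda>x\<in>carrier G. x),
     ring.zero = (\<lambda>x\<in>carrier G. \<one>\<^bsub>G\<^esub>),
     ring.add = (\<lambda>f g. \<lambda>x\<in>carrier G. f x \<otimes>\<^bsub>G\<^esub> g x)\<rparr>"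

lemma carrier_right_endo_ring:
  "f \<in> carrier (right_endo_ring G) \<longleftrightarrow> f \<in> extensional (carrier G) \<and> f \<in> hom G G"
  by (simp add: right_endo_ring_def)

lemma right_endo_ring_apply:
  assumes "x \<in> carrier G"
  shows "(f \<otimes>\<^bsub>right_endo_ring G\<^esub> g) x = g (f x)"
    and "(f \<oplus>\<^bsub>right_endo_ring G\<^esub> g) x = f x \<otimes>\<^bsub>G\<^esub> g x"
    and "\<one>\<^bsub>right_endo_ring G\<^esub> x = x"
    and "\<zero>\<^bsub>right_endo_ring G\<^esub> x = \<one>\<^bsub>G\<^esub>"
  using assms by (simp_all add: right_endo_ring_def compose_eq)

lemma ring_right_endo_ring:
  assumes "comm_group G"
  shows "ring (right_endo_ring G)"
proof -
  interpret G: comm_group G by fact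
  let ?E = "right_endo_ring G"
  have ext: "f = g" if "f \<in> carrier ?E" "g \<in> carrier ?E" "\<And>x. x \<in> carrier G \<Longrightarrow> f x = g x" for f g
    using that by (intro extensionalityI[of f "carrier G" g]) (auto simp: right_endo_ring_def)
  have closed: "f x \<in> carrier G" if "f \<in> carrier ?E" "x \<in> carrier G" for f x
    using that by (auto simp: right_endo_ring_def hom_def)
  have hom: "f (x \<otimes>\<^bsub>G\<^esub> y) = f x \<otimes>\<^bsub>G\<^esub> f y"
    if "f \<in> carrier ?E" "x \<in> carrier G" "y \<in> carrier G" for f x y
    using that by (auto simp: right_endo_ring_def hom_def)
  have mult: "f \<otimes>\<^bsub>?E\<^esub> g \<in> carrier ?E" if "f \<in> carrier ?E" "g \<in> carrier ?E" for f g
    using that by (auto simp: right_endo_ring_def hom_def compose_def Pi_iff)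
  have add: "f \<oplus>\<^bsub>?E\<^esub> g \<in> carrier ?E" if "f \<in> carrier ?E" "g \<in> carrier ?E" for f g
    using that closed[OF that(1)] closed[OF that(2)]
    by (auto simp: right_endo_ring_def hom_def Pi_iff G.m_ac)
  have one: "\<one>\<^bsub>?E\<^esub> \<in> carrier ?E" and zero: "\<zero>\<^bsub>?E\<^esub> \<in> carrier ?E"
    by (auto simp: right_endo_ring_def hom_def)
  have neg: "(\<lambda>x\<in>carrier G. inv\<^bsub>G\<^esub> f x) \<in> carrier ?E" if "f \<in> carrier ?E" for f
    using closed[OF that] hom[OF that]
    by (auto simp: right_endo_ring_def hom_def G.inv_mult)
  note app = right_endo_ring_apply
  show ?thesis
  proof (rule ringI)
    show "abelian_group ?E"
    proof (rule abelian_groupI)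
      fix f assume f: "f \<in> carrier ?E"
      show "\<exists>g\<in>carrier ?E. g \<oplus>\<^bsub>?E\<^esub> f = \<zero>\<^bsub>?E\<^esub>"
        by (rule bexI[OF ext neg[OF f]]) (use f add neg zero closed in \<open>simp_all add: app\<close>)
    qed (use add zero in \<open>auto intro!: ext simp: app closed G.m_ac\<close>)
    show "Group.monoid ?E"
      by (rule monoidI) (use mult one in \<open>auto intro!: ext simp: app closed\<close>)
  qed (use add mult in \<open>auto intro!: ext simp: app closed hom\<close>)
qed

section \<open>Tensor products\<close>

locale tensor_product = A: comm_group A + B: comm_group B
  for A :: "('a, 'm) monoid_scheme" and B :: "('b, 'k) monoid_scheme"
begin

abbreviation F where "F \<equiv> free_Abelian_group (carrier A \<times> carrier B)"

lemma frag_diff_closed: "a \<in> carrier F \<Longrightarrow> b \<in> carrier F \<Longrightarrow> a - b \<in> carrier F"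
  using keys_diff[of a b] by auto

lemma relators_subset: "tensor_relators A B \<subseteq> carrier F"
  by (auto simp: tensor_relators_def simp del: carrier_free_Abelian_group_iff intro!: frag_diff_closed)

lemma subgroup_tensor_subgroup: "subgroup (tensor_subgroup A B) F"
  unfolding tensor_subgroup_def
  by (intro group.generate_is_subgroup relators_subset) simp

lemma normal_tensor_subgroup: "tensor_subgroup A B \<lhd> F"
  by (simp add: comm_group.subgroup_imp_normal[OF abelian_free_Abelian_group] subgroup_tensor_subgroup)

lemma comm_group_tensor_group: "comm_group (tensor_group A B)"
  unfolding tensor_group_def
  by (intro comm_group.abelian_FactGroup abelian_free_Abelian_group subgroup_tensor_subgroup)

sublocale T: comm_group "tensor_group A B"
  by (rule comm_group_tensor_group)

abbreviation pure where "pure \<equiv> pure_tensor A B"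

abbreviation proj where "proj c \<equiv> tensor_subgroup A B #>\<^bsub>F\<^esub> c"

lemma proj_hom: "proj \<in> hom F (tensor_group A B)"
  unfolding tensor_group_def using normal.r_coset_hom_Mod[OF normal_tensor_subgroup] .

lemma pure_closed: "x \<in> carrier A \<Longrightarrow> y \<in> carrier B \<Longrightarrow> pure x y \<in> carrier (tensor_group A B)"
  unfolding pure_tensor_def using hom_in_carrier[OF proj_hom] by simp

lemma proj_diff:
  assumes "a \<in> carrier F" "b \<in> carrier F"
  shows "proj (a - b) = proj a \<otimes>\<^bsub>tensor_group A B\<^esub> inv\<^bsub>tensor_group A B\<^esub> proj b"
proof -
  interpret proj: group_hom F "tensor_group A B" proj
    using proj_hom by (simp add: group_hom_def group_hom_axioms_def)
  show ?thesis
    using proj.hom_mult[of a "- b"] proj.hom_inv[of b] assms by simp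
qed

lemma proj_relator:
  assumes "a - b - c \<in> tensor_relators A B" "a \<in> carrier F" "b \<in> carrier F" "c \<in> carrier F"
  shows "proj a = proj b \<otimes>\<^bsub>tensor_group A B\<^esub> proj c"
proof -
  have "a - b \<in> carrier F" using assms(2,3) by (rule frag_diff_closed)
  have "a - b - c \<in> tensor_subgroup A B"
    unfolding tensor_subgroup_def using assms(1) by (rule generate.incl)
  then have "proj (a - b - c) = \<one>\<^bsub>tensor_group A B\<^esub>"
    using subgroup.rcos_const[OF subgroup_tensor_subgroup]
    by (simp add: tensor_group_def)
  then have "proj a \<otimes>\<^bsub>tensor_group A B\<^esub> inv\<^bsub>tensor_group A B\<^esub> proj b
      \<otimes>\<^bsub>tensor_group A B\<^esub> inv\<^bsub>tensor_group A B\<^esub> proj c = \<one>\<^bsub>tensor_group A B\<^esub>"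
    using proj_diff[OF \<open>a - b \<in> carrier F\<close> assms(4)] proj_diff[OF assms(2,3)] by simp
  moreover note cl = hom_in_carrier[OF proj_hom assms(2)] hom_in_carrier[OF proj_hom assms(3)]
    hom_in_carrier[OF proj_hom assms(4)]
  ultimately have "proj a \<otimes>\<^bsub>tensor_group A B\<^esub> inv\<^bsub>tensor_group A B\<^esub> proj b = proj c"
    by (metis T.inv_closed T.inv_inv T.inv_equality T.m_closed)
  then show ?thesis
    using cl T.m_comm T.inv_solve_right' by metis
qed

lemma pure_add_left:
  assumes "x \<in> carrier A" "x' \<in> carrier A" "y \<in> carrier B"
  shows "pure (x \<otimes>\<^bsub>A\<^esub> x') y = pure x y \<otimes>\<^bsub>tensor_group A B\<^esub> pure x' y"
  unfolding pure_tensor_def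
  by (rule proj_relator) (use assms in \<open>auto simp: tensor_relators_def\<close>)

lemma pure_add_right:
  assumes "x \<in> carrier A" "y \<in> carrier B" "y' \<in> carrier B"
  shows "pure x (y \<otimes>\<^bsub>B\<^esub> y') = pure x y \<otimes>\<^bsub>tensor_group A B\<^esub> pure x y'"
  unfolding pure_tensor_def
  by (rule proj_relator) (use assms in \<open>auto simp: tensor_relators_def\<close>)

lemma pure_hom_left: "y \<in> carrier B \<Longrightarrow> (\<lambda>x. pure x y) \<in> hom A (tensor_group A B)"
  by (auto simp: hom_def pure_closed pure_add_left)

lemma pure_hom_right: "x \<in> carrier A \<Longrightarrow> pure x \<in> hom B (tensor_group A B)"
  by (auto simp: hom_def pure_closed pure_add_right)

lemma tensor_universal:
  assumes C: "comm_group C"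
    and left: "\<And>y. y \<in> carrier B \<Longrightarrow> (\<lambda>x. \<beta> x y) \<in> hom A C"
    and right: "\<And>x. x \<in> carrier A \<Longrightarrow> \<beta> x \<in> hom B C"
  obtains \<phi> where "\<phi> \<in> hom (tensor_group A B) C"
    "\<And>x y. x \<in> carrier A \<Longrightarrow> y \<in> carrier B \<Longrightarrow> \<phi> (pure x y) = \<beta> x y"
proof -
  interpret C: comm_group C by fact
  have closed: "\<beta> x y \<in> carrier C" if "x \<in> carrier A" "y \<in> carrier B" for x y
    using left that by (auto simp: hom_def)
  obtain h where h: "h \<in> hom F C"
    and h\<beta>: "\<And>p. p \<in> carrier A \<times> carrier B \<Longrightarrow> h (frag_of p) = (\<lambda>(x, y). \<beta> x y) p"
  proof -
    have "(\<lambda>(x, y). \<beta> x y) ` (carrier A \<times> carrier B) \<subseteq> carrier C" using closed by auto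
    then show thesis using C.free_Abelian_group_universal that by metis
  qed
  interpret h: group_hom F C h
    using h by (simp add: group_hom_def group_hom_axioms_def C.is_group)
  have h_diff: "h (a - b) = h a \<otimes>\<^bsub>C\<^esub> inv\<^bsub>C\<^esub> h b" if "a \<in> carrier F" "b \<in> carrier F" for a b
    using h.hom_mult[of a "- b"] h.hom_inv[of b] that by simp
  have relator: "h (a - b - c) = \<one>\<^bsub>C\<^esub>"
    if "h a = h b \<otimes>\<^bsub>C\<^esub> h c" "a \<in> carrier F" "b \<in> carrier F" "c \<in> carrier F" for a b c
  proof -
    note cl = h.hom_closed[OF that(3)] h.hom_closed[OF that(4)]
    have "h (a - b) = h c"
      using h_diff[OF that(2,3)] that(1) cl by (simp add: C.m_comm[of "h b" "h c"] C.m_assoc)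
    then show ?thesis
      using h_diff[OF frag_diff_closed[OF that(2,3)] that(4)] cl by simp
  qed
  have "h r = \<one>\<^bsub>C\<^esub>" if "r \<in> tensor_relators A B" for r
  proof -
    consider (l) x x' y where "x \<in> carrier A" "x' \<in> carrier A" "y \<in> carrier B"
        "r = frag_of (x \<otimes>\<^bsub>A\<^esub> x', y) - frag_of (x, y) - frag_of (x', y)"
      | (r) x y y' where "x \<in> carrier A" "y \<in> carrier B" "y' \<in> carrier B"
        "r = frag_of (x, y \<otimes>\<^bsub>B\<^esub> y') - frag_of (x, y) - frag_of (x, y')"
      using \<open>r \<in> tensor_relators A B\<close> unfolding tensor_relators_def by blast
    then show ?thesis
    proof cases
      case l
      then show ?thesis
        using hom_mult[OF left] by (simp add: relator h\<beta>)
    next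
      case r
      then show ?thesis
        using hom_mult[OF right] by (simp add: relator h\<beta>)
    qed
  qed
  then have "tensor_relators A B \<subseteq> kernel F C h"
    using relators_subset unfolding kernel_def by blast
  then have "tensor_subgroup A B \<subseteq> kernel F C h"
    unfolding tensor_subgroup_def
    by (intro group.generate_subgroup_incl h.subgroup_kernel) simp_all
  \<comment> \<open>\<open>FactGroup_universal\<close> asks for constancy on cosets rather than
    vanishing on the subgroup.\<close>
  then have "h a = h b" if "a \<in> carrier F" "b \<in> carrier F" "proj a = proj b" for a b
  proof -
    have "a \<in> proj b"
      using group.rcos_self[OF group_free_Abelian_group that(1) subgroup_tensor_subgroup] that(3) by simp
    then obtain t where t: "t \<in> tensor_subgroup A B" "a = t + b"
      by (auto simp: r_coset_def)
    then have "t \<in> carrier F" "h t = \<one>\<^bsub>C\<^esub>"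
      using \<open>tensor_subgroup A B \<subseteq> kernel F C h\<close> by (auto simp: kernel_def)
    then show ?thesis using t(2) h.hom_mult[of t b] that(2) by simp
  qed
  then obtain \<phi> where "\<phi> \<in> hom (F Mod tensor_subgroup A B) C" "\<And>c. c \<in> carrier F \<Longrightarrow> \<phi> (proj c) = h c"
    using FactGroup_universal[OF h normal_tensor_subgroup] by blast
  then show thesis
    by (intro that[of \<phi>]) (auto simp: tensor_group_def pure_tensor_def h\<beta>)
qed

lemma tensor_hom_eqI:
  assumes "group C" and f: "f \<in> hom (tensor_group A B) C" and g: "g \<in> hom (tensor_group A B) C"
    and eq: "\<And>x y. x \<in> carrier A \<Longrightarrow> y \<in> carrier B \<Longrightarrow> f (pure x y) = g (pure x y)"
    and t: "t \<in> carrier (tensor_group A B)"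
  shows "f t = g t"
proof -
  obtain c where c: "c \<in> carrier F" "t = proj c"
    using t by (auto simp: tensor_group_def carrier_FactGroup)
  have "(f \<circ> proj) c = (g \<circ> proj) c"
  proof (rule free_Abelian_group_hom_eqI[OF \<open>group C\<close>])
    show "f \<circ> proj \<in> hom F C" "g \<circ> proj \<in> hom F C"
      using Group.hom_compose[OF proj_hom] f g by blast+
  qed (use c eq in \<open>auto simp: pure_tensor_def\<close>)
  then show ?thesis by (simp add: c(2))
qed

end

section \<open>Rings with elements satisfying the defining relations\<close>

text \<open>Relators are ring expressions in the generators. One inclusion shows that the relations
  hold in the quotient, the other that a homomorphism out of the free algebra kills the
  ideal.\<close>

lemma HSn_relators_image:
  assumes "ring R" "ring R'" and h: "h \<in> ring_hom R R'"
    and s: "\<And>i. i \<in> {1..<n} \<Longrightarrow> s i \<in> carrier R \<and> h (s i) = s' i"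
    and D: "\<And>i. i \<in> {1..<n} \<Longrightarrow> D i \<in> carrier R \<and> h (D i) = D' i"
  shows "h ` HSn_relators R n s D = HSn_relators R' n s' D'"
proof -
  interpret h: ring_hom_ring R R' h by (rule ring_hom_ringI2) fact+
  have h_minus: "h (x \<ominus>\<^bsub>R\<^esub> y) = h x \<ominus>\<^bsub>R'\<^esub> h y" if "x \<in> carrier R" "y \<in> carrier R" for x y
    using that by (simp add: a_minus_def)
  note simps = h_minus s D h.hom_mult h.hom_add h.hom_one
    h.R.m_closed h.R.a_closed h.R.minus_closed h.R.one_closed
  show ?thesis
  proof
    show "h ` HSn_relators R n s D \<subseteq> HSn_relators R' n s' D'"
    proof
      fix y assume "y \<in> h ` HSn_relators R n s D"
      then obtain x where "x \<in> HSn_relators R n s D" and y: "y = h x" by blast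
      then have "h x \<in> HSn_relators R' n s' D'"
        by (induction rule: HSn_relators.induct)
           (simp_all only: simps HSn_relators.intros)
      then show "y \<in> HSn_relators R' n s' D'" using y by simp
    qed
    show "HSn_relators R' n s' D' \<subseteq> h ` HSn_relators R n s D"
    proof
      fix y assume "y \<in> HSn_relators R' n s' D'"
      then show "y \<in> h ` HSn_relators R n s D"
      proof (induction rule: HSn_relators.induct)
        case (s_sq i)
        show ?case using s_sq
          by (intro image_eqI[OF _ HSn_relators.s_sq[of i]]) (simp_all only: simps)
      next
        case (s_D i)
        show ?case using s_D
          by (intro image_eqI[OF _ HSn_relators.s_D[of i]]) (simp_all only: simps)
      next
        case (D_sq i)
        show ?case using D_sq
          by (intro image_eqI[OF _ HSn_relators.D_sq[of i]]) (simp_all only: simps)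
      next
        case (ss_far i j)
        show ?case using ss_far
          by (intro image_eqI[OF _ HSn_relators.ss_far[of i _ j]]) (simp_all only: simps)
      next
        case (Ds_far i j)
        show ?case using Ds_far
          by (intro image_eqI[OF _ HSn_relators.Ds_far[of i _ j]]) (simp_all only: simps)
      next
        case (DD_far i j)
        show ?case using DD_far
          by (intro image_eqI[OF _ HSn_relators.DD_far[of i _ j]]) (simp_all only: simps)
      next
        case (sss_near i j)
        show ?case using sss_near
          by (intro image_eqI[OF _ HSn_relators.sss_near[of i _ j]]) (simp_all only: simps)
      next
        case (Dss_near i j)
        show ?case using Dss_near
          by (intro image_eqI[OF _ HSn_relators.Dss_near[of i _ j]]) (simp_all only: simps)
      next
        case (DsD_near i j)
        show ?case using DsD_near
          by (intro image_eqI[OF _ HSn_relators.DsD_near[of i _ j]]) (simp_all only: simps)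
      qed
    qed
  qed
qed

text \<open>Serves both for H(S_n) itself and for the endomorphism ring in which it acts. Inclusion
  in the zero set, not equality, also covers n < 2, where there are no relators.\<close>

locale HSn_elements = ring R for R :: "('a, 'b) ring_scheme" (structure) +
  fixes n :: nat and s D :: "nat \<Rightarrow> 'a"
  assumes s_mem: "i \<in> {1..<n} \<Longrightarrow> s i \<in> carrier R"
    and D_mem: "i \<in> {1..<n} \<Longrightarrow> D i \<in> carrier R"
    and relators: "HSn_relators R n s D \<subseteq> {\<zero>}"
begin

lemma eq_of_relator: "x \<ominus> y \<in> HSn_relators R n s D \<Longrightarrow> x \<in> carrier R \<Longrightarrow> y \<in> carrier R \<Longrightarrow> x = y"
  using relators by (metis r_right_minus_eq singletonD subsetD)

lemma
  assumes i: "i \<in> {1..<n}"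
  shows s_s: "s i \<otimes> s i = \<one>"
    and s_D_rel: "s i \<otimes> D i \<oplus> D i \<otimes> s i = s i \<ominus> \<one>"
    and D_D: "D i \<otimes> D i = D i"
  using i by (intro eq_of_relator HSn_relators.intros; simp add: s_mem D_mem)+

lemma
  assumes i: "i \<in> {1..<n}" and j: "j \<in> {1..<n}" and ij: "\<bar>int i - int j\<bar> > 1"
  shows ss_commute: "s j \<otimes> s i = s i \<otimes> s j"
    and Ds_commute: "D j \<otimes> s i = s i \<otimes> D j"
    and DD_commute: "D j \<otimes> D i = D i \<otimes> D j"
  using i j by (intro eq_of_relator HSn_relators.intros ij; simp add: s_mem D_mem)+

lemma
  assumes i: "i \<in> {1..<n}" and j: "j \<in> {1..<n}" and ij: "\<bar>int i - int j\<bar> = 1"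
  shows sss_rel: "s j \<otimes> s i \<otimes> s j = s i \<otimes> s j \<otimes> s i"
    and Dss_rel: "D i \<otimes> s j \<otimes> s i = s j \<otimes> s i \<otimes> D j"
    and DsD_rel: "D j \<otimes> s i \<otimes> D j = s i \<otimes> D j \<otimes> D i \<oplus> D i \<otimes> D j \<otimes> s i \<oplus> s i \<otimes> D j \<otimes> s i"
  using i j by (intro eq_of_relator HSn_relators.intros ij; simp add: s_mem D_mem)+

sublocale coxeter_elements R n s
  by unfold_locales (fact s_mem s_s ss_commute sss_rel)+

abbreviation g where "g \<equiv> perm_rep"

section \<open>Moving permutations past the elements D_ij\<close>

lemma g_cancel:
  assumes "w permutes {1..n}" "x \<in> carrier R"
  shows "g w \<otimes> (g (inv' w) \<otimes> x) = x" "g (inv' w) \<otimes> (g w \<otimes> x) = x"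
proof -
  note w = assms(1) permutes_inv[OF assms(1)]
  have "g w \<otimes> g (inv' w) = \<one>" "g (inv' w) \<otimes> g w = \<one>"
    using perm_rep_comp[OF w] perm_rep_comp[OF w(2,1)] permutes_inv_o[OF w(1)]
    by (simp_all only: perm_rep_id)
  then show "g w \<otimes> (g (inv' w) \<otimes> x) = x" "g (inv' w) \<otimes> (g w \<otimes> x) = x"
    using assms(2) perm_rep_closed[OF w(1)] perm_rep_closed[OF w(2)] by (simp_all flip: m_assoc)
qed

lemma g_right_cancel:
  assumes w: "w permutes {1..n}" and x: "x \<in> carrier R" "y \<in> carrier R" and eq: "x \<otimes> g w = y \<otimes> g w"
  shows "x = y"
proof -
  note cl = perm_rep_closed[OF w] perm_rep_closed[OF permutes_inv[OF w]]
  have "g w \<otimes> g (inv' w) = \<one>"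
    using perm_rep_comp[OF w permutes_inv[OF w]] permutes_inv_o[OF w] by (simp only: perm_rep_id)
  then show ?thesis
    using arg_cong[OF eq, of "\<lambda>z. z \<otimes> g (inv' w)"] x cl by (simp add: m_assoc)
qed

text \<open>Induction on the disorder of \<open>u\<close>: a descent \<open>i\<close> of \<open>u\<close> is not \<open>k\<close>; if it is far from
  \<open>k\<close>, then \<open>s\<^sub>i\<close> commutes with \<open>D\<^sub>k\<close>, and otherwise \<open>s\<^sub>k s\<^sub>i\<close> splits off from \<open>u\<close>.\<close>

lemma g_D_adjacent:
  assumes "u permutes {1..n}" "k \<in> {1..<n}" "k' \<in> {1..<n}" "u k = k'" "u (k + 1) = k' + 1"
  shows "g u \<otimes> D k = D k' \<otimes> g u"
  using assms
proof (induction "disorder n u" arbitrary: u k rule: less_induct)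
  case less
  note u = less.prems(1) and k = less.prems(2) and k' = less.prems(3)
  note uk = less.prems(4,5)
  show ?case
  proof (cases "u = id")
    case True
    then have "k' = k" using uk by simp
    then show ?thesis using D_mem[OF k] by (simp only: True perm_rep_id l_one r_one)
  next
    case False
    obtain i where i: "i \<in> {1..<n}" "u (i + 1) < u i"
      using permutes_descentE[OF u False] by blast
    note ui = comp_adj_permutes[OF u i(1)] and smaller = disorder_comp_adj[OF u i]
    have split: "g u = g (u \<circ> adj i) \<otimes> s i"
      using perm_rep_comp_adj[OF ui i(1)] by (simp only: comp_adj_adj)
    note cl = perm_rep_closed[OF ui] s_mem[OF i(1)] s_mem[OF k] D_mem[OF k] D_mem[OF k'] D_mem[OF i(1)]
    consider "i = k" | "\<bar>int i - int k\<bar> > 1" | "\<bar>int i - int k\<bar> = 1" by (rule far_or_near)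
    then show ?thesis
    proof cases
      case 1
      then show ?thesis using i(2) uk by simp
    next
      case 2
      have "g (u \<circ> adj i) \<otimes> D k = D k' \<otimes> g (u \<circ> adj i)"
        by (rule less.hyps[OF smaller ui k k']) (use 2 uk in auto)
      then show ?thesis
        using cl Ds_commute[OF i(1) k 2] unfolding split by (metis m_assoc)
    next
      case 3
      then have ik: "i = k + 1 \<or> k = i + 1" by linarith
      let ?v = "u \<circ> adj i \<circ> adj k"
      have v: "?v permutes {1..n}" by (rule comp_adj_permutes[OF ui k])
      \<comment> \<open>The pair of consecutive values now sits at position \<open>i\<close>, so the
        induction hypothesis is used for \<open>D i\<close> in place of \<open>D k\<close>.\<close>
      have v_val: "?v i = k'" "?v (i + 1) = k' + 1"
        using ik uk by auto
      \<comment> \<open>Here the values at \<open>k\<close> and \<open>k + 1\<close> being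
        consecutive matters: the third value involved lies on one side of one of them and, by
        injectivity, cannot fall between the two, so a second descent appears.\<close>
      have "(u \<circ> adj i) (k + 1) < (u \<circ> adj i) k"
        using ik i(2) uk inj_eq[OF permutes_inj[OF u], of "i + 1" k]
          inj_eq[OF permutes_inj[OF u], of i "k + 1"] by auto
      then have "disorder n ?v < disorder n u"
        using disorder_comp_adj[OF ui k] smaller by simp
      then have IH: "g ?v \<otimes> D i = D k' \<otimes> g ?v"
        by (rule less.hyps[OF _ v i(1) k']) (fact v_val)+
      have "g (u \<circ> adj i) = g ?v \<otimes> s k"
        using perm_rep_comp_adj[OF v k] by (simp only: comp_adj_adj)
      then have gu: "g u = g ?v \<otimes> (s k \<otimes> s i)"
        using split cl perm_rep_closed[OF v] by (simp add: m_assoc)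
      have "g u \<otimes> D k = g ?v \<otimes> (s k \<otimes> s i \<otimes> D k)"
        using gu cl perm_rep_closed[OF v] by (simp add: m_assoc)
      also have "\<dots> = g ?v \<otimes> D i \<otimes> (s k \<otimes> s i)"
        using Dss_rel[OF i(1) k 3] cl perm_rep_closed[OF v] by (simp add: m_assoc)
      also have "\<dots> = D k' \<otimes> g u"
        unfolding IH using gu cl perm_rep_closed[OF v] by (simp add: m_assoc)
      finally show ?thesis .
    qed
  qed
qed

text \<open>For \<open>i < j\<close> this transposition fixes \<open>i\<close> and sends
  \<open>i + 1\<close> to \<open>j\<close>, so it carries the adjacent pair to (i, j) in order;
  being an involution, it is its own inverse in the conjugation.\<close>

definition Dp :: "nat \<Rightarrow> nat \<Rightarrow> 'a" where
  "Dp i j = g (transpose (Suc i) j) \<otimes> D i \<otimes> g (transpose (Suc i) j)"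

lemma transpose_perm: "i \<in> {1..n} \<Longrightarrow> j \<in> {1..n} \<Longrightarrow> transpose i j permutes {1..n}"
  by (rule permutes_swap_id)

lemma g_transpose_sq:
  assumes "i \<in> {1..n}" "j \<in> {1..n}"
  shows "g (transpose i j) \<otimes> g (transpose i j) = \<one>"
  using perm_rep_comp[OF transpose_perm[OF assms] transpose_perm[OF assms]]
  by (simp only: transpose_comp_involutory perm_rep_id)

lemma Dp_closed: "1 \<le> i \<Longrightarrow> i < j \<Longrightarrow> j \<le> n \<Longrightarrow> Dp i j \<in> carrier R"
  unfolding Dp_def by (intro m_closed perm_rep_closed transpose_perm D_mem) auto

lemma Dp_adjacent: "i \<in> {1..<n} \<Longrightarrow> Dp i (Suc i) = D i"
  unfolding Dp_def by (simp only: transpose_same perm_rep_id D_mem l_one r_one)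

text \<open>Composing \<open>w\<close> with the transposition that moves \<open>w (Suc k)\<close>
  next to \<open>w k\<close> makes the two values consecutive, which is the case of
  \<open>g_D_adjacent\<close>.\<close>

lemma g_D:
  assumes w: "w permutes {1..n}" and k: "k \<in> {1..<n}" and lt: "w k < w (Suc k)"
  shows "g w \<otimes> D k = Dp (w k) (w (Suc k)) \<otimes> g w"
proof -
  let ?t = "transpose (Suc (w k)) (w (Suc k))"
  have wk: "w k \<in> {1..<n}" "w (Suc k) \<in> {1..n}"
    using permutes_in_image[OF w, of k] permutes_in_image[OF w, of "Suc k"] k lt by auto
  then have t: "?t permutes {1..n}" by (intro transpose_perm) auto
  note cl = perm_rep_closed[OF t] perm_rep_closed[OF w] D_mem[OF k] D_mem[OF wk(1)]
  have "g (?t \<circ> w) \<otimes> D k = D (w k) \<otimes> g (?t \<circ> w)"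
    by (rule g_D_adjacent) (use lt w t k wk in \<open>simp_all add: permutes_compose\<close>)
  then have eq: "g ?t \<otimes> (g w \<otimes> D k) = D (w k) \<otimes> (g ?t \<otimes> g w)"
    using cl by (simp add: perm_rep_comp[OF t w] m_assoc)
  have tt: "g ?t \<otimes> g ?t = \<one>" by (rule g_transpose_sq) (use wk in auto)
  have "g w \<otimes> D k = g ?t \<otimes> g ?t \<otimes> (g w \<otimes> D k)" using tt cl by simp
  also have "\<dots> = g ?t \<otimes> (g ?t \<otimes> (g w \<otimes> D k))" using cl by (simp add: m_assoc)
  also have "\<dots> = Dp (w k) (w (Suc k)) \<otimes> g w"
    unfolding eq Dp_def using cl by (simp add: m_assoc)
  finally show ?thesis .
qed

text \<open>Unfolding \<open>Dp\<close> as a conjugate of \<open>D i\<close> turns this into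
  \<open>g_D\<close> for \<open>w \<circ> transpose (Suc i) j\<close>. It is the property that
  characterises the family D_ij.\<close>

lemma g_Dp:
  assumes w: "w permutes {1..n}" and ij: "1 \<le> i" "i < j" "j \<le> n" and lt: "w i < w j"
  shows "g w \<otimes> Dp i j = Dp (w i) (w j) \<otimes> g w"
proof -
  let ?t = "transpose (Suc i) j"
  have t: "?t permutes {1..n}" using ij by (intro transpose_perm) auto
  have tt: "g ?t \<otimes> g ?t = \<one>" by (rule g_transpose_sq) (use ij in auto)
  have i: "i \<in> {1..<n}" using ij by auto
  have wij: "1 \<le> w i" "w j \<le> n"
    using permutes_in_image[OF w, of i] permutes_in_image[OF w, of j] ij by auto
  note cl = perm_rep_closed[OF t] perm_rep_closed[OF w] D_mem[OF i] Dp_closed[OF wij(1) lt wij(2)]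
  have val: "(w \<circ> ?t) i = w i" "(w \<circ> ?t) (Suc i) = w j" using ij by auto
  have "g (w \<circ> ?t) \<otimes> D i = Dp (w i) (w j) \<otimes> g (w \<circ> ?t)"
    using g_D[OF permutes_compose[OF t w] i] lt by (simp only: val)
  then have eq: "g w \<otimes> (g ?t \<otimes> D i) = Dp (w i) (w j) \<otimes> (g w \<otimes> g ?t)"
    using cl by (simp add: perm_rep_comp[OF w t] m_assoc)
  have "g w \<otimes> Dp i j = g w \<otimes> (g ?t \<otimes> D i) \<otimes> g ?t"
    using cl by (simp add: Dp_def m_assoc)
  also have "\<dots> = Dp (w i) (w j) \<otimes> (g w \<otimes> (g ?t \<otimes> g ?t))"
    unfolding eq using cl by (simp add: m_assoc)
  finally show ?thesis using tt cl by simp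
qed

text \<open>The relation s_i D_i + D_i s_i = s_i - 1, conjugated by the transposition that defines
  \<open>Dp\<close>; the same conjugation takes s_i to (i j).\<close>

lemma g_transpose_Dp:
  assumes ij: "1 \<le> i" "i < j" "j \<le> n"
  shows "g (transpose i j) \<otimes> Dp i j \<oplus> Dp i j \<otimes> g (transpose i j) = g (transpose i j) \<ominus> \<one>"
proof -
  let ?t = "transpose (Suc i) j"
  have t: "?t permutes {1..n}" using ij by (intro transpose_perm) auto
  have tt: "g ?t \<otimes> g ?t = \<one>" by (rule g_transpose_sq) (use ij in auto)
  have i: "i \<in> {1..<n}" using ij by auto
  note cl = perm_rep_closed[OF t] D_mem[OF i] s_mem[OF i]
  have "transpose i j = ?t \<circ> adj i \<circ> ?t"
    using ij by (auto simp: fun_eq_iff adj_def transpose_def)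
  then have gT: "g (transpose i j) = g ?t \<otimes> s i \<otimes> g ?t"
    by (simp only: perm_rep_comp[OF comp_adj_permutes[OF t i] t] perm_rep_comp_adj[OF t i])
  have conj: "(g ?t \<otimes> x \<otimes> g ?t) \<otimes> (g ?t \<otimes> y \<otimes> g ?t) = g ?t \<otimes> (x \<otimes> y) \<otimes> g ?t"
    if "x \<in> carrier R" "y \<in> carrier R" for x y
  proof -
    have "(g ?t \<otimes> x \<otimes> g ?t) \<otimes> (g ?t \<otimes> y \<otimes> g ?t) = g ?t \<otimes> x \<otimes> (g ?t \<otimes> g ?t) \<otimes> (y \<otimes> g ?t)"
      using that cl by (simp add: m_assoc)
    then show ?thesis using that cl tt by (simp add: m_assoc)
  qed
  have "g (transpose i j) \<otimes> Dp i j \<oplus> Dp i j \<otimes> g (transpose i j)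
      = g ?t \<otimes> (s i \<otimes> D i \<oplus> D i \<otimes> s i) \<otimes> g ?t"
    using cl unfolding gT Dp_def by (simp add: conj l_distr r_distr)
  also have "\<dots> = g ?t \<otimes> s i \<otimes> g ?t \<ominus> g ?t \<otimes> g ?t"
    unfolding s_D_rel[OF i] using cl by (simp add: minus_eq l_distr r_distr l_minus r_minus)
  finally show ?thesis by (simp only: gT tt)
qed

text \<open>Exchanging the two values first gives a permutation that preserves the order, to which
  \<open>g_Dp\<close> applies; the transposition left over is then moved by
  \<open>g_transpose_Dp\<close>, which produces the extra term.\<close>

lemma g_Dp_reverse:
  assumes w: "w permutes {1..n}" and ij: "1 \<le> i" "i < j" "j \<le> n" and lt: "w j < w i"
  shows "g w \<otimes> Dp i j = (\<one> \<ominus> Dp (w j) (w i)) \<otimes> g w \<ominus> g (transpose (w j) (w i) \<circ> w)"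
proof -
  let ?t = "transpose (w j) (w i)"
  have wij: "1 \<le> w j" "w i \<le> n" "w j \<in> {1..n}" "w i \<in> {1..n}"
    using permutes_in_image[OF w, of i] permutes_in_image[OF w, of j] ij by auto
  then have t: "?t permutes {1..n}" by (intro transpose_perm)
  have tt: "g ?t \<otimes> g ?t = \<one>" by (rule g_transpose_sq) (use wij in auto)
  let ?v = "?t \<circ> w"
  have v: "?v permutes {1..n}" by (rule permutes_compose[OF w t])
  have val: "?v i = w j" "?v j = w i" by auto
  note cl = perm_rep_closed[OF w] perm_rep_closed[OF v] perm_rep_closed[OF t]
    Dp_closed[OF ij] Dp_closed[OF wij(1) lt wij(2)]
  have tv: "g ?t \<otimes> g ?v = g w"
    using cl tt by (simp add: perm_rep_comp[OF w t] m_assoc perm_rep_comp[OF t w] flip: m_assoc)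
  have gv: "g ?v = g ?t \<otimes> g w" by (rule perm_rep_comp[OF t w])
  have "g ?v \<otimes> Dp i j = Dp (w j) (w i) \<otimes> g ?v"
    using g_Dp[OF v ij] lt by (simp only: val)
  then have "g w \<otimes> Dp i j = g ?t \<otimes> Dp (w j) (w i) \<otimes> g ?v"
    using cl by (simp add: m_assoc flip: tv)
  also have "g ?t \<otimes> Dp (w j) (w i) = g ?t \<ominus> \<one> \<ominus> Dp (w j) (w i) \<otimes> g ?t"
  proof -
    have "g ?t \<otimes> Dp (w j) (w i)
        = g ?t \<otimes> Dp (w j) (w i) \<oplus> Dp (w j) (w i) \<otimes> g ?t \<ominus> Dp (w j) (w i) \<otimes> g ?t"
      using cl by algebra
    then show ?thesis by (simp only: g_transpose_Dp[OF wij(1) lt wij(2)])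
  qed
  also have "(g ?t \<ominus> \<one> \<ominus> Dp (w j) (w i) \<otimes> g ?t) \<otimes> g ?v
      = g ?t \<otimes> g ?v \<ominus> g ?v \<ominus> Dp (w j) (w i) \<otimes> (g ?t \<otimes> g ?v)"
    using cl by algebra
  also have "\<dots> = (\<one> \<ominus> Dp (w j) (w i)) \<otimes> g w \<ominus> g ?v"
    unfolding tv using cl by algebra
  finally show ?thesis .
qed

end

lemma permutes_extend:
  assumes S: "finite S" "A \<subseteq> S" "inj_on f A" "f ` A \<subseteq> S"
  obtains p where "p permutes S" "\<And>x. x \<in> A \<Longrightarrow> p x = f x"
proof -
  have "card (S - A) = card (S - f ` A)"
    using S by (simp add: card_Diff_subset finite_subset card_image)
  then obtain h where h: "bij_betw h (S - A) (S - f ` A)"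
    using S(1) finite_same_card_bij[of "S - A" "S - f ` A"] by auto
  let ?p = "\<lambda>x. if x \<in> A then f x else if x \<in> S then h x else x"
  have "bij_betw ?p A (f ` A)" "bij_betw ?p (S - A) (S - f ` A)"
    using S(3) h by (auto simp: bij_betw_def inj_on_def image_def)
  then have "bij_betw ?p (A \<union> (S - A)) (f ` A \<union> (S - f ` A))"
    by (rule bij_betw_combine) auto
  then have "bij_betw ?p S S" using S(2,4) by (simp add: Un_absorb1)
  then have "?p permutes S" using S(2) by (intro bij_imp_permutes) auto
  then show thesis using that by auto
qed

context ring begin

lemma one_minus_mult:
  "a \<in> carrier R \<Longrightarrow> b \<in> carrier R \<Longrightarrow> (\<one> \<ominus> a) \<otimes> b = b \<ominus> a \<otimes> b"
  "a \<in> carrier R \<Longrightarrow> b \<in> carrier R \<Longrightarrow> b \<otimes> (\<one> \<ominus> a) = b \<ominus> b \<otimes> a"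
  by (simp_all add: minus_eq l_distr r_distr l_minus r_minus)

lemma mult_minus:
  "a \<in> carrier R \<Longrightarrow> b \<in> carrier R \<Longrightarrow> c \<in> carrier R \<Longrightarrow> a \<otimes> (b \<ominus> c) = a \<otimes> b \<ominus> a \<otimes> c"
  by (simp add: minus_eq r_distr r_minus)

end

context HSn_elements begin

section \<open>Relations between the elements \<open>D\<^sub>i\<^sub>j\<close>\<close>

lemma Dp_sq:
  assumes ij: "1 \<le> i" "i < j" "j \<le> n"
  shows "Dp i j \<otimes> Dp i j = Dp i j"
proof -
  let ?t = "transpose (Suc i) j"
  have t: "?t permutes {1..n}" using ij by (intro transpose_perm) auto
  have i: "i \<in> {1..<n}" using ij by auto
  note cl = perm_rep_closed[OF t] D_mem[OF i] Dp_closed[OF ij]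
  have tD: "g ?t \<otimes> D i = Dp i j \<otimes> g ?t"
    using g_D[OF t i] ij by simp
  have "(Dp i j \<otimes> Dp i j) \<otimes> g ?t = Dp i j \<otimes> g ?t \<otimes> D i" using cl tD by (simp add: m_assoc)
  also have "\<dots> = g ?t \<otimes> (D i \<otimes> D i)" unfolding tD[symmetric] using cl by (simp add: m_assoc)
  also have "\<dots> = Dp i j \<otimes> g ?t" unfolding D_D[OF i] by (rule tD)
  finally show ?thesis by (rule g_right_cancel[OF t, rotated 2]) (use cl in simp_all)
qed

text \<open>A permutation taking 1, 2, 3, 4 to i, j, k, l preserves the order inside each pair,
  whatever the order between the pairs, so it conjugates D_3 D_1 = D_1 D_3 into the claim.\<close>

lemma Dp_commute:
  assumes ij: "1 \<le> i" "i < j" "j \<le> n" and kl: "1 \<le> k" "k < l" "l \<le> n"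
    and disj: "{i, j} \<inter> {k, l} = {}"
  shows "Dp i j \<otimes> Dp k l = Dp k l \<otimes> Dp i j"
proof -
  have "card {i, j, k, l} \<le> card {1..n}" by (rule card_mono) (use ij kl in auto)
  then have n: "4 \<le> n" using ij kl disj by auto
  define f where "f = (\<lambda>x::nat. if x = 1 then i else if x = 2 then j else if x = 3 then k else l)"
  have "inj_on f {1, 2, 3, 4}" "f ` {1, 2, 3, 4} \<subseteq> {1..n}" "{1, 2, 3, 4} \<subseteq> {1..n}"
    using n ij kl disj by (auto simp: f_def inj_on_def)
  then obtain v where v: "v permutes {1..n}" and vf: "\<And>x. x \<in> {1, 2, 3, 4} \<Longrightarrow> v x = f x"
    using permutes_extend[of "{1..n}" "{1, 2, 3, 4}" f] by auto
  have val: "v 1 = i" "v (Suc 1) = j" "v 3 = k" "v (Suc 3) = l"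
    using vf by (simp_all add: f_def)
  have idx: "1 \<in> {1..<n}" "3 \<in> {1..<n}" using n by auto
  note cl = perm_rep_closed[OF v] D_mem[OF idx(1)] D_mem[OF idx(2)] Dp_closed[OF ij] Dp_closed[OF kl]
  have c1: "g v \<otimes> D 1 = Dp i j \<otimes> g v" and c3: "g v \<otimes> D 3 = Dp k l \<otimes> g v"
    using g_D[OF v idx(1)] g_D[OF v idx(2)] val ij kl by simp_all
  have "D 3 \<otimes> D 1 = D 1 \<otimes> D 3" by (rule DD_commute[OF idx]) simp
  then have "Dp i j \<otimes> Dp k l \<otimes> g v = Dp k l \<otimes> Dp i j \<otimes> g v"
    using c1 c3 cl by (metis m_assoc)
  then show ?thesis by (rule g_right_cancel[OF v, rotated 2]) (use cl in simp_all)
qed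

text \<open>With T = D_{i,i+2} one has s_i D_{i+1} = T s_i and s_{i+1} D_i = T s_{i+1}. They bring
  every s in the cubic relation to the right end, where a common factor cancels; the two choices of
  roles give the two identities.\<close>

lemma D_triple:
  assumes i: "i \<in> {1..<n}" and i': "Suc i \<in> {1..<n}"
  shows "D i \<otimes> D (Suc i) = Dp i (Suc (Suc i)) \<otimes> D i \<oplus> D (Suc i) \<otimes> Dp i (Suc (Suc i)) \<ominus> Dp i (Suc (Suc i))"
    and "D (Suc i) \<otimes> D i = D i \<otimes> Dp i (Suc (Suc i)) \<oplus> Dp i (Suc (Suc i)) \<otimes> D (Suc i) \<ominus> Dp i (Suc (Suc i))"
proof -
  let ?T = "Dp i (Suc (Suc i))" and ?p = "Suc i"
  have T: "?T \<in> carrier R" by (rule Dp_closed) (use i i' in auto)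
  note cl = T D_mem[OF i] D_mem[OF i'] s_mem[OF i] s_mem[OF i']
  have pi: "s ?p \<otimes> D i = ?T \<otimes> s ?p"
    using g_D[OF adj_permutes[OF i'] i] by (simp only: perm_rep_adj[OF i']) simp
  have ip: "s i \<otimes> D ?p = ?T \<otimes> s i"
    using g_D[OF adj_permutes[OF i] i'] by (simp only: perm_rep_adj[OF i]) simp
  have sp: "s ?p \<otimes> D ?p = s ?p \<ominus> \<one> \<ominus> D ?p \<otimes> s ?p"
  proof -
    have "s ?p \<otimes> D ?p = s ?p \<otimes> D ?p \<oplus> D ?p \<otimes> s ?p \<ominus> D ?p \<otimes> s ?p" using cl by algebra
    then show ?thesis by (simp only: s_D_rel[OF i'])
  qed
  have si: "s i \<otimes> D i = s i \<ominus> \<one> \<ominus> D i \<otimes> s i"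
  proof -
    have "s i \<otimes> D i = s i \<otimes> D i \<oplus> D i \<otimes> s i \<ominus> D i \<otimes> s i" using cl by algebra
    then show ?thesis by (simp only: s_D_rel[OF i])
  qed
  have cancel: "x = y" if "x \<otimes> s k = y \<otimes> s k" "x \<in> carrier R" "y \<in> carrier R" "k \<in> {1..<n}" for x y k
    using that g_right_cancel[OF adj_permutes[of k n], of x y] by (simp only: perm_rep_adj)
  have "(D ?p \<otimes> ?T) \<otimes> s i = D ?p \<otimes> s i \<otimes> D ?p" using cl by (simp add: m_assoc ip)
  also have "\<dots> = (s i \<otimes> D ?p) \<otimes> D i \<oplus> D i \<otimes> D ?p \<otimes> s i \<oplus> (s i \<otimes> D ?p) \<otimes> s i"
    using DsD_rel[OF i i'] by simp
  also have "\<dots> = ?T \<otimes> (s i \<otimes> D i) \<oplus> D i \<otimes> D ?p \<otimes> s i \<oplus> ?T \<otimes> (s i \<otimes> s i)"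
    unfolding ip using cl by (simp add: m_assoc)
  also have "\<dots> = (?T \<ominus> ?T \<otimes> D i \<oplus> D i \<otimes> D ?p) \<otimes> s i"
    unfolding si s_s[OF i] using cl by (simp only: mult_minus minus_closed m_closed one_closed r_one) algebra
  finally have "D ?p \<otimes> ?T = ?T \<ominus> ?T \<otimes> D i \<oplus> D i \<otimes> D ?p"
    by (rule cancel) (use cl i in simp_all)
  then show "D i \<otimes> D ?p = ?T \<otimes> D i \<oplus> D ?p \<otimes> ?T \<ominus> ?T"
    using cl by algebra
  have "(D i \<otimes> ?T) \<otimes> s ?p = D i \<otimes> s ?p \<otimes> D i" using cl by (simp add: m_assoc pi)
  also have "\<dots> = (s ?p \<otimes> D i) \<otimes> D ?p \<oplus> D ?p \<otimes> D i \<otimes> s ?p \<oplus> (s ?p \<otimes> D i) \<otimes> s ?p"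
    using DsD_rel[OF i' i] by simp
  also have "\<dots> = ?T \<otimes> (s ?p \<otimes> D ?p) \<oplus> D ?p \<otimes> D i \<otimes> s ?p \<oplus> ?T \<otimes> (s ?p \<otimes> s ?p)"
    unfolding pi using cl by (simp add: m_assoc)
  also have "\<dots> = (?T \<ominus> ?T \<otimes> D ?p \<oplus> D ?p \<otimes> D i) \<otimes> s ?p"
    unfolding sp s_s[OF i'] using cl by (simp only: mult_minus minus_closed m_closed one_closed r_one) algebra
  finally have "D i \<otimes> ?T = ?T \<ominus> ?T \<otimes> D ?p \<oplus> D ?p \<otimes> D i"
    by (rule cancel) (use cl i' in simp_all)
  then show "D ?p \<otimes> D i = D i \<otimes> ?T \<oplus> ?T \<otimes> D ?p \<ominus> ?T"
    using cl by algebra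
qed

text \<open>A permutation taking 1, 2, 3 to a < b < c keeps all three pairs in order and so
  conjugates \<open>D_triple\<close> at 1.\<close>

lemma Dp_triple:
  assumes abc: "1 \<le> a" "a < b" "b < c" "c \<le> n"
  shows "Dp a b \<otimes> Dp b c = Dp a c \<otimes> Dp a b \<oplus> Dp b c \<otimes> Dp a c \<ominus> Dp a c"
    and "Dp b c \<otimes> Dp a b = Dp a b \<otimes> Dp a c \<oplus> Dp a c \<otimes> Dp b c \<ominus> Dp a c"
proof -
  have n: "3 \<le> n" using abc by auto
  define f where "f = (\<lambda>x::nat. if x = 1 then a else if x = 2 then b else c)"
  have "inj_on f {1, 2, 3}" "f ` {1, 2, 3} \<subseteq> {1..n}" "{1, 2, 3} \<subseteq> {1..n}"
    using n abc by (auto simp: f_def inj_on_def)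
  then obtain v where v: "v permutes {1..n}" and vf: "\<And>x. x \<in> {1, 2, 3} \<Longrightarrow> v x = f x"
    using permutes_extend[of "{1..n}" "{1, 2, 3}" f] by auto
  have val: "v 1 = a" "v 2 = b" "v 3 = c" using vf by (simp_all add: f_def)
  have idx: "1 \<in> {1..<n}" "2 \<in> {1..<n}" "Suc 1 \<in> {1..<n}" using n by auto
  let ?U = "D 1" and ?V = "D 2" and ?T = "Dp 1 3"
  have U: "g v \<otimes> ?U = Dp a b \<otimes> g v"
    using g_D[OF v idx(1)] abc by (simp only: val numeral_2_eq_2[symmetric] One_nat_def[symmetric] Suc_1)
  have V: "g v \<otimes> ?V = Dp b c \<otimes> g v"
    using g_D[OF v idx(2)] abc by (simp add: val flip: numeral_3_eq_3)
  have T: "g v \<otimes> ?T = Dp a c \<otimes> g v"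
    using g_Dp[OF v, of 1 3] abc n by (simp add: val[simplified])
  note cl = perm_rep_closed[OF v] D_mem[OF idx(1)] D_mem[OF idx(2)] Dp_closed[of 1 3, simplified] n
    Dp_closed[of a b] Dp_closed[of b c] Dp_closed[of a c]
  have cls: "g v \<in> carrier R" "?U \<in> carrier R" "?V \<in> carrier R" "?T \<in> carrier R"
    "Dp a b \<in> carrier R" "Dp b c \<in> carrier R" "Dp a c \<in> carrier R"
    using cl abc by simp_all
  have comm: "(x' \<otimes> y') \<otimes> g v = g v \<otimes> (x \<otimes> y)"
    if "g v \<otimes> x = x' \<otimes> g v" "g v \<otimes> y = y' \<otimes> g v"
      "x \<in> carrier R" "y \<in> carrier R" "x' \<in> carrier R" "y' \<in> carrier R" for x y x' y'
    using that cls by (metis m_assoc)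
  have num: "Suc 1 = 2" "Suc (Suc 1) = 3" by simp_all
  note base = D_triple[OF idx(1,3), unfolded num]
  have "(Dp a b \<otimes> Dp b c) \<otimes> g v = g v \<otimes> (?T \<otimes> ?U \<oplus> ?V \<otimes> ?T \<ominus> ?T)"
    using comm[OF U V] cls base(1) by simp
  also have "\<dots> = (Dp a c \<otimes> Dp a b \<oplus> Dp b c \<otimes> Dp a c \<ominus> Dp a c) \<otimes> g v"
    using comm[OF T U] comm[OF V T] T cls
    by (simp add: minus_eq l_distr r_distr l_minus r_minus)
  finally show "Dp a b \<otimes> Dp b c = Dp a c \<otimes> Dp a b \<oplus> Dp b c \<otimes> Dp a c \<ominus> Dp a c"
    by (rule g_right_cancel[OF v, rotated 2]) (use cls in simp_all)
  have "(Dp b c \<otimes> Dp a b) \<otimes> g v = g v \<otimes> (?U \<otimes> ?T \<oplus> ?T \<otimes> ?V \<ominus> ?T)"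
    using comm[OF V U] cls base(2) by simp
  also have "\<dots> = (Dp a b \<otimes> Dp a c \<oplus> Dp a c \<otimes> Dp b c \<ominus> Dp a c) \<otimes> g v"
    using comm[OF T V] comm[OF U T] T cls
    by (simp add: minus_eq l_distr r_distr l_minus r_minus)
  finally show "Dp b c \<otimes> Dp a b = Dp a b \<otimes> Dp a c \<oplus> Dp a c \<otimes> Dp b c \<ominus> Dp a c"
    by (rule g_right_cancel[OF v, rotated 2]) (use cls in simp_all)
qed

text \<open>The value at a decreasing pair is the coefficient in \<open>g_Dp_reverse\<close>: up to
  the correction term, moving \<open>g w\<close> past \<open>Dp i j\<close> always yields
  \<open>E (w i) (w j)\<close>.\<close>

definition E :: "nat \<Rightarrow> nat \<Rightarrow> 'a" where
  "E i j = (if i < j then Dp i j else \<one> \<ominus> Dp j i)"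

lemma E_closed: "i \<in> {1..n} \<Longrightarrow> j \<in> {1..n} \<Longrightarrow> i \<noteq> j \<Longrightarrow> E i j \<in> carrier R"
  by (auto simp: E_def intro!: Dp_closed minus_closed)

lemma E_swap:
  assumes "i \<in> {1..n}" "j \<in> {1..n}" "i \<noteq> j"
  shows "E j i = \<one> \<ominus> E i j"
proof (cases "i < j")
  case False
  then have "Dp j i \<in> carrier R" using assms by (auto intro: Dp_closed)
  then have "Dp j i = \<one> \<ominus> (\<one> \<ominus> Dp j i)" by algebra
  then show ?thesis using False assms by (simp add: E_def)
qed (simp add: E_def)

lemma E_sq:
  assumes "i \<in> {1..n}" "j \<in> {1..n}" "i \<noteq> j"
  shows "E i j \<otimes> E i j = E i j"
proof (cases "i < j")
  case True
  then show ?thesis using assms by (auto simp: E_def intro: Dp_sq)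
next
  case False
  then have c: "Dp j i \<in> carrier R" "Dp j i \<otimes> Dp j i = Dp j i" using assms by (auto intro: Dp_closed Dp_sq)
  then show ?thesis using False by (simp add: E_def one_minus_mult) algebra
qed

lemma E_commute:
  assumes "i \<in> {1..n}" "j \<in> {1..n}" "k \<in> {1..n}" "l \<in> {1..n}" "distinct [i, j, k, l]"
  shows "E i j \<otimes> E k l = E k l \<otimes> E i j"
proof -
  have c: "x \<otimes> y = y \<otimes> x \<Longrightarrow> (\<one> \<ominus> x) \<otimes> y = y \<otimes> (\<one> \<ominus> x)"
    "x \<otimes> y = y \<otimes> x \<Longrightarrow> x \<otimes> (\<one> \<ominus> y) = (\<one> \<ominus> y) \<otimes> x"
    "x \<otimes> y = y \<otimes> x \<Longrightarrow> (\<one> \<ominus> x) \<otimes> (\<one> \<ominus> y) = (\<one> \<ominus> y) \<otimes> (\<one> \<ominus> x)"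
    if "x \<in> carrier R" "y \<in> carrier R" for x y
    using that by (simp_all add: one_minus_mult) algebra
  consider "i < j" "k < l" | "i < j" "l < k" | "j < i" "k < l" | "j < i" "l < k"
    using assms(5) by fastforce
  then show ?thesis
    by cases (use assms in \<open>auto simp: E_def intro!: c Dp_closed Dp_commute\<close>)
qed

text \<open>In each of the six orderings of the indices this unfolds to a consequence of the two
  relations in \<open>Dp_triple\<close>.\<close>

lemma E_triple:
  assumes "a \<in> {1..n}" "b \<in> {1..n}" "c \<in> {1..n}" "distinct [a, b, c]"
  shows "E a c \<otimes> E b c = E b c \<otimes> E a b \<oplus> E b a \<otimes> E a c"
proof -
  \<comment> \<open>U, V, T play D_pq, D_qr, D_pr for p < q < r; the six conjuncts are the six ways
    to assign a, b, c to p, q, r, in the order of the later cases.\<close>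
  have key: "\<lbrakk>U \<in> carrier R; V \<in> carrier R; T \<in> carrier R;
      U \<otimes> V = T \<otimes> U \<oplus> V \<otimes> T \<ominus> T; V \<otimes> U = U \<otimes> T \<oplus> T \<otimes> V \<ominus> T\<rbrakk> \<Longrightarrow>
      T \<otimes> V = V \<otimes> U \<oplus> (\<one> \<ominus> U) \<otimes> T \<and>
      U \<otimes> (\<one> \<ominus> V) = (\<one> \<ominus> V) \<otimes> T \<oplus> (\<one> \<ominus> T) \<otimes> U \<and>
      V \<otimes> T = T \<otimes> (\<one> \<ominus> U) \<oplus> U \<otimes> V \<and>
      (\<one> \<ominus> V) \<otimes> U = U \<otimes> (\<one> \<ominus> T) \<oplus> T \<otimes> (\<one> \<ominus> V) \<and>
      (\<one> \<ominus> U) \<otimes> (\<one> \<ominus> T) = (\<one> \<ominus> T) \<otimes> V \<oplus> (\<one> \<ominus> V) \<otimes> (\<one> \<ominus> U) \<and>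
      (\<one> \<ominus> T) \<otimes> (\<one> \<ominus> U) = (\<one> \<ominus> U) \<otimes> (\<one> \<ominus> V) \<oplus> V \<otimes> (\<one> \<ominus> T)" for U V T
    by (intro conjI; simp only: one_minus_mult minus_closed one_closed m_closed; algebra)
  have sorted: "Dp p r \<otimes> Dp q r = Dp q r \<otimes> Dp p q \<oplus> (\<one> \<ominus> Dp p q) \<otimes> Dp p r \<and>
      Dp p q \<otimes> (\<one> \<ominus> Dp q r) = (\<one> \<ominus> Dp q r) \<otimes> Dp p r \<oplus> (\<one> \<ominus> Dp p r) \<otimes> Dp p q \<and>
      Dp q r \<otimes> Dp p r = Dp p r \<otimes> (\<one> \<ominus> Dp p q) \<oplus> Dp p q \<otimes> Dp q r \<and>
      (\<one> \<ominus> Dp q r) \<otimes> Dp p q = Dp p q \<otimes> (\<one> \<ominus> Dp p r) \<oplus> Dp p r \<otimes> (\<one> \<ominus> Dp q r) \<and>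
      (\<one> \<ominus> Dp p q) \<otimes> (\<one> \<ominus> Dp p r) = (\<one> \<ominus> Dp p r) \<otimes> Dp q r \<oplus> (\<one> \<ominus> Dp q r) \<otimes> (\<one> \<ominus> Dp p q) \<and>
      (\<one> \<ominus> Dp p r) \<otimes> (\<one> \<ominus> Dp p q) = (\<one> \<ominus> Dp p q) \<otimes> (\<one> \<ominus> Dp q r) \<oplus> Dp q r \<otimes> (\<one> \<ominus> Dp p r)"
    if "1 \<le> p" "p < q" "q < r" "r \<le> n" for p q r
    by (rule key) (use that Dp_triple[OF that] in \<open>auto intro: Dp_closed\<close>)
  consider "a < b" "b < c" | "a < c" "c < b" | "b < a" "a < c" | "b < c" "c < a" | "c < a" "a < b" | "c < b" "b < a"
    using assms(4) by fastforce
  then show ?thesis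
  proof cases
    case 1
    then show ?thesis using sorted[of a b c] assms by (auto simp: E_def)
  next
    case 2
    then show ?thesis using sorted[of a c b] assms by (auto simp: E_def)
  next
    case 3
    then show ?thesis using sorted[of b a c] assms by (auto simp: E_def)
  next
    case 4
    then show ?thesis using sorted[of b c a] assms by (auto simp: E_def)
  next
    case 5
    then show ?thesis using sorted[of c a b] assms by (auto simp: E_def)
  next
    case 6
    then show ?thesis using sorted[of c b a] assms by (auto simp: E_def)
  qed
qed

text \<open>This is \<open>E_triple\<close> with \<open>a\<close> and \<open>c\<close> exchanged,
  every factor being rewritten by E_yx = 1 - E_xy. It serves the mirror image of the cubic
  relation.\<close>

lemma E_triple':
  assumes "a \<in> {1..n}" "b \<in> {1..n}" "c \<in> {1..n}" "distinct [a, b, c]"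
  shows "E a c \<otimes> E a b = E a b \<otimes> E b c \<oplus> E c b \<otimes> E a c"
proof -
  have key: "U \<otimes> V = V \<otimes> T \<oplus> (\<one> \<ominus> T) \<otimes> U"
    if cl: "U \<in> carrier R" "V \<in> carrier R" "T \<in> carrier R"
      and rel: "(\<one> \<ominus> U) \<otimes> (\<one> \<ominus> V) = (\<one> \<ominus> V) \<otimes> (\<one> \<ominus> T) \<oplus> T \<otimes> (\<one> \<ominus> U)" for U V T
  proof -
    have "U \<otimes> V = (\<one> \<ominus> U) \<otimes> (\<one> \<ominus> V) \<oplus> U \<oplus> V \<ominus> \<one>"
      using cl by (simp only: one_minus_mult minus_closed one_closed) algebra
    then show ?thesis
      unfolding rel using cl by (simp only: one_minus_mult minus_closed one_closed) algebra
  qed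
  have "E c a = \<one> \<ominus> E a c" "E b a = \<one> \<ominus> E a b" "E c b = \<one> \<ominus> E b c"
    using assms by (auto intro: E_swap)
  then show ?thesis
    using E_triple[of c b a] assms
    by (simp only:) (rule key, auto intro: E_closed)
qed

end

section \<open>Ring identities for the values of the operators at one permutation\<close>

context ring begin

lemma additive_values:
  assumes cl: "x \<in> carrier R" "y \<in> carrier R" "u \<in> carrier R" "v \<in> carrier R" "e \<in> carrier R"
  shows "(x \<oplus> y) \<otimes> e \<ominus> (if P then u \<oplus> v else \<zero>)
    = (x \<otimes> e \<ominus> (if P then u else \<zero>)) \<oplus> (y \<otimes> e \<ominus> (if P then v else \<zero>))"
proof (cases P)
  case True
  show ?thesis unfolding if_P[OF True] using cl by algebra
next
  case False
  show ?thesis unfolding if_not_P[OF False] using cl by algebra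
qed

text \<open>Here x0 = m(w), x1 = m(w s_i), \<open>e\<close> is the coefficient at w, and P says that
  w ascends at i. Passing to w s_i replaces e by 1 - e and P by its negation, so the terms in e
  cancel.\<close>

lemma linear_values:
  assumes cl: "x0 \<in> carrier R" "x1 \<in> carrier R" "e \<in> carrier R"
  shows "(x1 \<otimes> e \<ominus> (if P then x0 else \<zero>)) \<oplus> (x1 \<otimes> (\<one> \<ominus> e) \<ominus> (if \<not> P then x0 else \<zero>)) = x1 \<ominus> x0"
proof (cases P)
  case True
  then have P: "P = True" by simp
  show ?thesis
    unfolding P if_True if_False not_True_eq_False one_minus_mult(2)[OF cl(3,2)]
    using cl by algebra
next
  case False
  show ?thesis
    unfolding if_P[OF False] if_not_P[OF False] one_minus_mult(2)[OF cl(3,2)]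
    using cl by algebra
qed

lemma square_values:
  assumes cl: "x0 \<in> carrier R" "x1 \<in> carrier R" "e \<in> carrier R" and sq: "e \<otimes> e = e"
  shows "(x0 \<otimes> e \<ominus> (if P then x1 else \<zero>)) \<otimes> e
      \<ominus> (if P then x1 \<otimes> (\<one> \<ominus> e) \<ominus> (if \<not> P then x0 else \<zero>) else \<zero>)
    = x0 \<otimes> e \<ominus> (if P then x1 else \<zero>)"
proof (cases P)
  case True
  then have P: "P = True" by simp
  show ?thesis
    unfolding P if_True if_False not_True_eq_False one_minus_mult(2)[OF cl(3,2)]
    using cl sq by algebra
next
  case False
  show ?thesis
    unfolding if_not_P[OF False] using cl sq by algebra
qed

lemma commuting_values:
  assumes cl: "x0 \<in> carrier R" "x1 \<in> carrier R" "x2 \<in> carrier R" "x3 \<in> carrier R"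
      "e \<in> carrier R" "f \<in> carrier R" and comm: "e \<otimes> f = f \<otimes> e"
  shows "(x0 \<otimes> e \<ominus> (if P then x1 else \<zero>)) \<otimes> f \<ominus> (if Q then x2 \<otimes> e \<ominus> (if P then x3 else \<zero>) else \<zero>)
    = (x0 \<otimes> f \<ominus> (if Q then x2 else \<zero>)) \<otimes> e \<ominus> (if P then x1 \<otimes> f \<ominus> (if Q then x3 else \<zero>) else \<zero>)"
proof -
  have swap: "x0 \<otimes> e \<otimes> f = x0 \<otimes> f \<otimes> e" using cl comm by (simp add: m_assoc)
  consider "P = True" "Q = True" | "P = True" "Q = False" | "P = False" "Q = True" | "P = False" "Q = False"
    by blast
  then show ?thesis
  proof cases
    case 1
    show ?thesis unfolding 1 if_True using cl swap by algebra
  next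
    case 2
    show ?thesis unfolding 2 if_True if_False using cl swap by algebra
  next
    case 3
    show ?thesis unfolding 3 if_True if_False using cl swap by algebra
  next
    case 4
    show ?thesis unfolding 4 if_False using cl swap by algebra
  qed
qed

text \<open>In the next lemma the \<open>x\<^sub>k\<close> are the values of a function at \<open>w u\<close> for \<open>u\<close> in a parabolic
  subgroup \<open>S\<^sub>3\<close>, and \<open>P\<close>, \<open>Q\<close>, \<open>S\<close> compare three consecutive values of \<open>w\<close>.\<close>

lemma cubic_values:
  assumes cl: "x0 \<in> carrier R" "x1 \<in> carrier R" "x2 \<in> carrier R" "x3 \<in> carrier R" "x4 \<in> carrier R"
      "e \<in> carrier R" "e' \<in> carrier R" "f \<in> carrier R" "h \<in> carrier R"
    and rel: "h \<otimes> f = f \<otimes> e \<oplus> e' \<otimes> h" and PQS: "P \<Longrightarrow> Q \<Longrightarrow> S" "S \<Longrightarrow> P \<or> Q"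
  shows
    "(x1 \<otimes> h \<ominus> (if S then x2 else \<zero>)) \<otimes> f
       \<ominus> (if Q then x3 \<otimes> e \<ominus> (if P then x4 else \<zero>) else \<zero>)
     = ((x1 \<otimes> f \<ominus> (if Q then x3 else \<zero>)) \<otimes> e
         \<ominus> (if P then x0 \<otimes> h \<ominus> (if S then x4 else \<zero>) else \<zero>))
       \<oplus> ((x1 \<otimes> e' \<ominus> (if \<not> P then x0 else \<zero>)) \<otimes> h
         \<ominus> (if S then x2 \<otimes> f \<ominus> (if Q then x4 else \<zero>) else \<zero>))
       \<oplus> (x0 \<otimes> h \<ominus> (if S then x4 else \<zero>))"
proof -
  \<comment> \<open>The two excluded combinations violate transitivity; the remaining six are the
    orderings of three distinct values.\<close>
  consider "P = True" "Q = True" "S = True" | "P = True" "Q = False" "S = True"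
    | "P = True" "Q = False" "S = False" | "P = False" "Q = True" "S = True"
    | "P = False" "Q = True" "S = False" | "P = False" "Q = False" "S = False"
    using PQS by blast
  then show ?thesis
  proof cases
    case 1
    show ?thesis unfolding 1 if_True if_False not_True_eq_False using cl rel by algebra
  next
    case 2
    show ?thesis unfolding 2 if_True if_False not_True_eq_False using cl rel by algebra
  next
    case 3
    show ?thesis unfolding 3 if_True if_False not_True_eq_False using cl rel by algebra
  next
    case 4
    show ?thesis unfolding 4 if_True if_False not_False_eq_True using cl rel by algebra
  next
    case 5
    show ?thesis unfolding 5 if_True if_False not_False_eq_True using cl rel by algebra
  next
    case 6
    show ?thesis unfolding 6 if_True if_False not_False_eq_True using cl rel by algebra
  qed
qed

end

context HSn_elements begin

section \<open>The right module of functions on the symmetric group\<close>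

text \<open>A function \<open>m\<close> on \<open>S\<^sub>n\<close> stands for the formal sum \<open>\<Sum>\<^sub>w m(w) w\<close>.  The two operators below are
  right multiplication by \<open>s\<^sub>i\<close> and \<open>D\<^sub>i\<close> if one moves \<open>w\<close> to the right by the rules
  \<open>w D\<^sub>i = D\<^sub>a\<^sub>b w\<close> if \<open>a = w(i) < b = w(i + 1)\<close>, and \<open>w D\<^sub>i = (1 - D\<^sub>b\<^sub>a) w - w s\<^sub>i\<close> otherwise.\<close>

definition fun_module :: "((nat \<Rightarrow> nat) \<Rightarrow> 'a) monoid" where
  "fun_module = product_group (carrier (sym_group n)) (\<lambda>_. add_monoid R)"

lemma carrier_fun_module: "carrier fun_module = (carrier (sym_group n) \<rightarrow>\<^sub>E carrier R)"
  by (simp add: fun_module_def)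

lemma fun_module_closed: "m \<in> carrier fun_module \<Longrightarrow> w permutes {1..n} \<Longrightarrow> m w \<in> carrier R"
  using PiE_mem[of m "carrier (sym_group n)" "\<lambda>_. carrier R" w]
  by (simp only: carrier_fun_module sym_group_carrier)

lemma fun_module_mult: "w permutes {1..n} \<Longrightarrow> (m \<otimes>\<^bsub>fun_module\<^esub> m') w = m w \<oplus> m' w"
  by (simp add: fun_module_def sym_group_carrier)

lemma fun_module_one: "w permutes {1..n} \<Longrightarrow> \<one>\<^bsub>fun_module\<^esub> w = \<zero>"
  by (simp add: fun_module_def sym_group_carrier)

lemma comm_group_fun_module: "comm_group fun_module"
proof (rule group.group_comm_groupI)
  show "Group.group fun_module"
    unfolding fun_module_def by (intro product_group a_group)
  show "x \<otimes>\<^bsub>fun_module\<^esub> y = y \<otimes>\<^bsub>fun_module\<^esub> x"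
    if "x \<in> carrier fun_module" "y \<in> carrier fun_module" for x y
    using that by (auto simp: fun_module_def fun_eq_iff a_comm PiE_iff)
qed

abbreviation Endo where "Endo \<equiv> right_endo_ring fun_module"

lemma ring_Endo: "ring Endo"
  by (rule ring_right_endo_ring[OF comm_group_fun_module])

definition op_s :: "nat \<Rightarrow> ((nat \<Rightarrow> nat) \<Rightarrow> 'a) \<Rightarrow> (nat \<Rightarrow> nat) \<Rightarrow> 'a" where
  "op_s i = (\<lambda>m\<in>carrier fun_module. \<lambda>w\<in>carrier (sym_group n). m (w \<circ> adj i))"

text \<open>The value at w collects all terms that end up at w. The correction comes from w s_i,
  which must descend at i; hence the test is for an ascent of w itself.\<close>

definition op_D :: "nat \<Rightarrow> ((nat \<Rightarrow> nat) \<Rightarrow> 'a) \<Rightarrow> (nat \<Rightarrow> nat) \<Rightarrow> 'a" where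
  "op_D i = (\<lambda>m\<in>carrier fun_module. \<lambda>w\<in>carrier (sym_group n).
     m w \<otimes> E (w i) (w (Suc i)) \<ominus> (if w i < w (Suc i) then m (w \<circ> adj i) else \<zero>))"

lemma op_s_apply:
  "m \<in> carrier fun_module \<Longrightarrow> w permutes {1..n} \<Longrightarrow> op_s i m w = m (w \<circ> adj i)"
  by (simp add: op_s_def sym_group_carrier)

lemma op_D_apply:
  "m \<in> carrier fun_module \<Longrightarrow> w permutes {1..n} \<Longrightarrow>
    op_D i m w = m w \<otimes> E (w i) (w (Suc i)) \<ominus> (if w i < w (Suc i) then m (w \<circ> adj i) else \<zero>)"
  by (simp add: op_D_def sym_group_carrier)

lemma perm_image: "w permutes {1..n} \<Longrightarrow> k \<in> {1..n} \<Longrightarrow> w k \<in> {1..n}"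
  by (simp only: permutes_in_image)

lemma perm_eq_iff: "w permutes {1..n} \<Longrightarrow> w k = w l \<longleftrightarrow> k = l"
  by (rule inj_eq[OF permutes_inj])

lemma E_perm_closed:
  assumes w: "w permutes {1..n}" and kl: "k \<in> {1..n}" "l \<in> {1..n}" "k \<noteq> l"
  shows "E (w k) (w l) \<in> carrier R"
  by (rule E_closed[OF perm_image[OF w kl(1)] perm_image[OF w kl(2)]])
     (use kl(3) perm_eq_iff[OF w] in simp)

lemma op_s_closed:
  assumes i: "i \<in> {1..<n}" and m: "m \<in> carrier fun_module"
  shows "op_s i m \<in> carrier fun_module"
  unfolding carrier_fun_module
proof (rule PiE_I)
  fix w assume "w \<in> carrier (sym_group n)"
  then have w: "w permutes {1..n}" by (simp only: sym_group_carrier)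
  show "op_s i m w \<in> carrier R"
    unfolding op_s_apply[OF m w] by (rule fun_module_closed[OF m comp_adj_permutes[OF w i]])
qed (use m in \<open>simp add: op_s_def\<close>)

lemma op_D_closed:
  assumes i: "i \<in> {1..<n}" and m: "m \<in> carrier fun_module"
  shows "op_D i m \<in> carrier fun_module"
  unfolding carrier_fun_module
proof (rule PiE_I)
  fix w assume "w \<in> carrier (sym_group n)"
  then have w: "w permutes {1..n}" by (simp only: sym_group_carrier)
  have "E (w i) (w (Suc i)) \<in> carrier R" using i by (intro E_perm_closed[OF w]) auto
  then show "op_D i m w \<in> carrier R"
    using fun_module_closed[OF m w] fun_module_closed[OF m comp_adj_permutes[OF w i]]
    unfolding op_D_apply[OF m w] by simp
qed (use m in \<open>simp add: op_D_def\<close>)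

lemma Endo_memI:
  assumes closed: "\<And>m. m \<in> carrier fun_module \<Longrightarrow> f m \<in> carrier fun_module"
    and add: "\<And>m m' w. m \<in> carrier fun_module \<Longrightarrow> m' \<in> carrier fun_module \<Longrightarrow> w permutes {1..n} \<Longrightarrow>
      f (m \<otimes>\<^bsub>fun_module\<^esub> m') w = f m w \<oplus> f m' w"
    and ext: "f \<in> extensional (carrier fun_module)"
  shows "f \<in> carrier Endo"
proof -
  interpret M: comm_group fun_module by (rule comm_group_fun_module)
  have "f (m \<otimes>\<^bsub>fun_module\<^esub> m') = f m \<otimes>\<^bsub>fun_module\<^esub> f m'"
    if m: "m \<in> carrier fun_module" "m' \<in> carrier fun_module" for m m'
  proof (rule extensionalityI[where A = "carrier (sym_group n)"])
    show "f (m \<otimes>\<^bsub>fun_module\<^esub> m') \<in> extensional (carrier (sym_group n))"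
      "f m \<otimes>\<^bsub>fun_module\<^esub> f m' \<in> extensional (carrier (sym_group n))"
      using closed[OF M.m_closed[OF m]] M.m_closed[OF closed[OF m(1)] closed[OF m(2)]]
      by (simp_all add: carrier_fun_module PiE_iff)
  qed (use add[OF m] in \<open>simp add: sym_group_carrier fun_module_mult\<close>)
  then show ?thesis using ext closed by (simp add: carrier_right_endo_ring hom_def)
qed

lemma op_s_Endo: assumes i: "i \<in> {1..<n}" shows "op_s i \<in> carrier Endo"
proof (rule Endo_memI)
  interpret M: comm_group fun_module by (rule comm_group_fun_module)
  fix m m' w assume m: "m \<in> carrier fun_module" "m' \<in> carrier fun_module" and w: "w permutes {1..n}"
  show "op_s i (m \<otimes>\<^bsub>fun_module\<^esub> m') w = op_s i m w \<oplus> op_s i m' w"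
    by (simp only: op_s_apply[OF _ w] m M.m_closed fun_module_mult[OF comp_adj_permutes[OF w i]])
qed (simp_all add: op_s_closed[OF i], simp add: op_s_def)

lemma op_D_Endo: assumes i: "i \<in> {1..<n}" shows "op_D i \<in> carrier Endo"
proof (rule Endo_memI)
  interpret M: comm_group fun_module by (rule comm_group_fun_module)
  fix m m' w assume m: "m \<in> carrier fun_module" "m' \<in> carrier fun_module" and w: "w permutes {1..n}"
  have "E (w i) (w (Suc i)) \<in> carrier R" using i by (intro E_perm_closed[OF w]) auto
  note cl = this fun_module_closed[OF m(1) w] fun_module_closed[OF m(2) w]
    fun_module_closed[OF m(1) comp_adj_permutes[OF w i]]
    fun_module_closed[OF m(2) comp_adj_permutes[OF w i]]
  show "op_D i (m \<otimes>\<^bsub>fun_module\<^esub> m') w = op_D i m w \<oplus> op_D i m' w"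
    by (simp only: op_D_apply[OF _ w] m M.m_closed fun_module_mult[OF w]
          fun_module_mult[OF comp_adj_permutes[OF w i]] additive_values[OF cl(2-5,1)])
qed (simp_all add: op_D_closed[OF i], simp add: op_D_def)

lemma Endo_apply_closed: "f \<in> carrier Endo \<Longrightarrow> m \<in> carrier fun_module \<Longrightarrow> f m \<in> carrier fun_module"
  by (auto simp: carrier_right_endo_ring hom_def)

lemma Endo_minus_zeroI:
  assumes f: "f \<in> carrier Endo" and h: "h \<in> carrier Endo"
    and eq: "\<And>m w. m \<in> carrier fun_module \<Longrightarrow> w permutes {1..n} \<Longrightarrow> f m w = h m w"
  shows "f \<ominus>\<^bsub>Endo\<^esub> h \<in> {\<zero>\<^bsub>Endo\<^esub>}"
proof -
  interpret En: ring Endo by (rule ring_Endo)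
  have "f m = h m" if "m \<in> carrier fun_module" for m
    by (rule extensionalityI[where A = "carrier (sym_group n)"])
       (use eq[OF that] Endo_apply_closed[OF f that] Endo_apply_closed[OF h that]
        in \<open>simp_all add: carrier_fun_module PiE_iff sym_group_carrier\<close>)
  then have "f = h"
    using f h by (intro extensionalityI[where A = "carrier fun_module"]) (auto simp: carrier_right_endo_ring)
  then show ?thesis using h by simp
qed

lemma Endo_minus_apply:
  assumes f: "f \<in> carrier Endo" and h: "h \<in> carrier Endo"
    and m: "m \<in> carrier fun_module" and w: "w permutes {1..n}"
  shows "(f \<ominus>\<^bsub>Endo\<^esub> h) m w = f m w \<ominus> h m w"
proof -
  interpret En: ring Endo by (rule ring_Endo)
  have "f = (f \<ominus>\<^bsub>Endo\<^esub> h) \<oplus>\<^bsub>Endo\<^esub> h" using f h by (simp add: En.minus_eq En.a_assoc En.l_neg)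
  then have "f m w = (f \<ominus>\<^bsub>Endo\<^esub> h) m w \<oplus> h m w"
    by (metis right_endo_ring_apply(2)[OF m] fun_module_mult[OF w])
  moreover have "(f \<ominus>\<^bsub>Endo\<^esub> h) m w \<in> carrier R" "h m w \<in> carrier R"
    using Endo_apply_closed[OF _ m] fun_module_closed[OF _ w] f h En.minus_closed by blast+
  ultimately show ?thesis by (simp add: minus_eq a_assoc r_neg)
qed

text \<open>Evaluated at \<open>m\<close> and \<open>w\<close>, a relation compares values of
  \<open>m\<close> on the coset of \<open>w\<close> by the subgroup generated by the adjacent
  transpositions involved. Commutation or the braid relation matches the arguments, and
  \<open>E_swap\<close>, \<open>E_sq\<close>, \<open>E_commute\<close> and the triple identities
  match the coefficients.\<close>

lemma op_relators: "HSn_relators Endo n op_s op_D \<subseteq> {\<zero>\<^bsub>Endo\<^esub>}"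
proof
  interpret En: ring Endo by (rule ring_Endo)
  note cl = op_s_Endo op_D_Endo
  note fm = op_s_closed op_D_closed
  note app = right_endo_ring_apply fun_module_mult op_s_apply op_D_apply fm comp_adj_permutes comp_apply
    fun_module_closed adj_apply
  note E = E_perm_closed
  fix x assume "x \<in> HSn_relators Endo n op_s op_D"
  then show "x \<in> {\<zero>\<^bsub>Endo\<^esub>}"
  proof (induction rule: HSn_relators.induct)
    case (s_sq i)
    show ?case
    proof (rule Endo_minus_zeroI)
      fix m w assume m: "m \<in> carrier fun_module" and w: "w permutes {1..n}"
      note wi = comp_adj_permutes[OF w s_sq]
      show "(op_s i \<otimes>\<^bsub>Endo\<^esub> op_s i) m w = \<one>\<^bsub>Endo\<^esub> m w"
        by (simp only: app m w wi s_sq comp_adj_adj)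
    qed (use s_sq cl in simp_all)
  next
    case (s_D i)
    show ?case
    proof (rule Endo_minus_zeroI)
      fix m w assume m: "m \<in> carrier fun_module" and w: "w permutes {1..n}"
      note wi = comp_adj_permutes[OF w s_D]
      have ab: "w i \<in> {1..n}" "w (Suc i) \<in> {1..n}" "w i \<noteq> w (Suc i)"
        using s_D perm_image[OF w, of i] perm_image[OF w, of "Suc i"] perm_eq_iff[OF w] by simp_all
      then have neg: "w (Suc i) < w i \<longleftrightarrow> \<not> w i < w (Suc i)" by linarith
      show "(op_s i \<otimes>\<^bsub>Endo\<^esub> op_D i \<oplus>\<^bsub>Endo\<^esub> op_D i \<otimes>\<^bsub>Endo\<^esub> op_s i) m w
          = (op_s i \<ominus>\<^bsub>Endo\<^esub> \<one>\<^bsub>Endo\<^esub>) m w"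
        using linear_values[OF fun_module_closed[OF m w] fun_module_closed[OF m wi] E_closed[OF ab],
            of "w i < w (Suc i)"]
        by (simp only: Endo_minus_apply[OF op_s_Endo[OF s_D] En.one_closed m w] app m w wi s_D
            comp_adj_adj E_swap[OF ab] neg)
    qed (use s_D cl in simp_all)
  next
    case (D_sq i)
    show ?case
    proof (rule Endo_minus_zeroI)
      fix m w assume m: "m \<in> carrier fun_module" and w: "w permutes {1..n}"
      note wi = comp_adj_permutes[OF w D_sq]
      have ab: "w i \<in> {1..n}" "w (Suc i) \<in> {1..n}" "w i \<noteq> w (Suc i)"
        using D_sq perm_image[OF w, of i] perm_image[OF w, of "Suc i"] perm_eq_iff[OF w] by simp_all
      then have neg: "w (Suc i) < w i \<longleftrightarrow> \<not> w i < w (Suc i)" by linarith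
      show "(op_D i \<otimes>\<^bsub>Endo\<^esub> op_D i) m w = op_D i m w"
        using square_values[OF fun_module_closed[OF m w] fun_module_closed[OF m wi] E_closed[OF ab] E_sq[OF ab],
            of "w i < w (Suc i)"]
        by (simp only: app m w wi D_sq comp_adj_adj E_swap[OF ab] neg)
    qed (use D_sq cl in simp_all)
  next
    case (ss_far i j)
    show ?case
    proof (rule Endo_minus_zeroI)
      fix m w assume m: "m \<in> carrier fun_module" and w: "w permutes {1..n}"
      note wi = comp_adj_permutes[OF w ss_far(1)] and wj = comp_adj_permutes[OF w ss_far(2)]
      have comm: "w \<circ> adj j \<circ> adj i = w \<circ> adj i \<circ> adj j"
        using adj_commute[OF ss_far(3)] by (simp add: comp_assoc)
      show "(op_s j \<otimes>\<^bsub>Endo\<^esub> op_s i) m w = (op_s i \<otimes>\<^bsub>Endo\<^esub> op_s j) m w"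
        by (simp only: app m w wi wj ss_far(1,2) comm)
    qed (use ss_far cl in simp_all)
  next
    case (Ds_far i j)
    show ?case
    proof (rule Endo_minus_zeroI)
      fix m w assume m: "m \<in> carrier fun_module" and w: "w permutes {1..n}"
      note wi = comp_adj_permutes[OF w Ds_far(1)] and wj = comp_adj_permutes[OF w Ds_far(2)]
      have adj: "adj i j = j" "adj i (Suc j) = Suc j" using Ds_far(3) by auto
      have comm: "w \<circ> adj j \<circ> adj i = w \<circ> adj i \<circ> adj j"
        using adj_commute[OF Ds_far(3)] by (simp add: comp_assoc)
      show "(op_D j \<otimes>\<^bsub>Endo\<^esub> op_s i) m w = (op_s i \<otimes>\<^bsub>Endo\<^esub> op_D j) m w"
        by (simp only: app m w wi wj Ds_far(1,2) adj comm)
    qed (use Ds_far cl in simp_all)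
  next
    case (DD_far i j)
    show ?case
    proof (rule Endo_minus_zeroI)
      fix m w assume m: "m \<in> carrier fun_module" and w: "w permutes {1..n}"
      note i = DD_far(1) and j = DD_far(2)
      note wi = comp_adj_permutes[OF w i] and wj = comp_adj_permutes[OF w j]
      note wij = comp_adj_permutes[OF wi j] and wji = comp_adj_permutes[OF wj i]
      have adj: "adj i j = j" "adj i (Suc j) = Suc j" "adj j i = i" "adj j (Suc i) = Suc i"
        using DD_far(3) by auto
      have comm: "w \<circ> adj j \<circ> adj i = w \<circ> adj i \<circ> adj j"
        using adj_commute[OF DD_far(3)] by (simp add: comp_assoc)
      have Ecl: "E (w i) (w (Suc i)) \<in> carrier R" "E (w j) (w (Suc j)) \<in> carrier R"
        using i j by (auto intro!: E[OF w])
      have EE: "E (w i) (w (Suc i)) \<otimes> E (w j) (w (Suc j)) = E (w j) (w (Suc j)) \<otimes> E (w i) (w (Suc i))"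
        using i j DD_far(3) by (intro E_commute perm_image[OF w]) (auto simp: perm_eq_iff[OF w])
      note mcl = fun_module_closed[OF m]
      show "(op_D j \<otimes>\<^bsub>Endo\<^esub> op_D i) m w = (op_D i \<otimes>\<^bsub>Endo\<^esub> op_D j) m w"
        using commuting_values[OF mcl[OF w] mcl[OF wj] mcl[OF wi] mcl[OF wij] Ecl(2,1) EE[symmetric],
            of "w j < w (Suc j)" "w i < w (Suc i)"]
        by (simp only: app m w wi wj wij wji i j adj comm)
    qed (use DD_far cl in simp_all)
  next
    case (sss_near i j)
    show ?case
    proof (rule Endo_minus_zeroI)
      fix m w assume m: "m \<in> carrier fun_module" and w: "w permutes {1..n}"
      note i = sss_near(1) and j = sss_near(2)
      note wi = comp_adj_permutes[OF w i] and wj = comp_adj_permutes[OF w j]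
      note wij = comp_adj_permutes[OF wi j] and wji = comp_adj_permutes[OF wj i]
      have braid: "w \<circ> adj j \<circ> adj i \<circ> adj j = w \<circ> adj i \<circ> adj j \<circ> adj i"
        using adj_braid[OF sss_near(3)] by (simp add: comp_assoc)
      show "(op_s j \<otimes>\<^bsub>Endo\<^esub> op_s i \<otimes>\<^bsub>Endo\<^esub> op_s j) m w = (op_s i \<otimes>\<^bsub>Endo\<^esub> op_s j \<otimes>\<^bsub>Endo\<^esub> op_s i) m w"
        by (simp only: app m w wi wj wij wji i j braid)
    qed (use sss_near cl in simp_all)
  next
    case (Dss_near i j)
    have ij: "j = Suc i \<or> i = Suc j" using Dss_near(3) by linarith
    show ?case
    proof (rule Endo_minus_zeroI)
      fix m w assume m: "m \<in> carrier fun_module" and w: "w permutes {1..n}"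
      note i = Dss_near(1) and j = Dss_near(2)
      note wi = comp_adj_permutes[OF w i] and wj = comp_adj_permutes[OF w j]
      note wij = comp_adj_permutes[OF wi j] and wji = comp_adj_permutes[OF wj i]
      have braid: "w \<circ> adj j \<circ> adj i \<circ> adj j = w \<circ> adj i \<circ> adj j \<circ> adj i"
        using adj_braid[OF Dss_near(3)] by (simp add: comp_assoc)
      show "(op_D i \<otimes>\<^bsub>Endo\<^esub> op_s j \<otimes>\<^bsub>Endo\<^esub> op_s i) m w = (op_s j \<otimes>\<^bsub>Endo\<^esub> op_s i \<otimes>\<^bsub>Endo\<^esub> op_D j) m w"
        using ij
      proof
        assume ji: "j = Suc i"
        have adj: "adj i (Suc (Suc i)) = Suc (Suc i)" "adj (Suc i) i = i" by simp_all
        show ?thesis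
          using i j w wi wj wij wji m braid unfolding ji by (simp only: app adj)
      next
        assume ij: "i = Suc j"
        have adj: "adj j (Suc (Suc j)) = Suc (Suc j)" "adj (Suc j) j = j" by simp_all
        show ?thesis
          using i j w wi wj wij wji m braid unfolding ij by (simp only: app adj)
      qed
    qed (use Dss_near cl in simp_all)
  next
    case (DsD_near i j)
    have ij: "j = Suc i \<or> i = Suc j" using DsD_near(3) by linarith
    show ?case
    proof (rule Endo_minus_zeroI)
      fix m w assume m: "m \<in> carrier fun_module" and w: "w permutes {1..n}"
      note i = DsD_near(1) and j = DsD_near(2)
      note wi = comp_adj_permutes[OF w i] and wj = comp_adj_permutes[OF w j]
      note wij = comp_adj_permutes[OF wi j] and wji = comp_adj_permutes[OF wj i]
      note wiji = comp_adj_permutes[OF wij i]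
      have braid: "w \<circ> adj j \<circ> adj i \<circ> adj j = w \<circ> adj i \<circ> adj j \<circ> adj i"
        using adj_braid[OF DsD_near(3)] by (simp add: comp_assoc)
      note mcl = fun_module_closed[OF m]
      show "(op_D j \<otimes>\<^bsub>Endo\<^esub> op_s i \<otimes>\<^bsub>Endo\<^esub> op_D j) m w =
          (op_s i \<otimes>\<^bsub>Endo\<^esub> op_D j \<otimes>\<^bsub>Endo\<^esub> op_D i \<oplus>\<^bsub>Endo\<^esub> op_D i \<otimes>\<^bsub>Endo\<^esub> op_D j \<otimes>\<^bsub>Endo\<^esub> op_s i
            \<oplus>\<^bsub>Endo\<^esub> op_s i \<otimes>\<^bsub>Endo\<^esub> op_D j \<otimes>\<^bsub>Endo\<^esub> op_s i) m w"
        using ij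
      proof
        assume ji: "j = Suc i"
        have adj: "adj i (Suc (Suc i)) = Suc (Suc i)" "adj (Suc i) i = i" by simp_all
        let ?a = "w i" and ?b = "w (Suc i)" and ?c = "w (Suc (Suc i))"
        have abc: "?a \<in> {1..n}" "?b \<in> {1..n}" "?c \<in> {1..n}" "distinct [?a, ?b, ?c]"
          using i j ji perm_image[OF w, of i] perm_image[OF w, of "Suc i"] perm_image[OF w, of "Suc (Suc i)"]
          by (simp_all add: perm_eq_iff[OF w])
        then have ne: "?a \<noteq> ?b" "?b \<noteq> ?c" "?a \<noteq> ?c" by simp_all
        then have neg: "?b < ?a \<longleftrightarrow> \<not> ?a < ?b" and less: "?a < ?b \<Longrightarrow> ?b < ?c \<Longrightarrow> ?a < ?c"
          "?a < ?c \<Longrightarrow> ?a < ?b \<or> ?b < ?c"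
          by linarith+
        show ?thesis
          \<comment> \<open>In \<open>cubic_values\<close>, e, e', f, h are E_ab, E_ba, E_bc, E_ac,
            and P, Q, S are a < b, b < c, a < c.\<close>
          using i j w wi wj wij wji wiji m braid
            cubic_values[OF mcl[OF w] mcl[OF wi] mcl[OF wij] mcl[OF wji] mcl[OF wiji]
              E_closed[OF abc(1,2) ne(1)] E_closed[OF abc(2,1) ne(1)[symmetric]]
              E_closed[OF abc(2,3) ne(2)] E_closed[OF abc(1,3) ne(3)] E_triple[OF abc] less]
          unfolding ji by (simp only: app adj comp_adj_adj neg)
      next
        assume ij: "i = Suc j"
        have adj: "adj j (Suc (Suc j)) = Suc (Suc j)" "adj (Suc j) j = j" by simp_all
        let ?a = "w j" and ?b = "w (Suc j)" and ?c = "w (Suc (Suc j))"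
        have abc: "?a \<in> {1..n}" "?b \<in> {1..n}" "?c \<in> {1..n}" "distinct [?a, ?b, ?c]"
          using i j ij perm_image[OF w, of j] perm_image[OF w, of "Suc j"] perm_image[OF w, of "Suc (Suc j)"]
          by (simp_all add: perm_eq_iff[OF w])
        then have ne: "?a \<noteq> ?b" "?b \<noteq> ?c" "?a \<noteq> ?c" by simp_all
        then have neg: "?c < ?b \<longleftrightarrow> \<not> ?b < ?c" and less: "?b < ?c \<Longrightarrow> ?a < ?b \<Longrightarrow> ?a < ?c"
          "?a < ?c \<Longrightarrow> ?b < ?c \<or> ?a < ?b"
          by linarith+
        show ?thesis
          \<comment> \<open>The mirror case: e, e', f, h are E_bc, E_cb, E_ab, E_ac, so P and Q
            exchange their meanings and \<open>E_triple'\<close> supplies the relation.\<close>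
          using i j w wi wj wij wji wiji m braid
            cubic_values[OF mcl[OF w] mcl[OF wi] mcl[OF wij] mcl[OF wji] mcl[OF wiji]
              E_closed[OF abc(2,3) ne(2)] E_closed[OF abc(3,2) ne(2)[symmetric]]
              E_closed[OF abc(1,2) ne(1)] E_closed[OF abc(1,3) ne(3)] E_triple'[OF abc] less]
          unfolding ij by (simp only: app adj comp_adj_adj neg)
      qed
    qed (use DsD_near cl in simp_all)
  qed
qed

end

context HSn_elements begin

section \<open>Spanning\<close>

definition D_alg :: "'a set" where
  "D_alg = generate_ring R {Dp i j | i j. 1 \<le> i \<and> i < j \<and> j \<le> n}"

lemma Dp_set_closed: "{Dp i j | i j. 1 \<le> i \<and> i < j \<and> j \<le> n} \<subseteq> carrier R"
  by (auto intro: Dp_closed)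

lemma D_alg_closed: "d \<in> D_alg \<Longrightarrow> d \<in> carrier R"
  unfolding D_alg_def by (rule generate_ring_in_carrier[OF Dp_set_closed])

lemma Dp_in_D_alg: "1 \<le> i \<Longrightarrow> i < j \<Longrightarrow> j \<le> n \<Longrightarrow> Dp i j \<in> D_alg"
  unfolding D_alg_def by (rule generate_ring.incl) blast

lemma D_alg_zero: "\<zero> \<in> D_alg"
  unfolding D_alg_def by (rule zero_in_generate)

text \<open>A sign can be absorbed by the coefficient in \<open>D_alg\<close>, so these rules
  already describe an additive subgroup.\<close>

inductive_set span :: "'a set" where
  span_zero: "\<zero> \<in> span"
| span_gen: "d \<in> D_alg \<Longrightarrow> w permutes {1..n} \<Longrightarrow> d \<otimes> g w \<in> span"
| span_add: "x \<in> span \<Longrightarrow> y \<in> span \<Longrightarrow> x \<oplus> y \<in> span"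

lemma span_closed: "x \<in> span \<Longrightarrow> x \<in> carrier R"
  by (induction rule: span.induct) (simp_all only: zero_closed m_closed a_closed D_alg_closed perm_rep_closed)

lemma span_uminus: "x \<in> span \<Longrightarrow> \<ominus> x \<in> span"
proof (induction rule: span.induct)
  case span_zero
  show ?case using span.span_zero by simp
next
  case (span_gen d w)
  have "\<ominus> (d \<otimes> g w) = (\<ominus> d) \<otimes> g w"
    using D_alg_closed[OF span_gen(1)] perm_rep_closed[OF span_gen(2)] by (simp add: l_minus)
  moreover have "\<ominus> d \<in> D_alg"
    using span_gen(1) unfolding D_alg_def by (rule generate_ring.a_inv)
  ultimately show ?case using span.span_gen span_gen(2) by simp
next
  case (span_add x y)
  then show ?case using span_closed span.span_add by (simp add: minus_add)
qed

lemma span_minus: "x \<in> span \<Longrightarrow> y \<in> span \<Longrightarrow> x \<ominus> y \<in> span"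
  unfolding minus_eq by (intro span_add span_uminus)

lemma span_D_alg_mult:
  assumes "x \<in> span" "d \<in> D_alg" shows "d \<otimes> x \<in> span"
  using assms(1)
proof (induction rule: span.induct)
  case span_zero
  show ?case using D_alg_closed[OF assms(2)] span.span_zero by simp
next
  case (span_gen e w)
  have "d \<otimes> (e \<otimes> g w) = (d \<otimes> e) \<otimes> g w"
    using D_alg_closed[OF assms(2)] D_alg_closed[OF span_gen(1)] perm_rep_closed[OF span_gen(2)]
    by (simp add: m_assoc)
  moreover have "d \<otimes> e \<in> D_alg"
    using assms(2) span_gen(1) unfolding D_alg_def by (rule generate_ring.eng_mult)
  ultimately show ?case using span.span_gen span_gen(2) by simp
next
  case (span_add x y)
  then show ?case using span_closed span.span_add D_alg_closed[OF assms(2)] by (simp add: r_distr)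
qed

lemma span_mult_g:
  assumes "x \<in> span" "v permutes {1..n}" shows "x \<otimes> g v \<in> span"
  using assms(1)
proof (induction rule: span.induct)
  case span_zero
  show ?case using perm_rep_closed[OF assms(2)] span.span_zero by simp
next
  case (span_gen e w)
  have "(e \<otimes> g w) \<otimes> g v = e \<otimes> g (w \<circ> v)"
    unfolding perm_rep_comp[OF span_gen(2) assms(2)]
    using D_alg_closed[OF span_gen(1)] perm_rep_closed[OF span_gen(2)] perm_rep_closed[OF assms(2)]
    by (simp add: m_assoc)
  then show ?case
    using span.span_gen[OF span_gen(1) permutes_compose[OF assms(2) span_gen(2)]] by simp
next
  case (span_add x y)
  then show ?case using span_closed span.span_add perm_rep_closed[OF assms(2)] by (simp add: l_distr)
qed

lemma g_in_span: "w permutes {1..n} \<Longrightarrow> g w \<in> span"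
  using span_gen[of \<one> w] perm_rep_closed generate_ring.one unfolding D_alg_def by fastforce

lemma g_Dp_in_span:
  assumes w: "w permutes {1..n}" and ij: "1 \<le> i" "i < j" "j \<le> n"
  shows "g w \<otimes> Dp i j \<in> span"
proof -
  have val: "w i \<in> {1..n}" "w j \<in> {1..n}" "w i \<noteq> w j"
    using perm_image[OF w, of i] perm_image[OF w, of j] ij by (simp_all add: perm_eq_iff[OF w])
  then consider "w i < w j" | "w j < w i" by linarith
  then show ?thesis
  proof cases
    case 1
    have "Dp (w i) (w j) \<in> D_alg" using val 1 by (intro Dp_in_D_alg) auto
    then show ?thesis unfolding g_Dp[OF w ij 1] by (rule span_gen[OF _ w])
  next
    case 2
    have d: "Dp (w j) (w i) \<in> D_alg" using val 2 by (intro Dp_in_D_alg) auto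
    have t: "transpose (w j) (w i) permutes {1..n}" using val by (intro transpose_perm)
    have "(\<one> \<ominus> Dp (w j) (w i)) \<otimes> g w = g w \<ominus> Dp (w j) (w i) \<otimes> g w"
      using D_alg_closed[OF d] perm_rep_closed[OF w] by (simp add: one_minus_mult)
    then show ?thesis unfolding g_Dp_reverse[OF w ij 2]
      using span_minus g_in_span[OF w] span_gen[OF d w] g_in_span[OF permutes_compose[OF w t]] by simp
  qed
qed

lemma g_D_alg_in_span:
  assumes "d \<in> D_alg" "w permutes {1..n}" shows "g w \<otimes> d \<in> span"
  using assms unfolding D_alg_def
proof (induction d arbitrary: w rule: generate_ring.induct)
  case one
  then show ?case using g_in_span perm_rep_closed by simp
next
  case (incl h)
  then show ?case using g_Dp_in_span by blast
next
  case (a_inv h)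
  then have "h \<in> carrier R" using D_alg_closed unfolding D_alg_def by blast
  then show ?case
    using span_uminus[OF a_inv.IH[OF a_inv.prems]] perm_rep_closed[OF a_inv.prems] by (simp add: r_minus)
next
  case (eng_add h1 h2)
  then have "h1 \<in> carrier R" "h2 \<in> carrier R" using D_alg_closed unfolding D_alg_def by blast+
  then show ?case
    using span_add[OF eng_add.IH(1)[OF eng_add.prems] eng_add.IH(2)[OF eng_add.prems]]
      perm_rep_closed[OF eng_add.prems] by (simp add: r_distr)
next
  case (eng_mult h1 h2)
  then have cl: "h1 \<in> carrier R" "h2 \<in> carrier R" using D_alg_closed unfolding D_alg_def by blast+
  \<comment> \<open>Moving \<open>w\<close> past \<open>h1\<close> produces other permutations as
    well, so the hypothesis for \<open>h2\<close> is needed at every permutation.\<close>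
  have "x \<otimes> h2 \<in> span" if "x \<in> span" for x
    using that
  proof (induction rule: span.induct)
    case span_zero
    show ?case using cl span.span_zero by simp
  next
    case (span_gen e v)
    then have "e \<otimes> (g v \<otimes> h2) \<in> span" by (intro span_D_alg_mult eng_mult.IH(2))
    then show ?case
      using cl D_alg_closed[OF span_gen(1)] perm_rep_closed[OF span_gen(2)] by (simp add: m_assoc)
  next
    case (span_add x y)
    then show ?case using span_closed span.span_add cl by (simp add: l_distr)
  qed
  from this[OF eng_mult.IH(1)[OF eng_mult.prems]] show ?case
    using cl perm_rep_closed[OF eng_mult.prems] by (simp add: m_assoc)
qed

text \<open>Together with \<open>D_mult_span\<close> and the membership of 1, this puts every word
  in the generators into \<open>span\<close>, by prepending one letter at a time.\<close>

lemma s_mult_span: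
  assumes i: "i \<in> {1..<n}" and "x \<in> span" shows "s i \<otimes> x \<in> span"
  using assms(2)
proof (induction rule: span.induct)
  case span_zero
  show ?case using s_mem[OF i] span.span_zero by simp
next
  case (span_gen d w)
  have "s i \<otimes> d \<otimes> g w \<in> span"
    using span_mult_g[OF g_D_alg_in_span[OF span_gen(1) adj_permutes[OF i]] span_gen(2)]
    by (simp only: perm_rep_adj[OF i])
  then show ?case
    using s_mem[OF i] D_alg_closed[OF span_gen(1)] perm_rep_closed[OF span_gen(2)] by (simp add: m_assoc)
next
  case (span_add x y)
  then show ?case using span_closed span.span_add s_mem[OF i] by (simp add: r_distr)
qed

lemma D_mult_span:
  assumes i: "i \<in> {1..<n}" and "x \<in> span" shows "D i \<otimes> x \<in> span"
  using span_D_alg_mult[OF assms(2) Dp_in_D_alg[of i "Suc i"]] i by (simp add: Dp_adjacent)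

section \<open>Coefficients\<close>

definition single :: "'a \<Rightarrow> (nat \<Rightarrow> nat) \<Rightarrow> (nat \<Rightarrow> nat) \<Rightarrow> 'a" where
  "single y u = (\<lambda>w\<in>carrier (sym_group n). if w = u then y else \<zero>)"

lemma single_apply: "w permutes {1..n} \<Longrightarrow> single y u w = (if w = u then y else \<zero>)"
  by (simp add: single_def sym_group_carrier)

lemma single_closed: "y \<in> carrier R \<Longrightarrow> single y u \<in> carrier fun_module"
  by (simp add: carrier_fun_module single_def)

lemma fun_module_eqI:
  assumes "m \<in> carrier fun_module" "m' \<in> carrier fun_module"
    and "\<And>w. w permutes {1..n} \<Longrightarrow> m w = m' w"
  shows "m = m'"
  by (rule extensionalityI[where A = "carrier (sym_group n)"])
     (use assms in \<open>simp_all add: carrier_fun_module PiE_iff sym_group_carrier\<close>)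

text \<open>A right action: products in \<open>Endo\<close> apply the left factor first. It is
  assumed here and obtained for H(S_n) from its presentation.\<close>

context
  fixes \<rho>
  assumes \<rho>: "\<rho> \<in> ring_hom R Endo"
    and \<rho>_s: "\<And>i. i \<in> {1..<n} \<Longrightarrow> \<rho> (s i) = op_s i"
    and \<rho>_D: "\<And>i. i \<in> {1..<n} \<Longrightarrow> \<rho> (D i) = op_D i"
begin

lemma \<rho>_closed: "x \<in> carrier R \<Longrightarrow> m \<in> carrier fun_module \<Longrightarrow> \<rho> x m \<in> carrier fun_module"
  using ring_hom_closed[OF \<rho>] by (rule Endo_apply_closed)

lemma \<rho>_mult: "x \<in> carrier R \<Longrightarrow> y \<in> carrier R \<Longrightarrow> m \<in> carrier fun_module \<Longrightarrow> \<rho> (x \<otimes> y) m = \<rho> y (\<rho> x m)"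
  by (simp add: ring_hom_mult[OF \<rho>] right_endo_ring_apply)

lemma \<rho>_add:
  "x \<in> carrier R \<Longrightarrow> y \<in> carrier R \<Longrightarrow> m \<in> carrier fun_module \<Longrightarrow> w permutes {1..n} \<Longrightarrow>
    \<rho> (x \<oplus> y) m w = \<rho> x m w \<oplus> \<rho> y m w"
  by (simp only: ring_hom_add[OF \<rho>] right_endo_ring_apply fun_module_mult)

lemma \<rho>_g:
  assumes "v permutes {1..n}" "m \<in> carrier fun_module" "w permutes {1..n}"
  shows "\<rho> (g v) m w = m (w \<circ> inv' v)"
  using assms(1,3)
proof (induction v arbitrary: w rule: permutes_adj_induct)
  case id
  show ?case by (simp only: perm_rep_id ring_hom_one[OF \<rho>] right_endo_ring_apply[OF assms(2)] inv_id comp_id)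
next
  case (adj v i)
  note g = perm_rep_closed[OF adj(1)] s_mem[OF adj(2)]
  have "inv' (v \<circ> adj i) = inv' (adj i) \<circ> inv' v"
    using permutes_bij[OF adj(1)] permutes_bij[OF adj_permutes[OF adj(2)]] by (rule o_inv_distrib)
  moreover have "inv' (adj i) = adj i" by (simp add: adj_def)
  ultimately have inv: "inv' (v \<circ> adj i) = adj i \<circ> inv' v" by simp
  have "\<rho> (g (v \<circ> adj i)) m w = op_s i (\<rho> (g v) m) w"
    by (simp only: perm_rep_comp_adj[OF adj(1,2)] \<rho>_mult[OF g assms(2)] \<rho>_s[OF adj(2)])
  also have "\<dots> = \<rho> (g v) m (w \<circ> adj i)"
    by (rule op_s_apply[OF \<rho>_closed[OF g(1) assms(2)] adj.prems])
  also have "\<dots> = m (w \<circ> inv' (v \<circ> adj i))"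
    unfolding adj.IH[OF comp_adj_permutes[OF adj.prems adj(2)]] inv by (simp only: comp_assoc)
  finally show ?case .
qed

lemma \<rho>_g_single:
  assumes v: "v permutes {1..n}" and y: "y \<in> carrier R" and u: "u permutes {1..n}"
  shows "\<rho> (g v) (single y u) = single y (u \<circ> v)"
proof (rule fun_module_eqI)
  fix w assume w: "w permutes {1..n}"
  have "w \<circ> inv' v = u \<longleftrightarrow> w = u \<circ> v"
    using permutes_inv_o[OF v] by (metis comp_assoc comp_id)
  then show "\<rho> (g v) (single y u) w = single y (u \<circ> v) w"
    by (simp only: \<rho>_g[OF v single_closed[OF y] w] single_apply[OF w]
        single_apply[OF permutes_compose[OF permutes_inv[OF v] w]])
qed (use \<rho>_closed[OF perm_rep_closed[OF v] single_closed[OF y]] single_closed[OF y] in simp_all)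

text \<open>A correction would have to come from \<open>u\<close> descending at \<open>i\<close>,
  which the last hypothesis excludes; only the coefficient changes.\<close>

lemma \<rho>_D_single:
  assumes i: "i \<in> {1..<n}" and y: "y \<in> carrier R" and u: "u permutes {1..n}" and lt: "u i < u (Suc i)"
  shows "\<rho> (D i) (single y u) = single (y \<otimes> Dp (u i) (u (Suc i))) u"
proof (rule fun_module_eqI)
  have d: "Dp (u i) (u (Suc i)) \<in> carrier R"
    using perm_image[OF u, of i] perm_image[OF u, of "Suc i"] i lt by (intro Dp_closed) simp_all
  then show "single (y \<otimes> Dp (u i) (u (Suc i))) u \<in> carrier fun_module"
    using y by (intro single_closed m_closed)
  fix w assume w: "w permutes {1..n}"
  have E: "E (w i) (w (Suc i)) \<in> carrier R" using i by (intro E_perm_closed[OF w]) auto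
  have "(if w i < w (Suc i) then single y u (w \<circ> adj i) else \<zero>) = \<zero>"
  proof -
    have "w \<circ> adj i \<noteq> u" if "w i < w (Suc i)"
    proof
      assume "w \<circ> adj i = u"
      then have "u i = w (Suc i)" "u (Suc i) = w i" by auto
      then show False using lt that by simp
    qed
    then show ?thesis
      by (simp only: single_apply[OF comp_adj_permutes[OF w i]] if_False split: if_split) auto
  qed
  then show "\<rho> (D i) (single y u) w = single (y \<otimes> Dp (u i) (u (Suc i))) u w"
    unfolding \<rho>_D[OF i] op_D_apply[OF single_closed[OF y] w] single_apply[OF w]
    using E d y lt by (cases "w = u") (simp_all add: E_def minus_eq)
qed (rule \<rho>_closed[OF D_mem[OF i] single_closed[OF y]])

text \<open>The three factors of \<open>Dp\<close> carry the support from \<open>id\<close> to the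
  transposition, multiply the coefficient there, where the pair is in order, and carry the support
  back.\<close>

lemma \<rho>_Dp_single:
  assumes ij: "1 \<le> i" "i < j" "j \<le> n" and y: "y \<in> carrier R"
  shows "\<rho> (Dp i j) (single y id) = single (y \<otimes> Dp i j) id"
proof -
  let ?t = "transpose (Suc i) j"
  have t: "?t permutes {1..n}" using ij by (intro transpose_perm) auto
  have i: "i \<in> {1..<n}" using ij by auto
  note cl = perm_rep_closed[OF t] D_mem[OF i]
  have val: "?t i = i" "?t (Suc i) = j" using ij by auto
  have "\<rho> (Dp i j) (single y id) = \<rho> (g ?t) (\<rho> (D i) (\<rho> (g ?t) (single y id)))"
    unfolding Dp_def using cl \<rho>_mult single_closed[OF y] \<rho>_closed by simp
  also have "\<dots> = single (y \<otimes> Dp i j) (?t \<circ> ?t)"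
    using \<rho>_D_single[OF i y t] ij \<rho>_g_single[OF t _ t] Dp_closed[OF ij] y
    by (simp only: \<rho>_g_single[OF t y permutes_id] id_comp val m_closed)
  finally show ?thesis by (simp only: transpose_comp_involutory)
qed

text \<open>On sums supported at \<open>id\<close> each D_ij acts without correction and keeps the
  support, so products do as well; \<open>y\<close> is general because the second factor meets the
  coefficient left by the first.\<close>

lemma \<rho>_D_alg_single:
  assumes "d \<in> D_alg" "y \<in> carrier R"
  shows "\<rho> d (single y id) = single (y \<otimes> d) id"
  using assms unfolding D_alg_def
proof (induction d arbitrary: y rule: generate_ring.induct)
  case one
  then show ?case
    by (simp add: ring_hom_one[OF \<rho>] right_endo_ring_apply single_closed)
next
  case (incl h)
  then show ?case using \<rho>_Dp_single by blast
next
  case (a_inv h)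
  interpret En: ring Endo by (rule ring_Endo)
  have h: "h \<in> carrier R" using a_inv.hyps D_alg_closed unfolding D_alg_def by blast
  note y = a_inv.prems
  show ?case
  proof (rule fun_module_eqI)
    fix w assume w: "w permutes {1..n}"
    have "\<zero> = \<rho> (h \<oplus> \<ominus> h) (single y id) w"
      using h ring_hom_zero[OF \<rho> ring_axioms ring_Endo] single_closed[OF y]
      by (simp only: r_neg right_endo_ring_apply fun_module_one[OF w])
    also have "\<dots> = single (y \<otimes> h) id w \<oplus> \<rho> (\<ominus> h) (single y id) w"
      using h by (simp only: \<rho>_add[OF _ _ single_closed[OF y] w] a_inv.IH[OF y] a_inv_closed)
    finally have eq: "\<rho> (\<ominus> h) (single y id) w \<oplus> single (y \<otimes> h) id w = \<zero>"
      using fun_module_closed[OF \<rho>_closed[OF a_inv_closed[OF h] single_closed[OF y]] w]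
        fun_module_closed[OF single_closed[OF m_closed[OF y h]] w] a_comm by simp
    then have "\<rho> (\<ominus> h) (single y id) w = \<ominus> single (y \<otimes> h) id w"
      using fun_module_closed[OF \<rho>_closed[OF a_inv_closed[OF h] single_closed[OF y]] w]
        fun_module_closed[OF single_closed[OF m_closed[OF y h]] w]
      by (metis minus_equality)
    then show "\<rho> (\<ominus> h) (single y id) w = single (y \<otimes> \<ominus> h) id w"
      using y h unfolding single_apply[OF w] by (simp add: r_minus)
  qed (use h y \<rho>_closed single_closed in simp_all)
next
  case (eng_add h1 h2)
  then have h: "h1 \<in> carrier R" "h2 \<in> carrier R" using D_alg_closed unfolding D_alg_def by blast+
  note y = eng_add.prems
  show ?case
  proof (rule fun_module_eqI)
    fix w assume w: "w permutes {1..n}"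
    show "\<rho> (h1 \<oplus> h2) (single y id) w = single (y \<otimes> (h1 \<oplus> h2)) id w"
      unfolding \<rho>_add[OF h single_closed[OF y] w] eng_add.IH[OF y] single_apply[OF w]
      using h y by (simp add: r_distr)
  qed (use h y \<rho>_closed single_closed in simp_all)
next
  case (eng_mult h1 h2)
  then have "h1 \<in> carrier R" "h2 \<in> carrier R" using D_alg_closed unfolding D_alg_def by blast+
  then show ?case
    using eng_mult by (simp add: \<rho>_mult single_closed m_assoc)
qed

lemma coefficients:
  obtains coef where
    "\<And>w x. w permutes {1..n} \<Longrightarrow> x \<in> carrier R \<Longrightarrow> coef w x \<in> carrier R"
    "\<And>w x y. w permutes {1..n} \<Longrightarrow> x \<in> carrier R \<Longrightarrow> y \<in> carrier R \<Longrightarrow> coef w (x \<oplus> y) = coef w x \<oplus> coef w y"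
    "\<And>w d u. w permutes {1..n} \<Longrightarrow> d \<in> D_alg \<Longrightarrow> u permutes {1..n} \<Longrightarrow>
      coef w (d \<otimes> g u) = (if w = u then d else \<zero>)"
proof
  let ?coef = "\<lambda>w x. \<rho> x (single \<one> id) w"
  have one: "single \<one> id \<in> carrier fun_module" by (rule single_closed) simp
  show "?coef w x \<in> carrier R" if "w permutes {1..n}" "x \<in> carrier R" for w x
    using fun_module_closed[OF \<rho>_closed[OF that(2) one] that(1)] .
  show "?coef w (x \<oplus> y) = ?coef w x \<oplus> ?coef w y"
    if "w permutes {1..n}" "x \<in> carrier R" "y \<in> carrier R" for w x y
    using \<rho>_add[OF that(2,3) one that(1)] .
  show "?coef w (d \<otimes> g u) = (if w = u then d else \<zero>)"
    if w: "w permutes {1..n}" and d: "d \<in> D_alg" and u: "u permutes {1..n}" for w d u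
  proof -
    note cl = D_alg_closed[OF d] perm_rep_closed[OF u]
    have "\<rho> (d \<otimes> g u) (single \<one> id) = \<rho> (g u) (single d id)"
      using \<rho>_mult[OF cl one] \<rho>_D_alg_single[OF d one_closed] cl by simp
    also have "\<dots> = single d u"
      using \<rho>_g_single[OF u cl(1) permutes_id] by (simp only: id_comp)
    finally show ?thesis by (simp only: single_apply[OF w])
  qed
qed

end

end

section \<open>The algebra \<open>H(S\<^sub>n)\<close>\<close>

abbreviation HSn_free :: "nat \<Rightarrow> (HSn_gen list \<Rightarrow>\<^sub>0 int) ring" where
  "HSn_free n \<equiv> free_algebra (HSn_gens n)"

abbreviation HSn_proj :: "nat \<Rightarrow> (HSn_gen list \<Rightarrow>\<^sub>0 int) \<Rightarrow> (HSn_gen list \<Rightarrow>\<^sub>0 int) set" where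
  "HSn_proj n x \<equiv> HSn_ideal n +>\<^bsub>HSn_free n\<^esub> x"

lemma HSn_proj_hom: "HSn_proj n \<in> ring_hom (HSn_free n) (HSn n)"
  unfolding HSn_def by (rule ideal.rcos_ring_hom[OF HSn_ideal_is_ideal])

lemma carrier_HSnE:
  assumes "x \<in> carrier (HSn n)"
  obtains c where "c \<in> carrier (HSn_free n)" "x = HSn_proj n c"
  using assms unfolding HSn_def FactRing_def A_RCOSETS_def' by auto

lemma free_gens_closed:
  assumes "i \<in> {1..<n}"
  shows "free_var (Gen_s i) \<in> carrier (HSn_free n)" "free_var (Gen_D i) \<in> carrier (HSn_free n)"
  using assms by (auto intro!: free_var_in_carrier simp: HSn_gens_def)

lemma free_relators_subset:
  "HSn_relators (HSn_free n) n (\<lambda>i. free_var (Gen_s i)) (\<lambda>i. free_var (Gen_D i)) \<subseteq> carrier (HSn_free n)"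
  by (intro HSn_relators_in_carrier ring_free_algebra free_gens_closed)

lemma HSn_elements_HSn: "HSn_elements (HSn n) n (HSn_s n) (HSn_D n)"
proof -
  interpret F: ring "HSn_free n" by (rule ring_free_algebra)
  have mem: "HSn_s n i \<in> carrier (HSn n)" "HSn_D n i \<in> carrier (HSn n)" if "i \<in> {1..<n}" for i
    unfolding HSn_s_def HSn_D_def by (intro ring_hom_closed[OF HSn_proj_hom] free_gens_closed that)+
  have "HSn_proj n ` HSn_relators (HSn_free n) n (\<lambda>i. free_var (Gen_s i)) (\<lambda>i. free_var (Gen_D i))
      = HSn_relators (HSn n) n (HSn_s n) (HSn_D n)"
    by (rule HSn_relators_image[OF ring_free_algebra ring_HSn HSn_proj_hom])
       (use free_gens_closed in \<open>simp_all add: HSn_s_def HSn_D_def\<close>)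
  moreover have "HSn_proj n r = \<zero>\<^bsub>HSn n\<^esub>"
    if "r \<in> HSn_relators (HSn_free n) n (\<lambda>i. free_var (Gen_s i)) (\<lambda>i. free_var (Gen_D i))" for r
  proof -
    have "r \<in> HSn_ideal n"
      using F.genideal_self[OF free_relators_subset] that unfolding HSn_ideal_def Let_def by blast
    then show ?thesis
      using F.a_rcos_zero[OF HSn_ideal_is_ideal] by (simp add: HSn_def FactRing_def)
  qed
  ultimately have "HSn_relators (HSn n) n (HSn_s n) (HSn_D n) \<subseteq> {\<zero>\<^bsub>HSn n\<^esub>}" by blast
  then show ?thesis
    using mem ring_HSn by (simp add: HSn_elements_def HSn_elements_axioms_def)
qed

lemma HSn_hom_exists:
  assumes "HSn_elements R n s D"
  obtains \<rho> where "\<rho> \<in> ring_hom (HSn n) R"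
    "\<And>i. i \<in> {1..<n} \<Longrightarrow> \<rho> (HSn_s n i) = s i" "\<And>i. i \<in> {1..<n} \<Longrightarrow> \<rho> (HSn_D n i) = D i"
proof -
  interpret HSn_elements R n s D by fact
  interpret F: ring "HSn_free n" by (rule ring_free_algebra)
  define gen where "gen = (\<lambda>a. case a of Gen_s i \<Rightarrow> s i | Gen_D i \<Rightarrow> D i)"
  have gen: "gen a \<in> carrier R" if "a \<in> HSn_gens n" for a
    using that s_mem D_mem by (auto simp: gen_def HSn_gens_def)
  define f where "f = (\<lambda>l. foldr (\<lambda>a x. gen a \<otimes>\<^bsub>R\<^esub> x) l \<one>\<^bsub>R\<^esub>)"
  have f_closed: "f l \<in> carrier R" if "l \<in> lists (HSn_gens n)" for l
    using that gen by (induction l) (auto simp: f_def)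
  have f_append: "f (l @ l') = f l \<otimes>\<^bsub>R\<^esub> f l'" if "l \<in> lists (HSn_gens n)" "l' \<in> lists (HSn_gens n)" for l l'
    using that(1)
  proof (induction l)
    case Nil
    then show ?case using f_closed[OF that(2)] by (simp add: f_def)
  next
    case (Cons a l)
    have "f (a # l @ l') = gen a \<otimes>\<^bsub>R\<^esub> f (l @ l')" "f (a # l) = gen a \<otimes>\<^bsub>R\<^esub> f l" by (simp_all add: f_def)
    then show ?case
      using Cons f_closed[of l] f_closed[OF that(2)] gen[of a] by (simp add: m_assoc)
  qed
  have "f \<in> hom (free_monoid (HSn_gens n)) R" "f \<one>\<^bsub>free_monoid (HSn_gens n)\<^esub> = \<one>\<^bsub>R\<^esub>"
    using f_closed f_append by (auto simp: hom_def free_monoid_def f_def)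
  then obtain h where h: "h \<in> ring_hom (HSn_free n) R"
    and hf: "\<And>l. l \<in> lists (HSn_gens n) \<Longrightarrow> h (frag_of l) = f l"
  proof (rule monoid_ring_hom_exists[OF monoid_free_monoid ring_axioms])
    fix h
    assume "h \<in> ring_hom (monoid_ring (free_monoid (HSn_gens n))) R"
      and "\<And>l. l \<in> carrier (free_monoid (HSn_gens n)) \<Longrightarrow> h (frag_of l) = f l"
    then show thesis by (intro that) (simp_all add: free_algebra_def free_monoid_def)
  qed
  interpret h: ring_hom_ring "HSn_free n" R h
    using ring_hom_ringI2[OF ring_free_algebra ring_axioms h] .
  have h_gen: "h (free_var a) = gen a" if "a \<in> HSn_gens n" for a
    using hf[of "[a]"] gen[OF that] that by (simp add: free_var_def f_def)
  have h_s: "h (free_var (Gen_s i)) = s i" and h_D: "h (free_var (Gen_D i)) = D i" if "i \<in> {1..<n}" for i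
    using h_gen that by (simp_all add: HSn_gens_def gen_def)
  have "h ` HSn_relators (HSn_free n) n (\<lambda>i. free_var (Gen_s i)) (\<lambda>i. free_var (Gen_D i))
      = HSn_relators R n s D"
    by (rule HSn_relators_image[OF ring_free_algebra ring_axioms h])
       (use free_gens_closed h_s h_D in simp_all)
  then have "HSn_relators (HSn_free n) n (\<lambda>i. free_var (Gen_s i)) (\<lambda>i. free_var (Gen_D i))
      \<subseteq> a_kernel (HSn_free n) R h"
    using relators free_relators_subset unfolding a_kernel_def' by blast
  then have "HSn_ideal n \<subseteq> a_kernel (HSn_free n) R h"
    unfolding HSn_ideal_def Let_def by (rule F.genideal_minimal[OF h.kernel_is_ideal])
  then have "h x = \<zero>\<^bsub>R\<^esub>" if "x \<in> HSn_ideal n" for x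
    using subsetD[OF _ that] unfolding a_kernel_def' by blast
  then obtain k where k: "k \<in> ring_hom (HSn n) R"
    and kh: "\<And>x. x \<in> carrier (HSn_free n) \<Longrightarrow> k (HSn_proj n x) = h x"
    using ideal.quotient_universal[OF HSn_ideal_is_ideal ring_axioms h] unfolding HSn_def by blast
  show thesis
    by (rule that[OF k])
       (use kh free_gens_closed h_s h_D in \<open>simp_all add: HSn_s_def HSn_D_def\<close>)
qed

section \<open>Identification of the defined objects, and the isomorphism\<close>

context
  fixes n :: nat
begin

interpretation H: HSn_elements "HSn n" n "HSn_s n" "HSn_D n"
  by (rule HSn_elements_HSn)

lemma HSn_span:
  assumes "x \<in> carrier (HSn n)" shows "x \<in> H.span"
proof -
  obtain c where c: "c \<in> carrier (HSn_free n)" "x = HSn_proj n c"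
    using assms by (rule carrier_HSnE)
  interpret proj: ring_hom_ring "HSn_free n" "HSn n" "HSn_proj n"
    by (rule ring_hom_ringI2[OF ring_free_algebra ring_HSn HSn_proj_hom])
  have "HSn_proj n c \<in> H.span"
    using c(1) unfolding free_algebra_def
  proof (induction c rule: monoid_ring_induct)
    case zero
    have "\<zero>\<^bsub>HSn_free n\<^esub> = 0" by (simp add: free_algebra_def monoid_ring_def)
    then show ?case using proj.hom_zero H.span_zero unfolding free_algebra_def by simp
  next
    case (gen l)
    then have "l \<in> lists (HSn_gens n)" by (simp add: free_monoid_def)
    then have "HSn_proj n (frag_of l) \<in> H.span"
    proof (induction l)
      case Nil
      have "frag_of [] = \<one>\<^bsub>HSn_free n\<^esub>" by (simp add: free_algebra_def monoid_ring_def free_monoid_def)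
      then show ?case
        using proj.hom_one H.g_in_span[OF permutes_id] by (simp only: H.perm_rep_id)
    next
      case (Cons a l)
      have "frag_of (a # l) = free_var a \<otimes>\<^bsub>HSn_free n\<^esub> frag_of l"
        by (simp add: free_var_def free_algebra_def mult_monoid_ring_frag_of) (simp add: free_monoid_def)
      moreover have "free_var a \<in> carrier (HSn_free n)" using Cons.hyps by (intro free_var_in_carrier)
      moreover have "frag_of l \<in> carrier (HSn_free n)"
        using Cons.hyps by (simp add: free_algebra_def carrier_monoid_ring free_monoid_def)
      ultimately have "HSn_proj n (frag_of (a # l)) = HSn_proj n (free_var a) \<otimes>\<^bsub>HSn n\<^esub> HSn_proj n (frag_of l)"
        by simp
      moreover have "HSn_proj n (free_var a) \<otimes>\<^bsub>HSn n\<^esub> HSn_proj n (frag_of l) \<in> H.span"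
      proof -
        from Cons.hyps consider i where "i \<in> {1..<n}" "a = Gen_s i" | i where "i \<in> {1..<n}" "a = Gen_D i"
          unfolding HSn_gens_def by blast
        then show ?thesis
        proof cases
          case 1
          show ?thesis
            unfolding 1(2) HSn_s_def[of n, symmetric] by (rule H.s_mult_span[OF 1(1) Cons.IH])
        next
          case 2
          show ?thesis
            unfolding 2(2) HSn_D_def[of n, symmetric] by (rule H.D_mult_span[OF 2(1) Cons.IH])
        qed
      qed
      ultimately show ?case by simp
    qed
    then show ?case unfolding free_algebra_def .
  next
    case (diff a b)
    have ab: "a \<in> carrier (HSn_free n)" "b \<in> carrier (HSn_free n)"
      using diff by (simp_all add: free_algebra_def)
    have "a - b \<in> carrier (HSn_free n)"
      using ab keys_diff[of a b] by (auto simp: free_algebra_def carrier_monoid_ring)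
    moreover have "a = (a - b) \<oplus>\<^bsub>HSn_free n\<^esub> b" by (simp add: free_algebra_def add_monoid_ring)
    ultimately have "HSn_proj n a = HSn_proj n (a - b) \<oplus>\<^bsub>HSn n\<^esub> HSn_proj n b"
      "HSn_proj n (a - b) \<in> carrier (HSn n)" "HSn_proj n b \<in> carrier (HSn n)"
      using ab proj.hom_add[of "a - b" b] by simp_all
    then have "HSn_proj n (a - b) = HSn_proj n a \<ominus>\<^bsub>HSn n\<^esub> HSn_proj n b"
      by (simp add: H.minus_eq H.a_assoc H.r_neg)
    then show ?case
      using H.span_minus diff unfolding free_algebra_def by simp
  qed
  then show ?thesis by (simp add: c(2))
qed

lemma finite_sym_group: "finite (carrier (sym_group n))"
  unfolding sym_group_def by (simp add: finite_permutations)

text \<open>Resolves the definite description. Existence is the universal property of the monoid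
  ring applied to the multiplicative map \<open>H.g\<close>; the values at adjacent transpositions
  determine those at all permutations, and additivity determines the rest.\<close>

lemma group_ring_to_HSn:
  shows group_ring_to_HSn_hom: "group_ring_to_HSn n \<in> ring_hom (group_ring_Sn n) (HSn n)"
    and group_ring_to_HSn_frag_of: "w permutes {1..n} \<Longrightarrow> group_ring_to_HSn n (frag_of w) = H.g w"
proof -
  let ?P = "\<lambda>f. f \<in> ring_hom (group_ring_Sn n) (HSn n) \<and>
      f \<in> extensional (carrier (group_ring_Sn n)) \<and>
      (\<forall>i\<in>{1..<n}. f (frag_of (transpose i (i + 1))) = HSn_s n i)"
  have M: "Group.monoid (sym_group n)" by (intro group.is_monoid sym_group_is_group)
  have mem: "frag_of w \<in> carrier (group_ring_Sn n)" if "w permutes {1..n}" for w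
    using that by (simp add: group_ring_Sn_def carrier_monoid_ring sym_group_carrier)
  have g: "f (frag_of w) = H.g w" if f: "?P f" and w: "w permutes {1..n}" for f w
    using w
  proof (induction rule: permutes_adj_induct)
    case id
    have "frag_of id = \<one>\<^bsub>group_ring_Sn n\<^esub>"
      by (simp only: group_ring_Sn_def one_monoid_ring sym_group_one)
    then show ?case using f ring_hom_one[of f "group_ring_Sn n" "HSn n"] by (simp only: H.perm_rep_id)
  next
    case (adj w i)
    have "frag_of (w \<circ> adj i) = frag_of w \<otimes>\<^bsub>group_ring_Sn n\<^esub> frag_of (adj i)"
      by (simp only: group_ring_Sn_def mult_monoid_ring_frag_of sym_group_mult)
    moreover have "f (frag_of (adj i)) = HSn_s n i" using f adj(2) unfolding adj_def by blast
    ultimately show ?case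
      using f ring_hom_mult[of f "group_ring_Sn n" "HSn n", OF _ mem[OF adj(1)] mem[OF adj_permutes[OF adj(2)]]]
        adj.IH by (simp only: H.perm_rep_comp_adj[OF adj(1,2)])
  qed
  obtain h where h: "h \<in> ring_hom (group_ring_Sn n) (HSn n)"
    and hg: "\<And>w. w \<in> carrier (sym_group n) \<Longrightarrow> h (frag_of w) = H.g w"
  proof (rule monoid_ring_hom_exists[OF M ring_HSn, of H.g])
    show "H.g \<in> hom (sym_group n) (HSn n)"
      using H.perm_rep_closed H.perm_rep_comp by (simp add: hom_def sym_group_carrier sym_group_mult)
  qed (auto simp: group_ring_Sn_def sym_group_one H.perm_rep_id)
  have ex: "?P (restrict h (carrier (group_ring_Sn n)))"
  proof (intro conjI ballI)
    interpret G: ring "group_ring_Sn n" by (rule ring_group_ring_Sn)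
    show "restrict h (carrier (group_ring_Sn n)) \<in> ring_hom (group_ring_Sn n) (HSn n)"
      by (rule ring_hom_memI)
         (simp_all add: ring_hom_closed[OF h] ring_hom_mult[OF h] ring_hom_add[OF h] ring_hom_one[OF h])
    fix i assume i: "i \<in> {1..<n}"
    note a = adj_permutes[OF i]
    show "restrict h (carrier (group_ring_Sn n)) (frag_of (transpose i (i + 1))) = HSn_s n i"
      using mem[OF a] hg[of "adj i"] a unfolding adj_def[symmetric]
      by (simp add: sym_group_carrier H.perm_rep_adj[OF i] del: One_nat_def)
  qed simp
  have unique: "f = restrict h (carrier (group_ring_Sn n))" if f: "?P f" for f
  proof (rule extensionalityI[where A = "carrier (group_ring_Sn n)"])
    fix c assume c: "c \<in> carrier (group_ring_Sn n)"
    have "f c = h c"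
    proof (rule free_Abelian_group_hom_eqI[where S = "carrier (sym_group n)" and G = "add_monoid (HSn n)"])
      show "f \<in> hom (free_Abelian_group (carrier (sym_group n))) (add_monoid (HSn n))"
        "h \<in> hom (free_Abelian_group (carrier (sym_group n))) (add_monoid (HSn n))"
        using ring_hom_additive f h unfolding group_ring_Sn_def add_monoid_monoid_ring[symmetric] by blast+
      show "Poly_Mapping.keys c \<subseteq> carrier (sym_group n)"
        using c by (simp add: group_ring_Sn_def carrier_monoid_ring)
      show "f (frag_of w) = h (frag_of w)" if "w \<in> carrier (sym_group n)" for w
        using g[OF f] hg[OF that] that by (simp only: sym_group_carrier)
    qed (rule H.a_group)
    then show "f c = restrict h (carrier (group_ring_Sn n)) c" using c by simp
  qed (use f in simp_all)
  have "group_ring_to_HSn n = restrict h (carrier (group_ring_Sn n))"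
    unfolding group_ring_to_HSn_def by (rule the_equality[where P = ?P]) (rule ex, rule unique)
  then have P: "?P (group_ring_to_HSn n)" using ex by simp
  then show "group_ring_to_HSn n \<in> ring_hom (group_ring_Sn n) (HSn n)" by simp
  show "group_ring_to_HSn n (frag_of w) = H.g w" if "w permutes {1..n}"
    by (rule g[OF P that])
qed

text \<open>Resolves the second definite description: \<open>H.g_Dp\<close> shows that the
  conjugates have the required property, and the same property for the transposition of i + 1 and j,
  at the pair (i, i + 1), forces the value.\<close>

lemma HSn_Dij:
  assumes ij: "1 \<le> i" "i < j" "j \<le> n" shows "HSn_Dij n (i, j) = H.Dp i j"
proof -
  let ?I = "{(i, j). 1 \<le> i \<and> i < j \<and> j \<le> n}"
  let ?P = "\<lambda>d. d \<in> extensional ?I \<and> (\<forall>i\<in>{1..<n}. d (i, i + 1) = HSn_D n i) \<and>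
    (\<forall>w i j. w permutes {1..n} \<and> 1 \<le> i \<and> i < j \<and> j \<le> n \<and> w i < w j \<longrightarrow>
       perm_to_HSn n w \<otimes>\<^bsub>HSn n\<^esub> d (i, j) \<otimes>\<^bsub>HSn n\<^esub> perm_to_HSn n (inv\<^bsub>sym_group n\<^esub> w) = d (w i, w j))"
  let ?d = "\<lambda>p\<in>?I. H.Dp (fst p) (snd p)"
  have perm: "perm_to_HSn n w = H.g w" "perm_to_HSn n (inv\<^bsub>sym_group n\<^esub> w) = H.g (inv' w)"
    if "w permutes {1..n}" for w
    using group_ring_to_HSn_frag_of[OF that] group_ring_to_HSn_frag_of[OF permutes_inv[OF that]]
      sym_group_inv_equality[of w n] that
    by (simp_all only: perm_to_HSn_def sym_group_carrier)
  have ex: "?P ?d"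
  proof (intro conjI ballI allI impI)
    show "?d (i, i + 1) = HSn_D n i" if "i \<in> {1..<n}" for i
      using that H.Dp_adjacent[OF that] by simp
    fix w i j assume a: "w permutes {1..n} \<and> 1 \<le> i \<and> i < j \<and> j \<le> n \<and> w i < w j"
    then have w: "w permutes {1..n}" and ij: "1 \<le> i" "i < j" "j \<le> n" and lt: "w i < w j" by auto
    have wij: "1 \<le> w i" "w j \<le> n"
      using H.perm_image[OF w, of i] H.perm_image[OF w, of j] ij by auto
    note cl = H.perm_rep_closed[OF w] H.perm_rep_closed[OF permutes_inv[OF w]] H.Dp_closed[OF wij(1) lt wij(2)]
    have "H.g w \<otimes>\<^bsub>HSn n\<^esub> H.Dp i j \<otimes>\<^bsub>HSn n\<^esub> H.g (inv' w)
        = H.Dp (w i) (w j) \<otimes>\<^bsub>HSn n\<^esub> (H.g w \<otimes>\<^bsub>HSn n\<^esub> (H.g (inv' w) \<otimes>\<^bsub>HSn n\<^esub> \<one>\<^bsub>HSn n\<^esub>))"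
      unfolding H.g_Dp[OF w ij lt] using cl by (simp add: H.m_assoc)
    also have "\<dots> = H.Dp (w i) (w j)"
      using cl H.g_cancel(1)[OF w, of "\<one>\<^bsub>HSn n\<^esub>"] by simp
    finally show "perm_to_HSn n w \<otimes>\<^bsub>HSn n\<^esub> ?d (i, j) \<otimes>\<^bsub>HSn n\<^esub> perm_to_HSn n (inv\<^bsub>sym_group n\<^esub> w) = ?d (w i, w j)"
      using ij lt wij by (simp only: perm[OF w]) simp
  qed simp
  have unique: "d = ?d" if d: "?P d" for d
  proof (rule extensionalityI[where A = ?I])
    fix p assume "p \<in> ?I"
    then obtain i j where p: "p = (i, j)" and ij: "1 \<le> i" "i < j" "j \<le> n" by auto
    let ?t = "transpose (Suc i) j"
    have t: "?t permutes {1..n}" using ij by (intro H.transpose_perm) auto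
    have i: "i \<in> {1..<n}" using ij by auto
    have val: "?t i = i" "?t (Suc i) = j" using ij by auto
    have "perm_to_HSn n ?t \<otimes>\<^bsub>HSn n\<^esub> d (i, Suc i) \<otimes>\<^bsub>HSn n\<^esub> perm_to_HSn n (inv\<^bsub>sym_group n\<^esub> ?t) = d (?t i, ?t (Suc i))"
      using d[THEN conjunct2, THEN conjunct2, rule_format, of ?t i "Suc i"] t ij by simp
    moreover have "d (i, Suc i) = HSn_D n i" using d i by simp
    ultimately have "d (i, j) = H.Dp i j"
      by (simp only: perm[OF t] inv_transpose_eq val H.Dp_def)
    then show "d p = ?d p" using p ij by simp
  qed (use d in simp_all)
  have "HSn_Dij n = ?d"
    unfolding HSn_Dij_def by (rule the_equality[where P = ?P]) (rule ex, rule unique)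
  then show ?thesis using ij by simp
qed

lemma carrier_DSn: "carrier (DSn n) = H.D_alg"
proof -
  have "HSn_Dij n ` {(i, j). 1 \<le> i \<and> i < j \<and> j \<le> n} = {H.Dp i j | i j. 1 \<le> i \<and> i < j \<and> j \<le> n}"
  proof -
    have "HSn_Dij n ` {(i, j). 1 \<le> i \<and> i < j \<and> j \<le> n} = (\<lambda>(i, j). H.Dp i j) ` {(i, j). 1 \<le> i \<and> i < j \<and> j \<le> n}"
      by (rule image_cong[OF refl]) (clarify, simp add: HSn_Dij)
    also have "\<dots> = {H.Dp i j | i j. 1 \<le> i \<and> i < j \<and> j \<le> n}"
      unfolding image_def Bex_def split_paired_Ex mem_Collect_eq prod.case by (simp only: conj_commute)
    finally show ?thesis .
  qed
  then show ?thesis by (simp add: DSn_def H.D_alg_def)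
qed

lemma ring_DSn: "ring (DSn n)"
proof -
  have "DSn n = (HSn n)\<lparr>carrier := H.D_alg\<rparr>" using carrier_DSn by (simp add: DSn_def)
  then show ?thesis unfolding H.D_alg_def using H.generate_ring_is_ring[OF H.Dp_set_closed] by simp
qed

lemma DSn_ops: "x \<oplus>\<^bsub>DSn n\<^esub> y = x \<oplus>\<^bsub>HSn n\<^esub> y" "\<zero>\<^bsub>DSn n\<^esub> = \<zero>\<^bsub>HSn n\<^esub>"
  by (simp_all add: DSn_def)

text \<open>The action yields coefficients in H(S_n) only. They lie in D(S_n) because they are
  additive, equal d or 0 on each product d w, and such products span.\<close>

lemma HSn_coefficients:
  obtains coef where
    "\<And>w x. w permutes {1..n} \<Longrightarrow> x \<in> carrier (HSn n) \<Longrightarrow> coef w x \<in> carrier (DSn n)"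
    "\<And>w x y. w permutes {1..n} \<Longrightarrow> x \<in> carrier (HSn n) \<Longrightarrow> y \<in> carrier (HSn n) \<Longrightarrow>
      coef w (x \<oplus>\<^bsub>HSn n\<^esub> y) = coef w x \<oplus>\<^bsub>HSn n\<^esub> coef w y"
    "\<And>w d u. w permutes {1..n} \<Longrightarrow> d \<in> carrier (DSn n) \<Longrightarrow> u permutes {1..n} \<Longrightarrow>
      coef w (d \<otimes>\<^bsub>HSn n\<^esub> H.g u) = (if w = u then d else \<zero>\<^bsub>HSn n\<^esub>)"
proof -
  have "HSn_elements H.Endo n H.op_s H.op_D"
    using H.ring_Endo H.op_s_Endo H.op_D_Endo H.op_relators
    by (simp add: HSn_elements_def HSn_elements_axioms_def)
  then obtain \<rho> where \<rho>: "\<rho> \<in> ring_hom (HSn n) H.Endo"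
    "\<And>i. i \<in> {1..<n} \<Longrightarrow> \<rho> (HSn_s n i) = H.op_s i" "\<And>i. i \<in> {1..<n} \<Longrightarrow> \<rho> (HSn_D n i) = H.op_D i"
    using HSn_hom_exists by blast
  obtain coef where closed: "\<And>w x. w permutes {1..n} \<Longrightarrow> x \<in> carrier (HSn n) \<Longrightarrow> coef w x \<in> carrier (HSn n)"
    and add: "\<And>w x y. w permutes {1..n} \<Longrightarrow> x \<in> carrier (HSn n) \<Longrightarrow> y \<in> carrier (HSn n) \<Longrightarrow>
      coef w (x \<oplus>\<^bsub>HSn n\<^esub> y) = coef w x \<oplus>\<^bsub>HSn n\<^esub> coef w y"
    and gen: "\<And>w d u. w permutes {1..n} \<Longrightarrow> d \<in> H.D_alg \<Longrightarrow> u permutes {1..n} \<Longrightarrow>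
      coef w (d \<otimes>\<^bsub>HSn n\<^esub> H.g u) = (if w = u then d else \<zero>\<^bsub>HSn n\<^esub>)"
    using H.coefficients[OF \<rho>] by blast
  have "coef w x \<in> H.D_alg" if w: "w permutes {1..n}" and x: "x \<in> carrier (HSn n)" for w x
    using HSn_span[OF x]
  proof (induction rule: H.span.induct)
    case span_zero
    have "\<zero>\<^bsub>HSn n\<^esub> = \<zero>\<^bsub>HSn n\<^esub> \<otimes>\<^bsub>HSn n\<^esub> H.g w" using H.perm_rep_closed[OF w] by simp
    then show ?case using gen[OF w H.D_alg_zero w] H.D_alg_zero by simp
  next
    case (span_gen d u)
    then show ?case using gen[OF w span_gen] H.D_alg_zero by simp
  next
    case (span_add x y)
    then show ?case
      using add[OF w H.span_closed[OF span_add(1)] H.span_closed[OF span_add(2)]]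
      by (simp add: H.D_alg_def generate_ring.eng_add)
  qed
  then show thesis using that[of coef] add gen by (simp only: carrier_DSn)
qed

text \<open>Reading off coefficients gives a left inverse of the multiplication map, hence
  injectivity; surjectivity is spanning.\<close>

lemma tensor_iso:
  "\<exists>\<phi> \<in> iso (tensor_group (add_monoid (DSn n)) (add_monoid (group_ring_Sn n))) (add_monoid (HSn n)).
     \<forall>x \<in> carrier (DSn n). \<forall>y \<in> carrier (group_ring_Sn n).
       \<phi> (pure_tensor (add_monoid (DSn n)) (add_monoid (group_ring_Sn n)) x y)
         = x \<otimes>\<^bsub>HSn n\<^esub> group_ring_to_HSn n y"
proof -
  let ?A = "add_monoid (DSn n)" and ?B = "add_monoid (group_ring_Sn n)" and ?C = "add_monoid (HSn n)"
  let ?G = "group_ring_to_HSn n"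
  interpret DS: ring "DSn n" by (rule ring_DSn)
  interpret GR: ring "group_ring_Sn n" by (rule ring_group_ring_Sn)
  interpret T: tensor_product ?A ?B
    by (intro tensor_product.intro DS.a_comm_group GR.a_comm_group)
  let ?T = "tensor_group ?A ?B"
  have D: "x \<in> carrier (HSn n)" if "x \<in> carrier (DSn n)" for x
    using that H.D_alg_closed by (simp only: carrier_DSn)
  have G: "?G y \<in> carrier (HSn n)" if "y \<in> carrier (group_ring_Sn n)" for y
    using that by (rule ring_hom_closed[OF group_ring_to_HSn_hom])
  obtain \<phi> where \<phi>: "\<phi> \<in> hom ?T ?C"
    and \<phi>_pure: "\<And>x y. x \<in> carrier ?A \<Longrightarrow> y \<in> carrier ?B \<Longrightarrow> \<phi> (T.pure x y) = x \<otimes>\<^bsub>HSn n\<^esub> ?G y"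
  proof (rule T.tensor_universal[OF H.a_comm_group, of "\<lambda>x y. x \<otimes>\<^bsub>HSn n\<^esub> ?G y"])
    show "(\<lambda>x. x \<otimes>\<^bsub>HSn n\<^esub> ?G y) \<in> hom ?A ?C" if "y \<in> carrier ?B" for y
      using that D G by (simp add: hom_def DSn_ops H.l_distr)
    show "(\<lambda>y. x \<otimes>\<^bsub>HSn n\<^esub> ?G y) \<in> hom ?B ?C" if "x \<in> carrier ?A" for x
      using that D G by (simp add: hom_def ring_hom_add[OF group_ring_to_HSn_hom] H.r_distr)
  qed blast
  obtain coef where coef: "\<And>w x. w permutes {1..n} \<Longrightarrow> x \<in> carrier (HSn n) \<Longrightarrow> coef w x \<in> carrier (DSn n)"
    and coef_add: "\<And>w x y. w permutes {1..n} \<Longrightarrow> x \<in> carrier (HSn n) \<Longrightarrow> y \<in> carrier (HSn n) \<Longrightarrow>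
      coef w (x \<oplus>\<^bsub>HSn n\<^esub> y) = coef w x \<oplus>\<^bsub>HSn n\<^esub> coef w y"
    and coef_gen: "\<And>w d u. w permutes {1..n} \<Longrightarrow> d \<in> carrier (DSn n) \<Longrightarrow> u permutes {1..n} \<Longrightarrow>
      coef w (d \<otimes>\<^bsub>HSn n\<^esub> H.g u) = (if w = u then d else \<zero>\<^bsub>HSn n\<^esub>)"
    using HSn_coefficients by blast
  let ?S = "carrier (sym_group n)"
  have mem: "frag_of w \<in> carrier ?B" if "w \<in> ?S" for w
    using that by (simp add: group_ring_Sn_def carrier_monoid_ring)
  \<comment> \<open>The candidate inverse: x goes to the sum over all w of its coefficient at w
    tensored with w. The sum is a \<open>finprod\<close> because the tensor group is written
    multiplicatively.\<close>
  define \<psi> where "\<psi> = (\<lambda>x. finprod ?T (\<lambda>w. T.pure (coef w x) (frag_of w)) ?S)"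
  have pure_coef: "T.pure (coef w x) (frag_of w) \<in> carrier ?T" if "w \<in> ?S" "x \<in> carrier (HSn n)" for w x
    using T.pure_closed coef mem that by (simp add: sym_group_carrier)
  have \<psi>_closed: "\<psi> x \<in> carrier ?T" if "x \<in> carrier (HSn n)" for x
    unfolding \<psi>_def by (rule T.T.finprod_closed) (use pure_coef that in blast)
  have "\<psi> (x \<oplus>\<^bsub>HSn n\<^esub> y) = \<psi> x \<otimes>\<^bsub>?T\<^esub> \<psi> y" if xy: "x \<in> carrier (HSn n)" "y \<in> carrier (HSn n)" for x y
  proof -
    have "\<psi> (x \<oplus>\<^bsub>HSn n\<^esub> y)
        = finprod ?T (\<lambda>w. T.pure (coef w x) (frag_of w) \<otimes>\<^bsub>?T\<^esub> T.pure (coef w y) (frag_of w)) ?S"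
      unfolding \<psi>_def
    proof (rule T.T.finprod_cong')
      fix w assume w: "w \<in> ?S"
      then have p: "w permutes {1..n}" by (simp only: sym_group_carrier)
      show "T.pure (coef w (x \<oplus>\<^bsub>HSn n\<^esub> y)) (frag_of w)
          = T.pure (coef w x) (frag_of w) \<otimes>\<^bsub>?T\<^esub> T.pure (coef w y) (frag_of w)"
        using T.pure_add_left[of "coef w x" "coef w y" "frag_of w"] coef[OF p] xy mem[OF w]
        by (simp add: coef_add[OF p xy] DSn_ops)
    qed (use pure_coef xy T.T.m_closed in blast)+
    also have "\<dots> = \<psi> x \<otimes>\<^bsub>?T\<^esub> \<psi> y"
      unfolding \<psi>_def by (rule T.T.finprod_multf) (use pure_coef xy in blast)+
    finally show ?thesis .
  qed
  then have \<psi>: "\<psi> \<in> hom ?C ?T"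
    using \<psi>_closed by (simp add: hom_def)
  have \<psi>_gen: "\<psi> (x \<otimes>\<^bsub>HSn n\<^esub> ?G (frag_of u)) = T.pure x (frag_of u)" if x: "x \<in> carrier ?A" and u: "u \<in> ?S" for x u
  proof -
    have p: "u permutes {1..n}" using u by (simp only: sym_group_carrier)
    have zero: "T.pure \<zero>\<^bsub>HSn n\<^esub> (frag_of w) = \<one>\<^bsub>?T\<^esub>" if "w \<in> ?S" for w
      using hom_one[OF T.pure_hom_left[OF mem[OF that]] DS.a_group T.T.is_group]
      by (simp add: DSn_ops)
    have "\<psi> (x \<otimes>\<^bsub>HSn n\<^esub> ?G (frag_of u)) = finprod ?T (\<lambda>w. if u = w then T.pure x (frag_of w) else \<one>\<^bsub>?T\<^esub>) ?S"
      unfolding \<psi>_def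
    proof (rule T.T.finprod_cong')
      fix w assume w: "w \<in> ?S"
      then have pw: "w permutes {1..n}" by (simp only: sym_group_carrier)
      have "coef w (x \<otimes>\<^bsub>HSn n\<^esub> ?G (frag_of u)) = (if w = u then x else \<zero>\<^bsub>HSn n\<^esub>)"
        using coef_gen[OF pw _ p, of x] x by (simp only: group_ring_to_HSn_frag_of[OF p]) simp
      then show "T.pure (coef w (x \<otimes>\<^bsub>HSn n\<^esub> ?G (frag_of u))) (frag_of w)
          = (if u = w then T.pure x (frag_of w) else \<one>\<^bsub>?T\<^esub>)"
        using zero[OF w] by simp
    qed (use T.pure_closed[OF x mem] T.T.one_closed in auto)
    also have "\<dots> = T.pure x (frag_of u)"
      by (rule T.T.finprod_singleton[OF u finite_sym_group]) (use T.pure_closed[OF x mem] in auto)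
    finally show ?thesis .
  qed
  have \<psi>_pure: "\<psi> (\<phi> (T.pure x y)) = T.pure x y" if x: "x \<in> carrier ?A" and y: "y \<in> carrier ?B" for x y
  proof -
    \<comment> \<open>Both sides are additive in \<open>y\<close>, so by freeness only the basis
      elements \<open>frag_of w\<close> remain to be compared.\<close>
    have B: "?B = free_Abelian_group ?S" unfolding group_ring_Sn_def by (rule add_monoid_monoid_ring)
    have hom: "(\<lambda>y. \<psi> (\<phi> (T.pure x y))) \<in> hom ?B ?T"
      using Group.hom_compose[OF Group.hom_compose[OF T.pure_hom_right[OF x] \<phi>] \<psi>] by (simp add: comp_def)
    show ?thesis
    proof (rule free_Abelian_group_hom_eqI[OF T.T.is_group, where S = ?S and h = "\<lambda>y. \<psi> (\<phi> (T.pure x y))"])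
      show "(\<lambda>y. \<psi> (\<phi> (T.pure x y))) \<in> hom (free_Abelian_group ?S) ?T"
        unfolding B[symmetric] by (rule hom)
      show "T.pure x \<in> hom (free_Abelian_group ?S) ?T"
        unfolding B[symmetric] by (rule T.pure_hom_right[OF x])
      show "Poly_Mapping.keys y \<subseteq> ?S"
        using y[unfolded B] by simp
      show "\<psi> (\<phi> (T.pure x (frag_of w))) = T.pure x (frag_of w)" if "w \<in> ?S" for w
        by (simp only: \<phi>_pure[OF x mem[OF that]] \<psi>_gen[OF x that])
    qed
  qed
  have inverse: "\<psi> (\<phi> t) = t" if t: "t \<in> carrier ?T" for t
    using T.tensor_hom_eqI[OF T.T.is_group Group.hom_compose[OF \<phi> \<psi>], of "\<lambda>t. t" t] \<psi>_pure t
    by (simp add: hom_def)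
  have "inj_on \<phi> (carrier ?T)" using inverse by (rule inj_on_inverseI)
  moreover have "\<phi> ` carrier ?T = carrier ?C"
  proof
    show "\<phi> ` carrier ?T \<subseteq> carrier ?C" using \<phi> by (auto simp: hom_def)
    have "x \<in> \<phi> ` carrier ?T" if "x \<in> H.span" for x
      using that
    proof (induction rule: H.span.induct)
      case span_zero
      have "\<phi> \<one>\<^bsub>?T\<^esub> = \<zero>\<^bsub>HSn n\<^esub>" using hom_one[OF \<phi> T.T.is_group H.a_group] by simp
      then show ?case using T.T.one_closed by (metis imageI)
    next
      case (span_gen d w)
      have w: "w \<in> ?S" and d: "d \<in> carrier ?A" using span_gen by (simp_all add: sym_group_carrier carrier_DSn)
      have "\<phi> (T.pure d (frag_of w)) = d \<otimes>\<^bsub>HSn n\<^esub> H.g w"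
        using \<phi>_pure[OF d mem[OF w]] by (simp only: group_ring_to_HSn_frag_of[OF span_gen(2)])
      then show ?case using T.pure_closed[OF d mem[OF w]] by (metis imageI)
    next
      case (span_add x y)
      then obtain t t' where "t \<in> carrier ?T" "t' \<in> carrier ?T" "x = \<phi> t" "y = \<phi> t'" by blast
      then have "x \<oplus>\<^bsub>HSn n\<^esub> y = \<phi> (t \<otimes>\<^bsub>?T\<^esub> t')" "t \<otimes>\<^bsub>?T\<^esub> t' \<in> carrier ?T"
        using hom_mult[OF \<phi>, of t t'] T.T.m_closed by simp_all
      then show ?case by (rule image_eqI)
    qed
    then show "carrier ?C \<subseteq> \<phi> ` carrier ?T" using HSn_span by auto
  qed
  ultimately have "\<phi> \<in> iso ?T ?C" using \<phi> by (simp add: iso_def bij_betw_def)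
  then show ?thesis using \<phi>_pure by (intro bexI[of _ \<phi>]) simp_all
qed

end

theorem proposition1p6:
  fixes n :: nat
  assumes "n \<ge> 2"
  shows "\<exists>\<phi> \<in> iso (tensor_group (add_monoid (DSn n)) (add_monoid (group_ring_Sn n)))
                  (add_monoid (HSn n)).
           \<forall>x \<in> carrier (DSn n). \<forall>y \<in> carrier (group_ring_Sn n).
             \<phi> (pure_tensor (add_monoid (DSn n)) (add_monoid (group_ring_Sn n)) x y)
               = x \<otimes>\<^bsub>HSn n\<^esub> group_ring_to_HSn n y"
  by (rule tensor_iso)

end
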